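(* Let $d\ge 2$ and let $\omega=(\omega_x)_{x\in\mathbb{Z}^d}$ be i.i.d. real weights such that (i) there exist $\nu>1$ and $c>0$ with $\mathbb{P}(\omega_x<-t)<e^{-ct^\nu}$ for all $t>0$; and (ii) $\Lambda(t)=\log\mathbb{E}[e^{t\omega_x}]$ is finite in some open interval about $0$ and $\mu<\sup_{t\ge 0}\Lambda'(t)$, where $\mu$ is the time constant. Fix $\epsilon>0$. Then there is $C_\epsilon>0$ such that for all sufficiently large $n$, any path $\gamma\in\Gamma_n$ with $|D(\gamma)|>\epsilon n$ satisfies $$\frac{\mathbb{P}(\gamma\in\Gamma_n^* )}{\mathbb{P}(\gamma^{\ulcorner}\in\Gamma_n^* )}\le C_\epsilon e^{-n/C_\epsilon}.$$
   Context: Directed last passage percolation on $\mathbb{Z}^d$: a directed path is a finite sequence of vertices whose successive increments lie in $\{e_1,\dots,e_d\}$. $\Gamma_n$ is the set of directed paths from $0$ to $(n,\dots,n)\in\mathbb{Z}^d$. The passage time of a path is $L(\gamma)=\sum_{x\in\gamma}\omega_x$ (all vertices, endpoints included), $L_n=\max_{\gamma\in\Gamma_n}L(\gamma)$, and $\Gamma_n^*=\{\gamma\in\Gamma_n: L(\gamma)=L_n\}$ is the set of geodesics. The time constant $\mu$ is the almost sure limit $\mu=\lim_{n\to\infty}L_n/(dn)$. The supremum of $\Lambda'$ is over $t\ge 0$ where $\Lambda$ is finite and differentiable. A vertex $x\in\gamma$ is a corner of $\gamma\in\Gamma_n$ if $x-e_{i_1},\,x+e_{i_2}\in\gamma$ for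 some $i_1\ne i_2$; $D(\gamma)$ is the set of corners of $\gamma$. $\gamma^{\ulcorner}\in\Gamma_n$ is the corner path made of straight segments $(0,\dots,0)\to(0,\dots,0,n)\to(0,\dots,0,n,n)\to\cdots\to(n,\dots,n)$. *)

theory Defs
  imports "HOL-Probability.Probability"
begin

definition directed_path :: "(int ^ 'd) list \<Rightarrow> bool" where
  "directed_path \<gamma> \<longleftrightarrow> successively (\<lambda>x y. \<exists>i. y - x = axis i 1) \<gamma>"

definition paths :: "nat \<Rightarrow> (int ^ 'd) list set" where
  "paths n = {\<gamma>. \<gamma> \<noteq> [] \<and> directed_path \<gamma> \<and> hd \<gamma> = 0 \<and> last \<gamma> = (\<chi> i. int n)}"

definition passage_time :: "(int ^ 'd \<Rightarrow> 'a \<Rightarrow> real) \<Rightarrow> (int ^ 'd) list \<Rightarrow> 'a \<Rightarrow> real" where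
  "passage_time \<omega> \<gamma> w = (\<Sum>x\<in>set \<gamma>. \<omega> x w)"

definition last_passage_time :: "(int ^ 'd \<Rightarrow> 'a \<Rightarrow> real) \<Rightarrow> nat \<Rightarrow> 'a \<Rightarrow> real" where
  "last_passage_time \<omega> n w = Max ((\<lambda>\<gamma>. passage_time \<omega> \<gamma> w) ` paths n)"

definition geodesics :: "(int ^ 'd \<Rightarrow> 'a \<Rightarrow> real) \<Rightarrow> nat \<Rightarrow> 'a \<Rightarrow> (int ^ 'd) list set" where
  "geodesics \<omega> n w = {\<gamma> \<in> paths n. passage_time \<omega> \<gamma> w = last_passage_time \<omega> n w}"

definition is_time_constant :: "'a measure \<Rightarrow> (int ^ 'd \<Rightarrow> 'a \<Rightarrow> real) \<Rightarrow> real \<Rightarrow> bool" where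
  "is_time_constant M \<omega> \<mu> \<longleftrightarrow>
     (AE w in M. (\<lambda>n. last_passage_time \<omega> n w / (real CARD('d) * real n)) \<longlonglongrightarrow> \<mu>)"

definition corners :: "(int ^ 'd) list \<Rightarrow> (int ^ 'd) set" where
  "corners \<gamma> = {x \<in> set \<gamma>. \<exists>i j. i \<noteq> j \<and> x - axis i 1 \<in> set \<gamma> \<and> x + axis j 1 \<in> set \<gamma>}"

text \<open>The coordinates are traversed from the largest index to the smallest; while coordinate
  \<open>i\<close> moves from 0 to \<open>n\<close>, the larger ones are already \<open>n\<close> and the smaller ones still 0.\<close>

definition corner_path :: "nat \<Rightarrow> (int ^ 'd::{finite,linorder}) list" where
  "corner_path n = 0 # concat (map
     (\<lambda>i. map (\<lambda>m. \<chi> j. if i < j then int n else if j = i then int m else 0) [1..<Suc n])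
     (rev (sorted_list_of_set UNIV)))"

text \<open>The Bochner integral is 0 where the exponential moment is infinite, so the value of
  \<open>cgf\<close> is meaningful only on \<open>cgf_domain\<close>.\<close>

definition cgf_domain :: "'a measure \<Rightarrow> ('a \<Rightarrow> real) \<Rightarrow> real set" where
  "cgf_domain M X = {t. integrable M (\<lambda>w. exp (t * X w))}"

definition cgf :: "'a measure \<Rightarrow> ('a \<Rightarrow> real) \<Rightarrow> real \<Rightarrow> real" where
  "cgf M X t = ln (\<integral>w. exp (t * X w) \<partial>M)"

text \<open>Differentiability at \<open>t\<close> presupposes finiteness near \<open>t\<close>, whence the interior; the
  supremum may be infinite.\<close>

definition sup_cgf_deriv :: "'a measure \<Rightarrow> ('a \<Rightarrow> real) \<Rightarrow> ereal" where
  "sup_cgf_deriv M X =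
     (SUP t \<in> {t. 0 \<le> t \<and> t \<in> interior (cgf_domain M X) \<and> cgf M X differentiable (at t)}.
        ereal (deriv (cgf M X) t))"

lemma corner_path_prefix:
  fixes ds es :: "'d::{finite,linorder} list" and n :: nat
  assumes "ds @ es = rev (sorted_list_of_set UNIV)"
  defines "f \<equiv> \<lambda>i. map (\<lambda>m. (\<chi> j. if i < j then int n else if j = i then int m else 0) :: int ^ 'd::{finite,linorder}) [1..<Suc n]"
  shows "directed_path (0 # concat (map f ds)) \<and>
         last (0 # concat (map f ds)) = (\<chi> j. if j \<in> set ds then int n else 0)"
  using assms(1)
proof (induction ds arbitrary: es rule: rev_induct)
  case Nil
  show ?case by (simp add: directed_path_def vec_eq_iff)
next
  case (snoc i ds)
  have eq: "ds @ (i # es) = rev (sorted_list_of_set UNIV)" using snoc.prems by simp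
  note IH = snoc.IH[OF eq]
  have srt: "sorted (rev (ds @ i # es))" "distinct (ds @ i # es)" "set (ds @ i # es) = UNIV"
    unfolding eq by auto
  have ds: "set ds = {j. i < j}"
  proof (intro equalityI subsetI CollectI)
    show "i < j" if "j \<in> set ds" for j
      using srt(1,2) that by (auto simp: sorted_append order.strict_iff_order)
    show "j \<in> set ds" if "j \<in> {j. i < j}" for j
    proof (rule ccontr)
      assume "j \<notin> set ds"
      moreover have "j \<in> set (ds @ i # es)" using srt(3) by blast
      ultimately have "j \<in> set es" using that by auto
      then have "j \<le> i" using srt(1) by (auto simp: sorted_append)
      with that show False by simp
    qed
  qed
  define p where "p m = ((\<chi> j. if i < j then int n else if j = i then int m else 0) :: (int, 'd) vec)" for m
  have fi: "f i = map p [1..<Suc n]" by (simp add: f_def p_def)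
  have p0: "last (0 # concat (map f ds)) = p 0"
    using IH by (auto simp: ds p_def vec_eq_iff)
  have step: "p (Suc m) - p m = axis i 1" for m
    by (auto simp: p_def vec_eq_iff axis_def)
  have succ: "successively (\<lambda>x y. \<exists>i. y - x = axis i 1) (map p [a..<b])" for a b
    by (auto simp: successively_conv_nth simp del: upt_Suc intro: step)
  show ?case
  proof (cases "n = 0")
    case True
    then show ?thesis using IH by (simp add: f_def vec_eq_iff)
  next
    case False
    then have ne: "f i \<noteq> []" "hd (f i) = p 1" "last (f i) = p n"
      by (auto simp: fi hd_map last_map simp del: upt_Suc)
    have "directed_path ((0 # concat (map f ds)) @ f i)"
      unfolding directed_path_def successively_append_iff
      using IH succ[of 1 "Suc n", folded fi] ne step[of 0] p0
      by (auto simp only: directed_path_def One_nat_def)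
    moreover have "last ((0 # concat (map f ds)) @ f i) = p n"
      using ne by simp
    moreover have "p n = (\<chi> j. if j \<in> set (ds @ [i]) then int n else 0)"
      by (auto simp: ds p_def vec_eq_iff)
    ultimately show ?thesis by simp
  qed
qed

lemma corner_path_in_paths: "corner_path n \<in> paths n"
  using corner_path_prefix[of "rev (sorted_list_of_set UNIV)" "[]" n]
  by (simp add: paths_def corner_path_def vec_eq_iff del: upt_Suc)

lemma sum_axis: "(\<Sum>j\<in>UNIV. axis i 1 $ j) = (1::int)" for i :: "'d::finite"
  by (simp add: axis_def)

lemma directed_path_sum:
  fixes \<gamma> :: "(int ^ 'd::finite) list"
  assumes "directed_path \<gamma>" "k < length \<gamma>"
  shows "(\<Sum>j\<in>UNIV. (\<gamma> ! k) $ j) = (\<Sum>j\<in>UNIV. (\<gamma> ! 0) $ j) + int k"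
  using assms(2)
proof (induction k)
  case (Suc k)
  obtain i where "\<gamma> ! Suc k - \<gamma> ! k = axis i 1"
    using assms(1) Suc.prems by (auto simp: directed_path_def successively_conv_nth)
  then have "\<gamma> ! Suc k = \<gamma> ! k + axis i 1" by (metis diff_add_cancel add.commute)
  then show ?case using Suc by (simp add: sum.distrib sum_axis)
qed simp

lemma paths_length:
  fixes \<gamma> :: "(int ^ 'd::finite) list"
  assumes "\<gamma> \<in> paths n"
  shows "length \<gamma> = Suc (CARD('d) * n)"
proof -
  have ne: "\<gamma> \<noteq> []" and d: "directed_path \<gamma>" and h: "\<gamma> ! 0 = 0"
    and l: "\<gamma> ! (length \<gamma> - 1) = (\<chi> i. int n)"
    using assms by (auto simp: paths_def hd_conv_nth last_conv_nth)
  have "int CARD('d) * int n = int (length \<gamma> - 1)"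
    using directed_path_sum[OF d, of "length \<gamma> - 1"] ne by (simp add: h l[simplified])
  then have "CARD('d) * n = length \<gamma> - 1" by (metis of_nat_eq_iff of_nat_mult)
  then show ?thesis using ne by (cases \<gamma>) auto
qed

lemma paths_distinct:
  fixes \<gamma> :: "(int ^ 'd::finite) list"
  assumes "\<gamma> \<in> paths n"
  shows "distinct \<gamma>"
  unfolding distinct_conv_nth
proof (intro allI impI notI)
  fix k l assume *: "k < length \<gamma>" "l < length \<gamma>" "k \<noteq> l" "\<gamma> ! k = \<gamma> ! l"
  have "directed_path \<gamma>" using assms by (simp add: paths_def)
  from directed_path_sum[OF this *(1)] directed_path_sum[OF this *(2)] *(3,4) show False by simp
qed

lemma paths_card:
  fixes \<gamma> :: "(int ^ 'd::finite) list"
  assumes "\<gamma> \<in> paths n"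
  shows "card (set \<gamma>) = Suc (CARD('d) * n)"
  using paths_length[OF assms] paths_distinct[OF assms] by (simp add: distinct_card)

lemma finite_directed_paths:
  "finite {\<gamma> :: (int ^ 'd::finite) list. length \<gamma> = Suc k \<and> directed_path \<gamma> \<and> hd \<gamma> = 0}"
proof (induction k)
  case 0
  have "{\<gamma> :: (int ^ 'd) list. length \<gamma> = Suc 0 \<and> directed_path \<gamma> \<and> hd \<gamma> = 0} \<subseteq> {[0]}"
    by (auto simp: length_Suc_conv)
  then show ?case by (rule finite_subset) simp
next
  case (Suc k)
  let ?P = "\<lambda>k. {\<gamma> :: (int ^ 'd) list. length \<gamma> = Suc k \<and> directed_path \<gamma> \<and> hd \<gamma> = 0}"
  have "\<gamma> \<in> (\<lambda>(\<gamma>, i). \<gamma> @ [last \<gamma> + axis i 1]) ` (?P k \<times> UNIV)" if mem: "\<gamma> \<in> ?P (Suc k)" for \<gamma>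
  proof -
    obtain \<gamma>' x where g: "\<gamma> = \<gamma>' @ [x]" using mem by (cases \<gamma> rule: rev_exhaust) auto
    with mem have ne: "\<gamma>' \<noteq> []" by auto
    with mem g obtain i where i: "x - last \<gamma>' = axis i 1"
      by (auto simp: directed_path_def successively_append_iff)
    then have "x = last \<gamma>' + axis i 1" by (metis diff_add_cancel add.commute)
    moreover have "\<gamma>' \<in> ?P k"
      using mem g ne by (auto simp: directed_path_def successively_append_iff)
    ultimately show ?thesis using g by force
  qed
  then have "?P (Suc k) \<subseteq> (\<lambda>(\<gamma>, i). \<gamma> @ [last \<gamma> + axis i 1]) ` (?P k \<times> UNIV)"
    by (rule subsetI)
  moreover have "finite ((\<lambda>(\<gamma>, i). \<gamma> @ [last \<gamma> + axis i 1]) ` (?P k \<times> (UNIV :: 'd set)))"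
    by (intro finite_imageI finite_cartesian_product Suc.IH finite)
  ultimately show ?case by (rule finite_subset)
qed

lemma finite_paths: "finite (paths n :: (int ^ 'd::finite) list set)"
proof (rule finite_subset[OF _ finite_directed_paths[of "CARD('d) * n"]])
  show "paths n \<subseteq> {\<gamma> :: (int ^ 'd) list. length \<gamma> = Suc (CARD('d) * n) \<and> directed_path \<gamma> \<and> hd \<gamma> = 0}"
    using paths_length by (auto simp: paths_def)
qed

lemma geodesics_iff:
  fixes \<gamma> :: "(int ^ 'd::finite) list"
  assumes "\<gamma> \<in> paths n"
  shows "\<gamma> \<in> geodesics \<omega> n w \<longleftrightarrow> (\<forall>\<gamma>'\<in>paths n. passage_time \<omega> \<gamma>' w \<le> passage_time \<omega> \<gamma> w)"
proof -
  have "passage_time \<omega> \<gamma> w \<le> last_passage_time \<omega> n w"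
    using assms by (simp add: last_passage_time_def finite_paths)
  then have "\<gamma> \<in> geodesics \<omega> n w \<longleftrightarrow> last_passage_time \<omega> n w \<le> passage_time \<omega> \<gamma> w"
    using assms by (auto simp: geodesics_def)
  moreover have "last_passage_time \<omega> n w \<le> c \<longleftrightarrow> (\<forall>\<gamma>'\<in>paths n. passage_time \<omega> \<gamma>' w \<le> c)" for c
    unfolding last_passage_time_def using assms by (subst Max_le_iff) (auto simp: finite_paths)
  ultimately show ?thesis by blast
qed

lemma (in real_distribution) exists_median:
  "\<exists>m. measure M {..m} > 0 \<and> measure M {m..} > 0"
proof -
  define B where "B = {x. 1/2 \<le> cdf M x}"
  have "eventually (\<lambda>x. cdf M x > 1/2) at_top"
    using order_tendstoD(1)[OF cdf_lim_at_top_prob, of "1/2"] by simp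
  then obtain x0 where "cdf M x0 > 1/2" by (auto simp: eventually_at_top_linorder)
  then have ne: "B \<noteq> {}" by (auto simp: B_def intro!: exI[of _ x0])
  have "eventually (\<lambda>x. cdf M x < 1/2) at_bot"
    using order_tendstoD(2)[OF cdf_lim_at_bot, of "1/2"] by simp
  then obtain b where b: "cdf M x < 1/2" if "x \<le> b" for x by (auto simp: eventually_at_bot_linorder)
  have bdd: "bdd_below B"
  proof (rule bdd_belowI[of _ b])
    show "b \<le> x" if "x \<in> B" for x
      using b[of x] that by (cases "x \<le> b") (auto simp: B_def)
  qed
  define m where "m = Inf B"
  have up: "cdf M x \<ge> 1/2" if mx: "x > m" for x
  proof -
    obtain y where "y \<in> B" "y < x" using cInf_lessD[OF ne mx[unfolded m_def]] by blast
    then show ?thesis using cdf_nondecreasing[of y x] by (simp add: B_def)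
  qed
  have lo: "cdf M x \<le> 1/2" if "x < m" for x
  proof (rule ccontr)
    assume "\<not> cdf M x \<le> 1/2"
    then have "x \<in> B" by (simp add: B_def)
    then have "m \<le> x" unfolding m_def using bdd by (rule cInf_lower)
    with that show False by simp
  qed
  have "cdf M m \<ge> 1/2"
  proof (rule tendsto_lowerbound)
    show "(cdf M \<longlongrightarrow> cdf M m) (at_right m)"
      using cdf_is_right_cont by (simp add: continuous_within)
    show "\<forall>\<^sub>F x in at_right m. 1/2 \<le> cdf M x"
      using up by (auto simp: eventually_at_filter)
  qed simp
  moreover have "measure M {..<m} \<le> 1/2"
  proof (rule tendsto_upperbound)
    show "(cdf M \<longlongrightarrow> measure M {..<m}) (at_left m)" by (rule cdf_at_left)
    show "\<forall>\<^sub>F x in at_left m. cdf M x \<le> 1/2"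
      using lo by (auto simp: eventually_at_filter)
  qed simp
  moreover have "measure M {m..} = 1 - measure M {..<m}"
  proof -
    have "{m..} = space M - {..<m}" by auto
    then show ?thesis using prob_compl[of "{..<m}"] by simp
  qed
  ultimately show ?thesis by (intro exI[of _ m]) (auto simp: cdf_def)
qed

text \<open>The probability of the corner path being a geodesic never vanishes, so that quotients by it
  are genuine.\<close>

lemma corner_path_geodesic_pos:
  fixes \<omega> :: "int ^ 'd::{finite,linorder} \<Rightarrow> 'a \<Rightarrow> real"
  assumes "prob_space M"
    and indep: "prob_space.indep_vars M (\<lambda>_. borel) \<omega> UNIV"
    and ident: "\<And>x y. distr M borel (\<omega> x) = distr M borel (\<omega> y)"
  shows "measure M {w \<in> space M. corner_path n \<in> geodesics \<omega> n w} > 0"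
proof -
  interpret prob_space M by fact
  have rv[measurable]: "random_variable borel (\<omega> x)" for x
    using indep by (auto simp: indep_vars_def)
  interpret D: real_distribution "distr M borel (\<omega> 0)" by (rule real_distribution_distr) (rule rv)
  obtain m where m: "measure (distr M borel (\<omega> 0)) {..m} > 0" "measure (distr M borel (\<omega> 0)) {m..} > 0"
    using D.exists_median by blast
  let ?c = "corner_path n :: (int, 'd) vec list"
  define A where "A x = (if x \<in> set ?c then {m..} else {..m})" for x
  have A[measurable]: "A x \<in> sets borel" for x by (auto simp: A_def)
  define S :: "(int, 'd) vec set" where "S = (\<Union>\<gamma>\<in>paths n. set \<gamma>)"
  have "finite S" by (simp add: S_def finite_paths)
  moreover have "S \<noteq> {}"
    using corner_path_in_paths[of n, where 'a = 'd] by (auto simp: S_def paths_def)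
  ultimately have S: "finite S" "S \<noteq> {}" by auto
  have "prob (\<omega> x -` A x \<inter> space M) > 0" for x
  proof -
    have "prob (\<omega> x -` A x \<inter> space M) = measure (distr M borel (\<omega> x)) (A x)"
      by (simp add: measure_distr)
    also have "\<dots> = measure (distr M borel (\<omega> 0)) (A x)" by (simp only: ident[of x 0])
    also have "\<dots> > 0" using m by (simp add: A_def)
    finally show ?thesis .
  qed
  then have "0 < (\<Prod>x\<in>S. prob (\<omega> x -` A x \<inter> space M))" by (intro prod_pos) auto
  also have "\<dots> = prob (\<Inter>x\<in>S. \<omega> x -` A x \<inter> space M)"
    using indep_varsD[OF indep, of S A] S by auto
  also have "\<dots> \<le> prob {w \<in> space M. ?c \<in> geodesics \<omega> n w}"
  proof (rule finite_measure_mono)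
    show "(\<Inter>x\<in>S. \<omega> x -` A x \<inter> space M) \<subseteq> {w \<in> space M. ?c \<in> geodesics \<omega> n w}"
    proof (intro subsetI CollectI conjI)
      fix w assume w: "w \<in> (\<Inter>x\<in>S. \<omega> x -` A x \<inter> space M)"
      then show "w \<in> space M" using S by auto
      have hi: "\<omega> x w \<ge> m" if "x \<in> set ?c" for x
      proof -
        have "x \<in> S" using that corner_path_in_paths by (auto simp: S_def)
        then have "w \<in> \<omega> x -` A x" using w by blast
        with that show ?thesis by (simp add: A_def)
      qed
      have "passage_time \<omega> \<gamma> w \<le> passage_time \<omega> ?c w" if g: "\<gamma> \<in> paths n" for \<gamma>
      proof -
        have lo: "\<omega> x w \<le> m" if "x \<in> set \<gamma> - set ?c" for x
        proof -
          have "x \<in> S" using that g by (auto simp: S_def)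
          then have "w \<in> \<omega> x -` A x" using w by blast
          with that show ?thesis by (simp add: A_def)
        qed
        have cards: "card (set \<gamma> - set ?c) = card (set ?c - set \<gamma>)"
          using paths_card[OF g] paths_card[OF corner_path_in_paths[of n, where 'a = 'd]]
          by (simp add: card_Diff_subset_Int Int_commute)
        have "passage_time \<omega> \<gamma> w = (\<Sum>x\<in>set \<gamma> \<inter> set ?c. \<omega> x w) + (\<Sum>x\<in>set \<gamma> - set ?c. \<omega> x w)"
          unfolding passage_time_def by (rule sum.Int_Diff) simp
        also have "(\<Sum>x\<in>set \<gamma> - set ?c. \<omega> x w) \<le> (\<Sum>x\<in>set \<gamma> - set ?c. m)"
          by (intro sum_mono lo)
        also have "\<dots> = (\<Sum>x\<in>set ?c - set \<gamma>. m)" using cards by simp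
        also have "\<dots> \<le> (\<Sum>x\<in>set ?c - set \<gamma>. \<omega> x w)" by (intro sum_mono hi) auto
        also have "(\<Sum>x\<in>set \<gamma> \<inter> set ?c. \<omega> x w) + \<dots> = passage_time \<omega> ?c w"
          unfolding passage_time_def by (subst Int_commute) (rule sum.Int_Diff[symmetric], simp)
        finally show ?thesis by simp
      qed
      then show "?c \<in> geodesics \<omega> n w"
        by (simp add: geodesics_iff[OF corner_path_in_paths])
    qed
    have "{w \<in> space M. ?c \<in> geodesics \<omega> n w} =
          {w \<in> space M. \<forall>\<gamma>\<in>paths n. passage_time \<omega> \<gamma> w \<le> passage_time \<omega> ?c w}"
      by (simp only: geodesics_iff[OF corner_path_in_paths])
    also have "\<dots> \<in> sets M"
      unfolding passage_time_def by (intro sets.sets_Collect_finite_All finite_paths) measurable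
    finally show "{w \<in> space M. ?c \<in> geodesics \<omega> n w} \<in> sets M" .
  qed
  finally show ?thesis .
qed

end

(* A path is a geodesic only if its passage time is close to d * mu * n, up to an event of probability exp (- R * n) for
   every R (many disjoint tubes of diagonal blocks, together with the superexponential lower tail). With r the minimiser of
   Lambda t - t * mu, the exponential Markov inequality bounds the probability of a large passage time by
   exp (d * n * (Lambda r - r * mu)). Each corner of the path moreover forces the vertex obtained by flipping it to have at most
   the weight of the corner, which costs a factor smaller than 1; flips at different corners are different vertices since they
   lie on different levels.

   For the corner path the rate d * (Lambda r - r * mu) is attained: tilt its weights to a mean slightly above mu. Competing paths
   decompose into excursions around the turning points, which pass through untilted weights and therefore gain at most about mu
   per step, in every direction and on every scale. Harris' inequality combines the O(log n) dyadic scales at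
   polynomial cost. *)
theory Submission
  imports Defs "HOL-Real_Asymp.Real_Asymp"
begin

text \<open>The upper bound for \<open>\<gamma>\<close> and the lower bound for the corner path
  share the rate \<open>Y = D * (L r - r * \<mu>)\<close>, so all other losses only have to stay
  below the gain from the corners. As \<open>Y\<close> may be very negative, an atypically small
  last passage time has to be negligible against every exponential. A single tube yields only some
  exponential rate, but for d at least 2 there is room for any number of them, and by \<nu> > 1 the
  boundedly many vertices that join them to the end points rarely spoil this. The corner path is
  singled out because the directed path between two points of a straight segment is unique: a
  competitor can leave it only around one of d - 1 fixed vertices, so the constraints cost a
  constant factor per scale. An excursion need not go in the diagonal direction, the only one of
  which \<mu> speaks; symmetry under coordinate permutations closes this gap. The slope condition
  enters twice: it provides tilts whose mean exceeds \<mu>, which leaves room for a threshold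
  \<open>A\<close> between the two, and it rules out constant weights, whence the factor below 1 at
  each corner.\<close>

section \<open>Directed paths\<close>

text \<open>The list in \<open>steps\<close> omits the starting vertex, so that concatenation of paths is
  concatenation of lists and weights add up.\<close>

definition steps :: "int ^ 'd \<Rightarrow> (int ^ 'd) list \<Rightarrow> int ^ 'd \<Rightarrow> bool" where
  "steps x \<pi> y \<longleftrightarrow> directed_path (x # \<pi>) \<and> last (x # \<pi>) = y"

definition wt :: "('v \<Rightarrow> real) \<Rightarrow> 'v list \<Rightarrow> real" where
  "wt \<sigma> \<pi> = sum_list (map \<sigma> \<pi>)"

text \<open>The time parameter of a directed path: every step raises it by one. It fixes the length
  of all paths between two given points and makes two paths from 0 meet only at equal
  indices.\<close>

definition level :: "int ^ 'd::finite \<Rightarrow> int" where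
  "level x = (\<Sum>i\<in>UNIV. x $ i)"

definition diag :: "nat \<Rightarrow> int ^ 'd" where
  "diag n = (\<chi> i. int n)"

definition box_set :: "int ^ 'd \<Rightarrow> int ^ 'd \<Rightarrow> (int ^ 'd) set" where
  "box_set x y = {z. \<forall>i. x $ i \<le> z $ i \<and> z $ i \<le> y $ i}"

lemma wt_simps [simp]: "wt \<sigma> [] = 0" "wt \<sigma> (x # \<pi>) = \<sigma> x + wt \<sigma> \<pi>" "wt \<sigma> (\<pi> @ \<rho>) = wt \<sigma> \<pi> + wt \<sigma> \<rho>"
  by (auto simp: wt_def)

lemma wt_cong: "(\<And>x. x \<in> set \<pi> \<Longrightarrow> \<sigma> x = \<tau> x) \<Longrightarrow> wt \<sigma> \<pi> = wt \<tau> \<pi>"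
  unfolding wt_def by (intro arg_cong[where f = sum_list] map_cong) auto

lemma wt_map: "wt \<sigma> (map f \<pi>) = wt (\<lambda>x. \<sigma> (f x)) \<pi>"
  by (simp add: wt_def o_def)

lemma wt_distinct: "distinct \<pi> \<Longrightarrow> wt \<sigma> \<pi> = (\<Sum>x\<in>set \<pi>. \<sigma> x)"
  by (simp add: wt_def sum_list_distinct_conv_sum_set)

lemma wt_diff_const: "wt (\<lambda>x. \<sigma> x - A) \<pi> = wt \<sigma> \<pi> - A * length \<pi>"
  by (induction \<pi>) (auto simp: algebra_simps)

lemma wt_le_const: "(\<And>x. x \<in> set \<pi> \<Longrightarrow> \<sigma> x \<le> c) \<Longrightarrow> wt \<sigma> \<pi> \<le> c * length \<pi>"
  by (induction \<pi>) (fastforce simp: algebra_simps)+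

lemma wt_ge_const: fixes c :: real shows "(\<And>x. x \<in> set \<pi> \<Longrightarrow> c \<le> \<sigma> x) \<Longrightarrow> c * length \<pi> \<le> wt \<sigma> \<pi>"
  by (induction \<pi>) (fastforce simp: algebra_simps)+

lemma wt_mono: "(\<And>x. x \<in> set \<pi> \<Longrightarrow> \<sigma> x \<le> \<tau> x) \<Longrightarrow> wt \<sigma> \<pi> \<le> wt \<tau> \<pi>"
  by (induction \<pi>) (fastforce)+

lemma borel_measurable_wt [measurable (raw)]:
  assumes "\<And>x. x \<in> set \<pi> \<Longrightarrow> (\<lambda>w. f w x) \<in> borel_measurable M"
  shows "(\<lambda>w. wt (f w) \<pi>) \<in> borel_measurable M"
  using assms by (induction \<pi>) (auto intro!: borel_measurable_add)

lemma steps_Nil [simp]: "steps x [] y \<longleftrightarrow> x = y"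
  by (auto simp: steps_def directed_path_def)

lemma steps_Cons: "steps x (z # \<pi>) y \<longleftrightarrow> (\<exists>i. z - x = axis i 1) \<and> steps z \<pi> y"
  by (auto simp: steps_def directed_path_def)

lemma steps_append: "steps x (\<pi> @ \<rho>) z \<longleftrightarrow> (\<exists>y. steps x \<pi> y \<and> steps y \<rho> z)"
  by (induction \<pi> arbitrary: x) (auto simp: steps_Cons)

lemma steps_appendI: "steps x \<pi> y \<Longrightarrow> steps y \<rho> z \<Longrightarrow> steps x (\<pi> @ \<rho>) z"
  by (auto simp: steps_append)

lemma level_axis [simp]: "level (axis i 1) = 1"
  by (simp add: level_def sum_axis)

lemma level_simps [simp]: "level (x + y) = level x + level y" "level (x - y) = level x - level y"
  "level 0 = 0"
  by (auto simp: level_def sum.distrib sum_subtractf)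

lemma level_diag [simp]: "level (diag n :: int ^ 'd::finite) = int (CARD('d) * n)"
  by (simp add: level_def diag_def)

lemma steps_level: "steps x \<pi> y \<Longrightarrow> level y = level x + int (length \<pi>)"
proof (induction \<pi> arbitrary: x)
  case (Cons z \<pi>)
  then obtain i where "z - x = axis i 1" "steps z \<pi> y" by (auto simp: steps_Cons)
  moreover from this(1) have "level z - level x = 1" by (metis level_axis level_simps(2))
  ultimately show ?case using Cons.IH[of z] by simp
qed simp

lemma steps_le: "steps x \<pi> y \<Longrightarrow> x $ i \<le> y $ i"
proof (induction \<pi> arbitrary: x)
  case (Cons z \<pi>)
  then obtain j where "z - x = axis j 1" "steps z \<pi> y" by (auto simp: steps_Cons)
  moreover from this(1) have "z $ i - x $ i = axis j 1 $ i" by (metis vector_minus_component)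
  moreover have "axis j 1 $ i \<ge> (0 :: int)" by (simp add: axis_def)
  ultimately show ?case using Cons.IH[of z] by linarith
qed simp

lemma steps_box:
  assumes "steps x \<pi> y" "z \<in> set \<pi>"
  shows "z \<in> box_set x y - {x}"
proof -
  obtain \<pi>1 \<pi>2 where p: "\<pi> = \<pi>1 @ z # \<pi>2" using assms(2) by (meson split_list)
  then have 1: "steps x (\<pi>1 @ [z]) z" and 2: "steps z \<pi>2 y"
    using assms(1) by (auto simp: steps_append steps_Cons)
  from 1 have "level z > level x" using steps_level by fastforce
  then have "z \<noteq> x" by auto
  then show ?thesis using steps_le[OF 1] steps_le[OF 2] by (auto simp: box_set_def)
qed

lemma steps_distinct: "steps x \<pi> y \<Longrightarrow> distinct \<pi>"
proof (induction \<pi> arbitrary: x)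
  case (Cons z \<pi>)
  then have "steps z \<pi> y" by (auto simp: steps_Cons)
  then show ?case using steps_box[of z \<pi> y z] Cons.IH by auto
qed simp

lemma finite_box_set: "finite (box_set x y :: (int ^ 'd::finite) set)"
proof -
  have "vec_nth ` box_set x y \<subseteq> Pi\<^sub>E UNIV (\<lambda>i. {x $ i .. y $ i})"
    by (auto simp: box_set_def)
  then have "finite (vec_nth ` box_set x y)" by (rule finite_subset) (auto intro: finite_PiE)
  then show ?thesis by (rule finite_imageD) (auto simp: inj_on_def vec_nth_inject)
qed

lemma finite_steps: "finite {\<pi> :: (int ^ 'd::finite) list. steps x \<pi> y}"
proof (rule finite_subset)
  show "{\<pi>. steps x \<pi> y} \<subseteq> {\<pi>. set \<pi> \<subseteq> box_set x y \<and> length \<pi> = nat (level y - level x)}"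
    using steps_box steps_level by fastforce
  show "finite {\<pi>. set \<pi> \<subseteq> box_set x y \<and> length \<pi> = nat (level y - level x)}"
    by (intro finite_lists_length_eq finite_box_set)
qed

text \<open>Induction on the level gap: as long as the two points differ, some coordinate of
  \<open>x\<close> lags behind and can be advanced.\<close>

lemma steps_exist:
  fixes x y :: "int ^ 'd::finite"
  assumes "\<And>i. x $ i \<le> y $ i"
  shows "\<exists>\<pi>. steps x \<pi> y"
  using assms
proof (induction "nat (level y - level x)" arbitrary: x)
  case 0
  have "level y - level x = (\<Sum>i\<in>UNIV. y $ i - x $ i)" by (simp add: level_def sum_subtractf)
  moreover have "\<dots> \<ge> 0" using 0(2) by (intro sum_nonneg) simp
  ultimately have "(\<Sum>i\<in>UNIV. y $ i - x $ i) = 0" using 0(1) by simp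
  then have "\<forall>i\<in>UNIV. y $ i - x $ i = 0"
    using 0(2) by (subst (asm) sum_nonneg_eq_0_iff) auto
  then have "x = y" by (auto simp: vec_eq_iff)
  then show ?case by (intro exI[of _ "[]"]) simp
next
  case (Suc n)
  have "x \<noteq> y" using Suc(2) by auto
  then obtain i where i: "x $ i \<noteq> y $ i" by (auto simp: vec_eq_iff)
  define z where "z = x + axis i 1"
  have "z $ j \<le> y $ j" for j
    using Suc.prems[of j] i by (auto simp: z_def axis_def)
  moreover have "n = nat (level y - level z)" using Suc(2) by (simp add: z_def)
  ultimately obtain \<pi> where "steps z \<pi> y" using Suc(1) by blast
  then have "steps x (z # \<pi>) y" by (auto simp: steps_Cons z_def)
  then show ?case by blast
qed

lemma steps_shift: "steps x \<pi> y \<Longrightarrow> steps (x + v) (map (\<lambda>z. z + v) \<pi>) (y + v)"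
  by (induction \<pi> arbitrary: x) (auto simp: steps_Cons)

section \<open>Coordinate permutations acting on directed paths\<close>

definition permv :: "('d \<Rightarrow> 'd) \<Rightarrow> int ^ 'd \<Rightarrow> int ^ 'd" where
  "permv p x = (\<chi> i. x $ p i)"

lemma permv_nth [simp]: "permv p x $ i = x $ p i" by (simp add: permv_def)

lemma permv_diff: "permv p (x - y) = permv p x - permv p y" by (simp add: vec_eq_iff)

lemma inj_permv: "bij p \<Longrightarrow> inj (permv p)"
  by (rule injI) (metis bij_pointE permv_nth vec_eq_iff)

lemma permv_axis: "bij p \<Longrightarrow> permv p (axis i 1) = axis (inv p i) 1"
  by (auto simp: vec_eq_iff axis_def bij_inv_eq_iff)

lemma steps_permv: "bij p \<Longrightarrow> steps x \<pi> y \<Longrightarrow> steps (permv p x) (map (permv p) \<pi>) (permv p y)"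
  by (induction \<pi> arbitrary: x) (auto simp: steps_Cons permv_diff[symmetric] permv_axis)

lemma level_permv: "bij p \<Longrightarrow> level (permv p x) = level x"
  unfolding level_def permv_nth by (rule sum.reindex_bij_betw)

lemma paths_iff_steps: "\<gamma> \<in> paths n \<longleftrightarrow> (\<exists>\<pi>. \<gamma> = 0 # \<pi> \<and> steps 0 \<pi> (diag n))"
  by (cases \<gamma>) (auto simp: paths_def steps_def diag_def)

lemma passage_time_wt:
  fixes \<gamma> :: "(int ^ 'd::finite) list"
  shows "\<gamma> \<in> paths n \<Longrightarrow> passage_time \<omega> \<gamma> w = wt (\<lambda>x. \<omega> x w) \<gamma>"
  by (simp add: passage_time_def wt_distinct paths_distinct)

section \<open>Point-to-point last passage times\<close>

text \<open>By the convention of \<open>steps\<close> the weight of \<open>x\<close> is left out and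
  that of \<open>y\<close> is counted. Superadditivity therefore needs no correction at the common
  vertex, and only weights in \<open>box_set x y - {x}\<close> matter, so that consecutive blocks
  read disjoint sets of weights.\<close>

definition lpp :: "(int ^ 'd \<Rightarrow> real) \<Rightarrow> int ^ 'd \<Rightarrow> int ^ 'd \<Rightarrow> real" where
  "lpp \<sigma> x y = Max ((\<lambda>\<pi>. wt \<sigma> \<pi>) ` {\<pi>. steps x \<pi> y})"

lemma lpp_ge: "steps x \<pi> y \<Longrightarrow> wt \<sigma> \<pi> \<le> lpp \<sigma> x (y :: int ^ 'd::finite)"
  unfolding lpp_def by (rule Max_ge) (auto intro: finite_steps)

lemma lpp_attained:
  fixes x y :: "int ^ 'd::finite"
  assumes "\<And>i. x $ i \<le> y $ i"
  shows "\<exists>\<pi>. steps x \<pi> y \<and> lpp \<sigma> x y = wt \<sigma> \<pi>"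
proof -
  have "lpp \<sigma> x y \<in> (\<lambda>\<pi>. wt \<sigma> \<pi>) ` {\<pi>. steps x \<pi> y}"
    unfolding lpp_def using steps_exist[OF assms] by (intro Max_in) (auto intro: finite_steps)
  then show ?thesis by auto
qed

lemma lpp_superadd:
  fixes x y z :: "int ^ 'd::finite"
  assumes "\<And>i. x $ i \<le> y $ i" "\<And>i. y $ i \<le> z $ i"
  shows "lpp \<sigma> x y + lpp \<sigma> y z \<le> lpp \<sigma> x z"
proof -
  obtain \<pi> \<rho> where "steps x \<pi> y" "lpp \<sigma> x y = wt \<sigma> \<pi>" "steps y \<rho> z" "lpp \<sigma> y z = wt \<sigma> \<rho>"
    using lpp_attained assms by metis
  then show ?thesis using lpp_ge[OF steps_appendI, of x \<pi> y \<rho> z \<sigma>] by simp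
qed

lemma lpp_cong: "(\<And>z. z \<in> box_set x y - {x} \<Longrightarrow> \<sigma> z = \<tau> z) \<Longrightarrow> lpp \<sigma> x y = lpp \<tau> x y"
  unfolding lpp_def
  by (intro arg_cong[where f = Max] image_cong refl wt_cong) (blast dest: steps_box)

text \<open>All directed paths from \<open>x\<close> to \<open>y\<close> count the same number
  \<open>level y - level x\<close> of vertices, so a constant shift of the weights does not change
  which path is maximal.\<close>

lemma lpp_diff_const:
  fixes x y :: "int ^ 'd::finite"
  assumes "\<And>i. x $ i \<le> y $ i"
  shows "lpp (\<lambda>z. \<sigma> z - A) x y = lpp \<sigma> x y - A * (level y - level x)"
proof -
  have len: "steps x \<pi> y \<Longrightarrow> wt (\<lambda>z. \<sigma> z - A) \<pi> = wt \<sigma> \<pi> - A * (level y - level x)" for \<pi>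
    by (simp add: wt_diff_const steps_level)
  show ?thesis
    using lpp_attained[OF assms, of \<sigma>] lpp_attained[OF assms, of "\<lambda>z. \<sigma> z - A"]
      lpp_ge[of x _ y \<sigma>] lpp_ge[of x _ y "\<lambda>z. \<sigma> z - A"] len
    by (smt (verit, ccfv_SIG))
qed

lemma lpp_shift_le:
  fixes x y :: "int ^ 'd::finite"
  assumes "\<And>i. x $ i \<le> y $ i"
  shows "lpp (\<lambda>z. \<sigma> (z + v)) x y \<le> lpp \<sigma> (x + v) (y + v)"
  using lpp_attained[OF assms, of "\<lambda>z. \<sigma> (z + v)"] steps_shift lpp_ge wt_map by metis

lemma lpp_shift:
  fixes x y :: "int ^ 'd::finite"
  assumes "\<And>i. x $ i \<le> y $ i"
  shows "lpp \<sigma> (x + v) (y + v) = lpp (\<lambda>z. \<sigma> (z + v)) x y"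
  using lpp_shift_le[OF assms, of \<sigma> v] lpp_shift_le[of "x + v" "y + v" "\<lambda>z. \<sigma> (z + v)" "- v"] assms
  by simp

lemma permv_inv: "bij p \<Longrightarrow> permv (inv p) (permv p x) = x" "bij p \<Longrightarrow> permv p (permv (inv p) x) = x"
  by (auto simp: vec_eq_iff bij_is_surj surj_f_inv_f bij_is_inj inv_f_f)

lemma lpp_permv_le:
  fixes x y :: "int ^ 'd::finite"
  assumes "\<And>i. x $ i \<le> y $ i" "bij p"
  shows "lpp (\<lambda>z. \<sigma> (permv p z)) x y \<le> lpp \<sigma> (permv p x) (permv p y)"
  using lpp_attained[OF assms(1), of "\<lambda>z. \<sigma> (permv p z)"] steps_permv[OF assms(2)] lpp_ge wt_map by metis

lemma lpp_permv:
  fixes x y :: "int ^ 'd::finite"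
  assumes "\<And>i. x $ i \<le> y $ i" "bij p"
  shows "lpp \<sigma> (permv p x) (permv p y) = lpp (\<lambda>z. \<sigma> (permv p z)) x y"
  using lpp_permv_le[OF assms, of \<sigma>] assms bij_imp_bij_inv[OF assms(2)]
    lpp_permv_le[of "permv p x" "permv p y" "inv p" "\<lambda>z. \<sigma> (permv p z)"]
  by (simp add: permv_inv)

lemma borel_measurable_lpp [measurable (raw)]:
  fixes x y :: "int ^ 'd::finite"
  assumes "\<And>z. z \<in> box_set x y - {x} \<Longrightarrow> (\<lambda>w. f w z) \<in> borel_measurable M"
  shows "(\<lambda>w. lpp (f w) x y) \<in> borel_measurable M"
  unfolding lpp_def
  by (intro borel_measurable_Max finite_steps borel_measurable_wt assms) (use steps_box in blast)

lemma lpp_chain: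
  fixes s :: "nat \<Rightarrow> int ^ 'd::finite"
  assumes "\<And>k i. k < K \<Longrightarrow> s k $ i \<le> s (Suc k) $ i"
  shows "(\<Sum>k<K. lpp \<sigma> (s k) (s (Suc k))) \<le> lpp \<sigma> (s 0) (s K) \<and> (\<forall>i. s 0 $ i \<le> s K $ i)"
  using assms
proof (induction K)
  case 0
  show ?case using lpp_ge[of "s 0" "[]" "s 0" \<sigma>] by simp
next
  case (Suc K)
  have IH: "(\<Sum>k<K. lpp \<sigma> (s k) (s (Suc k))) \<le> lpp \<sigma> (s 0) (s K)" and le: "s 0 $ i \<le> s K $ i" for i
    using Suc by auto
  have le': "s K $ i \<le> s (Suc K) $ i" for i using Suc.prems by simp
  have "(\<Sum>k<Suc K. lpp \<sigma> (s k) (s (Suc k))) \<le> lpp \<sigma> (s 0) (s (Suc K))"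
    using lpp_superadd[OF le le', of \<sigma>] IH by simp
  then show ?case using order_trans[OF le le'] by blast
qed

lemma last_passage_time_lpp:
  fixes \<omega> :: "int ^ 'd::finite \<Rightarrow> 'a \<Rightarrow> real"
  shows "last_passage_time \<omega> n w = \<omega> 0 w + lpp (\<lambda>x. \<omega> x w) 0 (diag n)"
proof -
  let ?\<sigma> = "\<lambda>x. \<omega> x w"
  have "(\<lambda>\<gamma>. passage_time \<omega> \<gamma> w) ` paths n = (\<lambda>\<gamma>. wt ?\<sigma> \<gamma>) ` paths n"
    by (rule image_cong) (simp_all add: passage_time_wt)
  moreover have "paths n = (\<lambda>\<pi>. 0 # \<pi>) ` {\<pi>. steps (0 :: int ^ 'd) \<pi> (diag n)}"
    by (auto simp: paths_iff_steps)
  ultimately have eq: "(\<lambda>\<gamma>. passage_time \<omega> \<gamma> w) ` paths n = (\<lambda>r. \<omega> 0 w + r) ` (wt ?\<sigma> ` {\<pi>. steps 0 \<pi> (diag n)})"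
    by (simp only: image_image wt_simps)
  have ne: "{\<pi>. steps (0 :: int ^ 'd) \<pi> (diag n)} \<noteq> {}"
    using steps_exist[of "0 :: int ^ 'd" "diag n"] by (auto simp: diag_def)
  show ?thesis
    unfolding last_passage_time_def eq lpp_def
    using ne by (intro mono_Max_commute[symmetric]) (auto intro!: finite_steps monoI)
qed

section \<open>Products of probability measures\<close>

text \<open>A finite product measure is determined on rectangles, where the integral of a product of
  functions of single coordinates factorises. This serves to undo the exponential tilt of many
  coordinates at once.\<close>

lemma prob_density_PiM:
  fixes N :: "'i \<Rightarrow> 'b measure" and f :: "'i \<Rightarrow> 'b \<Rightarrow> ennreal"
  assumes I: "finite I" and N: "\<And>i. prob_space (N i)" "\<And>i. prob_space (density (N i) (f i))"
    and f[measurable]: "\<And>i. f i \<in> borel_measurable (N i)"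
  shows "PiM I (\<lambda>i. density (N i) (f i)) = density (PiM I N) (\<lambda>x. \<Prod>i\<in>I. f i (x i))"
proof -
  interpret N: product_prob_space N I
    using N(1) by (simp add: product_prob_space_def product_sigma_finite_def product_prob_space_axioms_def prob_space_imp_sigma_finite)
  interpret D: product_prob_space "\<lambda>i. density (N i) (f i)" I
    using N(2) by (simp add: product_prob_space_def product_sigma_finite_def product_prob_space_axioms_def prob_space_imp_sigma_finite)
  have [measurable]: "(\<lambda>x. \<Prod>i\<in>I. f i (x i)) \<in> borel_measurable (PiM I N)"
    by measurable
  show ?thesis
  proof (rule D.PiM_eqI[symmetric])
    show "sets (density (PiM I N) (\<lambda>x. \<Prod>i\<in>I. f i (x i))) = sets (PiM I (\<lambda>i. density (N i) (f i)))"
      unfolding sets_density by (rule sets_PiM_cong) auto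
    fix A assume "\<And>i. i \<in> I \<Longrightarrow> A i \<in> sets (density (N i) (f i))"
    then have A: "\<And>i. i \<in> I \<Longrightarrow> A i \<in> sets (N i)" by simp
    have "emeasure (density (PiM I N) (\<lambda>x. \<Prod>i\<in>I. f i (x i))) (Pi\<^sub>E I A) =
       (\<integral>\<^sup>+x. (\<Prod>i\<in>I. f i (x i)) * indicator (Pi\<^sub>E I A) x \<partial>PiM I N)"
      using I A by (intro emeasure_density sets_PiM_I_finite) auto
    also have "\<dots> = (\<integral>\<^sup>+x. (\<Prod>i\<in>I. f i (x i) * indicator (A i) (x i)) \<partial>PiM I N)"
      using I by (intro nn_integral_cong)
        (auto simp: prod.distrib space_PiM PiE_def extensional_def indicator_def prod_zero_iff Pi_iff)
    also have "\<dots> = (\<Prod>i\<in>I. \<integral>\<^sup>+x. f i x * indicator (A i) x \<partial>N i)"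
    proof (rule N.product_nn_integral_prod[OF I])
      fix i assume "i \<in> I"
      note A[OF this, measurable]
      show "(\<lambda>x. f i x * indicator (A i) x) \<in> borel_measurable (N i)" by measurable
    qed
    also have "\<dots> = (\<Prod>i\<in>I. emeasure (density (N i) (f i)) (A i))"
      using A by (intro prod.cong refl) (simp add: emeasure_density)
    finally show "emeasure (density (PiM I N) (\<lambda>x. \<Prod>i\<in>I. f i (x i))) (Pi\<^sub>E I A) =
       (\<Prod>i\<in>I. emeasure (density (N i) (f i)) (A i))" .
  qed (rule I)
qed

text \<open>The nonnegative quantity \<open>(f x - f y) * (g x - g y)\<close> is integrated over two
  independent copies, in \<open>x\<close> first and then in \<open>y\<close>, so that no product
  space is needed.\<close>

lemma (in prob_space) chebyshev_integral:
  fixes f g :: "'a \<Rightarrow> real"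
  assumes [measurable]: "f \<in> borel_measurable M" "g \<in> borel_measurable M"
    and f: "\<And>x. x \<in> space M \<Longrightarrow> \<bar>f x\<bar> \<le> B" and g: "\<And>x. x \<in> space M \<Longrightarrow> \<bar>g x\<bar> \<le> B"
    and co: "\<And>x y. x \<in> space M \<Longrightarrow> y \<in> space M \<Longrightarrow> 0 \<le> (f x - f y) * (g x - g y)"
  shows "(\<integral>x. f x \<partial>M) * (\<integral>x. g x \<partial>M) \<le> (\<integral>x. f x * g x \<partial>M)"
proof -
  have if': "integrable M f" and ig: "integrable M g"
    using f g by (auto intro!: integrable_const_bound[where B = B])
  have ifg: "integrable M (\<lambda>x. f x * g x)"
    using f g by (intro integrable_const_bound[where B = "B * B"]) (auto simp: abs_mult intro!: mult_mono AE_I2 order_trans[OF abs_ge_zero])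
  define F where "F = (\<integral>x. f x \<partial>M)"
  define G where "G = (\<integral>x. g x \<partial>M)"
  define H where "H = (\<integral>x. f x * g x \<partial>M)"
  have 1: "0 \<le> H - f y * G - g y * F + f y * g y" if "y \<in> space M" for y
  proof -
    have "0 \<le> (\<integral>x. (f x - f y) * (g x - g y) \<partial>M)"
      using co that by (intro integral_nonneg_AE AE_I2) auto
    also have "\<dots> = (\<integral>x. f x * g x - f y * g x - g y * f x + f y * g y \<partial>M)"
      by (simp add: algebra_simps)
    also have "\<dots> = H - f y * G - g y * F + f y * g y"
      using if' ig ifg by (simp add: F_def G_def H_def prob_space)
    finally show ?thesis .
  qed
  have "0 \<le> (\<integral>y. H - f y * G - g y * F + f y * g y \<partial>M)"
    by (intro integral_nonneg_AE AE_I2 1)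
  also have "\<dots> = H - F * G - G * F + H"
    using if' ig ifg by (simp add: F_def G_def H_def prob_space)
  finally show ?thesis by (simp add: F_def G_def H_def)
qed

text \<open>Harris' inequality. Each coordinate carries its own total preorder \<open>le i\<close>, so that a function may be
  increasing in some coordinates and decreasing in the others.\<close>

lemma harris_integral:
  fixes N :: "'i \<Rightarrow> 'b measure" and f g :: "('i \<Rightarrow> 'b) \<Rightarrow> real" and le :: "'i \<Rightarrow> 'b \<Rightarrow> 'b \<Rightarrow> bool"
  assumes "finite I" and N: "\<And>i. prob_space (N i)"
    and tot: "\<And>i a b. le i a b \<or> le i b a"
    and "f \<in> borel_measurable (PiM I N)" "g \<in> borel_measurable (PiM I N)"
    and "\<And>x. x \<in> space (PiM I N) \<Longrightarrow> 0 \<le> f x \<and> f x \<le> 1" "\<And>x. x \<in> space (PiM I N) \<Longrightarrow> 0 \<le> g x \<and> g x \<le> 1"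
    and "\<And>x y. \<lbrakk>x \<in> space (PiM I N); y \<in> space (PiM I N); \<And>i. i \<in> I \<Longrightarrow> le i (x i) (y i)\<rbrakk> \<Longrightarrow> f x \<le> f y \<and> g x \<le> g y"
  shows "(\<integral>x. f x \<partial>PiM I N) * (\<integral>x. g x \<partial>PiM I N) \<le> (\<integral>x. f x * g x \<partial>PiM I N)"
  using assms(1,4-)
proof (induction I arbitrary: f g rule: finite_induct)
  case empty
  interpret P: prob_space "PiM {} N" by (intro prob_space_PiM N)
  show ?case
    using empty by (intro P.chebyshev_integral[where B = 1]) (auto simp: space_PiM)
next
  case (insert i I)
  interpret Ni: prob_space "N i" by (rule N)
  interpret product_prob_space N "insert i I"
    using N(1) by (simp add: product_prob_space_def product_sigma_finite_def product_prob_space_axioms_def prob_space_imp_sigma_finite)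
  interpret P: prob_space "PiM (insert i I) N" by (intro prob_space_PiM N)
  interpret PI: prob_space "PiM I N" by (intro prob_space_PiM N)
  note [measurable] = insert.prems(1,2)
  have refl: "le j a a" for j a using tot by blast
  have upd[simp]: "x(i := y) \<in> space (PiM (insert i I) N)" if "x \<in> space (PiM I N)" "y \<in> space (N i)" for x y
    using that insert.hyps(2) by (auto simp: space_PiM PiE_def extensional_def)
  note upd' [simp] = upd[unfolded fun_upd_def]
  have m[measurable]: "(\<lambda>(x, y). h (x(i := y))) \<in> borel_measurable (PiM I N \<Otimes>\<^sub>M N i)"
    if "h \<in> borel_measurable (PiM (insert i I) N)" for h :: "_ \<Rightarrow> real"
    using measurable_compose[OF measurable_add_dim that] by (simp add: case_prod_unfold)
  have m1: "(\<lambda>y. h (x(i := y))) \<in> borel_measurable (N i)"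
    if "h \<in> borel_measurable (PiM (insert i I) N)" "x \<in> space (PiM I N)" for h :: "_ \<Rightarrow> real" and x
    using measurable_Pair2[OF m[OF that(1)] that(2)] by simp
  have bnd: "0 \<le> f (x(i := y)) \<and> f (x(i := y)) \<le> 1" "0 \<le> g (x(i := y)) \<and> g (x(i := y)) \<le> 1"
    if "x \<in> space (PiM I N)" "y \<in> space (N i)" for x y
    by (rule insert.prems(3)[OF upd[OF that]], rule insert.prems(4)[OF upd[OF that]])
  \<comment> \<open>Integrating out the coordinate \<open>i\<close> leaves functions that are
    monotone in the other coordinates, to which the induction hypothesis applies. In each fibre the
    one-dimensional inequality handles the coordinate \<open>i\<close>; it applies because
    \<open>le i\<close> is total.\<close>
  define F where "F x = (\<integral>y. f (x(i := y)) \<partial>N i)" for x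
  define G where "G x = (\<integral>y. g (x(i := y)) \<partial>N i)" for x
  have mF[measurable]: "F \<in> borel_measurable (PiM I N)" "G \<in> borel_measurable (PiM I N)"
    unfolding F_def G_def using m[of f] m[of g] insert.prems(1,2) by (auto intro!: Ni.borel_measurable_lebesgue_integral)
  have int: "integrable (N i) (\<lambda>y. h (x(i := y)))"
    if "h = f \<or> h = g" "x \<in> space (PiM I N)" for h x
    using that insert.prems m1[of h x] by (intro Ni.integrable_const_bound[where B = 1]) auto
  have FG: "0 \<le> F x \<and> F x \<le> 1" "0 \<le> G x \<and> G x \<le> 1" if "x \<in> space (PiM I N)" for x
  proof -
    note fg = bnd[OF that]
    show "0 \<le> F x \<and> F x \<le> 1" "0 \<le> G x \<and> G x \<le> 1"
      unfolding F_def G_def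
      by (intro conjI integral_nonneg_AE Ni.integral_le_const AE_I2 fg[THEN conjunct1] fg[THEN conjunct2]
            int that disjI1 disjI2 refl HOL.refl; assumption)+
  qed
  have mono: "F x \<le> F y \<and> G x \<le> G y"
    if x: "x \<in> space (PiM I N)" and y: "y \<in> space (PiM I N)" and "\<And>j. j \<in> I \<Longrightarrow> le j (x j) (y j)" for x y
    unfolding F_def G_def
    using that by (intro conjI integral_mono int insert.prems(5)[THEN conjunct1] insert.prems(5)[THEN conjunct2])
      (auto simp: refl)
  have ins: "(\<integral>x. h x \<partial>PiM (insert i I) N) = (\<integral>x. (\<integral>y. h (x(i := y)) \<partial>N i) \<partial>PiM I N)"
    if "h \<in> borel_measurable (PiM (insert i I) N)" "\<And>x. x \<in> space (PiM (insert i I) N) \<Longrightarrow> \<bar>h x\<bar> \<le> 1" for h :: "_ \<Rightarrow> real"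
    using that insert.hyps by (intro product_integral_insert P.integrable_const_bound[where B = 1]) auto
  have "(\<integral>x. f x \<partial>PiM (insert i I) N) * (\<integral>x. g x \<partial>PiM (insert i I) N) = (\<integral>x. F x \<partial>PiM I N) * (\<integral>x. G x \<partial>PiM I N)"
    using insert.prems(1-4) by (simp add: ins F_def G_def)
  also have "\<dots> \<le> (\<integral>x. F x * G x \<partial>PiM I N)"
  proof (rule insert.IH)
    fix x y assume "x \<in> space (PiM I N)" "y \<in> space (PiM I N)" "\<And>j. j \<in> I \<Longrightarrow> le j (x j) (y j)"
    then show "F x \<le> F y \<and> G x \<le> G y" by (rule mono)
  qed (fact mF FG)+
  also have "\<dots> \<le> (\<integral>x. (\<integral>y. f (x(i := y)) * g (x(i := y)) \<partial>N i) \<partial>PiM I N)"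
  proof (rule integral_mono)
    show "integrable (PiM I N) (\<lambda>x. F x * G x)"
      using FG by (intro PI.integrable_const_bound[where B = 1]) (auto intro!: mult_le_one AE_I2)
    have mm: "(\<lambda>x. f x * g x) \<in> borel_measurable (PiM (insert i I) N)" by measurable
    have "(\<lambda>x. \<integral>y. f (x(i := y)) * g (x(i := y)) \<partial>N i) \<in> borel_measurable (PiM I N)"
      using m[OF mm] by (intro Ni.borel_measurable_lebesgue_integral)
    moreover have "\<bar>\<integral>y. f (x(i := y)) * g (x(i := y)) \<partial>N i\<bar> \<le> 1" if "x \<in> space (PiM I N)" for x
    proof -
      have fg: "0 \<le> f (x(i := y)) * g (x(i := y)) \<and> f (x(i := y)) * g (x(i := y)) \<le> 1" if "y \<in> space (N i)" for y
        by (intro conjI mult_nonneg_nonneg mult_le_one bnd[THEN conjunct1] bnd[THEN conjunct2] that \<open>x \<in> space (PiM I N)\<close>)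
      have "integrable (N i) (\<lambda>y. f (x(i := y)) * g (x(i := y)))"
        using fg m1[OF mm that] by (intro Ni.integrable_const_bound[where B = 1]) auto
      then have "0 \<le> (\<integral>y. f (x(i := y)) * g (x(i := y)) \<partial>N i) \<and> (\<integral>y. f (x(i := y)) * g (x(i := y)) \<partial>N i) \<le> 1"
        using fg by (auto intro!: integral_nonneg_AE Ni.integral_le_const AE_I2)
      then show ?thesis by simp
    qed
    ultimately show "integrable (PiM I N) (\<lambda>x. \<integral>y. f (x(i := y)) * g (x(i := y)) \<partial>N i)"
      by (intro PI.integrable_const_bound[where B = 1]) auto
    fix x assume x: "x \<in> space (PiM I N)"
    show "F x * G x \<le> (\<integral>y. f (x(i := y)) * g (x(i := y)) \<partial>N i)"
      unfolding F_def G_def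
    proof (rule Ni.chebyshev_integral[where B = 1])
      show "(\<lambda>y. f (x(i := y))) \<in> borel_measurable (N i)" "(\<lambda>y. g (x(i := y))) \<in> borel_measurable (N i)"
        using m1[OF _ x] by auto
      show "\<bar>f (x(i := y))\<bar> \<le> 1" "\<bar>g (x(i := y))\<bar> \<le> 1" if "y \<in> space (N i)" for y
        using bnd[OF x that] by linarith+
      fix y z assume yz: "y \<in> space (N i)" "z \<in> space (N i)"
      have *: "f (x(i := y)) \<le> f (x(i := z)) \<and> g (x(i := y)) \<le> g (x(i := z))"
        if "le i y z" "y \<in> space (N i)" "z \<in> space (N i)" for y z
        using that x by (intro insert.prems(5)) (auto simp: refl)
      from tot[of i y z] show "0 \<le> (f (x(i := y)) - f (x(i := z))) * (g (x(i := y)) - g (x(i := z)))"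
        using *[OF _ yz] *[OF _ yz(2,1)] by (auto simp: mult_nonneg_nonneg mult_nonpos_nonpos)
    qed
  qed
  also have "\<dots> = (\<integral>x. f x * g x \<partial>PiM (insert i I) N)"
    using insert.prems(3,4) by (subst ins) (auto simp: abs_mult intro!: mult_le_one)
  finally show ?case .
qed

text \<open>The indicator of a monotone event is a monotone function. One event is split off at a
  time, the intersection of the others being monotone again. Intersecting with the space gives the
  right meaning to an empty \<open>K\<close>.\<close>

lemma harris_events:
  fixes N :: "'i \<Rightarrow> 'b measure" and E :: "'k \<Rightarrow> ('i \<Rightarrow> 'b) set" and le :: "'i \<Rightarrow> 'b \<Rightarrow> 'b \<Rightarrow> bool"
  assumes I: "finite I" and N: "\<And>i. prob_space (N i)"
    and tot: "\<And>i a b. le i a b \<or> le i b a"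
    and K: "finite K" and E: "\<And>k. k \<in> K \<Longrightarrow> E k \<in> sets (PiM I N)"
    and up: "\<And>k x y. \<lbrakk>k \<in> K; x \<in> E k; y \<in> space (PiM I N); \<And>i. i \<in> I \<Longrightarrow> le i (x i) (y i)\<rbrakk> \<Longrightarrow> y \<in> E k"
  shows "(\<Prod>k\<in>K. measure (PiM I N) (E k)) \<le> measure (PiM I N) (space (PiM I N) \<inter> (\<Inter>k\<in>K. E k))"
  using K E up
proof (induction K rule: finite_induct)
  case empty
  interpret P: prob_space "PiM I N" by (intro prob_space_PiM N)
  show ?case by (simp add: P.prob_space)
next
  case (insert k K)
  interpret P: prob_space "PiM I N" by (intro prob_space_PiM N)
  define A where "A = space (PiM I N) \<inter> (\<Inter>k\<in>K. E k)"
  have "A = {x \<in> space (PiM I N). \<forall>k\<in>K. x \<in> E k}" by (auto simp: A_def)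
  also have "\<dots> \<in> sets (PiM I N)"
  proof (rule sets.sets_Collect_finite_All[OF _ insert.hyps(1)])
    fix k assume "k \<in> K"
    then have "E k \<in> sets (PiM I N)" using insert.prems(1) by simp
    then have "{x \<in> space (PiM I N). x \<in> E k} = E k" using sets.sets_into_space by blast
    then show "{x \<in> space (PiM I N). x \<in> E k} \<in> sets (PiM I N)" using \<open>E k \<in> sets (PiM I N)\<close> by simp
  qed
  finally have A[measurable]: "A \<in> sets (PiM I N)" .
  have [measurable]: "E k \<in> sets (PiM I N)" using insert.prems(1) by simp
  have upA: "y \<in> A" if "x \<in> A" "y \<in> space (PiM I N)" "\<And>i. i \<in> I \<Longrightarrow> le i (x i) (y i)" for x y
    using that insert.prems(2)[of _ x y] by (auto simp: A_def)
  have upE: "y \<in> E k" if "x \<in> E k" "y \<in> space (PiM I N)" "\<And>i. i \<in> I \<Longrightarrow> le i (x i) (y i)" for x y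
    using that by (intro insert.prems(2)[of k x y]) auto
  have "(\<Prod>k\<in>insert k K. measure (PiM I N) (E k)) \<le> measure (PiM I N) (E k) * measure (PiM I N) A"
  proof -
    have "(\<Prod>k\<in>K. measure (PiM I N) (E k)) \<le> measure (PiM I N) A"
      unfolding A_def
    proof (rule insert.IH)
      show "E k \<in> sets (PiM I N)" if "k \<in> K" for k using that insert.prems(1) by simp
      show "y \<in> E k" if "k \<in> K" "x \<in> E k" "y \<in> space (PiM I N)" "\<And>i. i \<in> I \<Longrightarrow> le i (x i) (y i)" for k x y
        using that by (intro insert.prems(2)[of k x y]) auto
    qed
    then show ?thesis using insert.hyps by (simp add: mult_left_mono)
  qed
  also have "\<dots> = (\<integral>x. indicator (E k) x \<partial>PiM I N) * (\<integral>x. indicator A x \<partial>PiM I N)"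
    by simp
  also have "\<dots> \<le> (\<integral>x. indicator (E k) x * indicator A x \<partial>PiM I N)"
  proof (rule harris_integral[OF I N tot])
    fix x y assume "x \<in> space (PiM I N)" "y \<in> space (PiM I N)" "\<And>i. i \<in> I \<Longrightarrow> le i (x i) (y i)"
    then show "indicator (E k) x \<le> (indicator (E k) y :: real) \<and> indicator A x \<le> (indicator A y :: real)"
      using upA[of x y] upE[of x y] by (auto simp: indicator_def)
  qed (auto simp: indicator_def)
  also have "\<dots> = (\<integral>x. indicator (E k \<inter> A) x \<partial>PiM I N)"
    by (simp add: indicator_inter_arith)
  also have "\<dots> = measure (PiM I N) (E k \<inter> A)" by simp
  also have "E k \<inter> A = space (PiM I N) \<inter> (\<Inter>k\<in>insert k K. E k)" by (auto simp: A_def)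
  finally show ?case .
qed

section \<open>Independent fields\<close>

text \<open>Markov's inequality for the exponential of the sum. Scaling and centring are left to the
  choice of \<open>X\<close>, which is why neither parameter appears.\<close>

lemma (in prob_space) chernoff:
  assumes I: "finite I" and ind: "indep_vars (\<lambda>_. borel) X I" and "0 \<le> \<rho>"
    and X: "\<And>i. i \<in> I \<Longrightarrow> (\<integral>\<^sup>+w. ennreal (exp (X i w)) \<partial>M) \<le> ennreal \<rho>"
  shows "prob {w \<in> space M. 0 \<le> (\<Sum>i\<in>I. X i w)} \<le> \<rho> ^ card I"
proof -
  have [measurable]: "X i \<in> borel_measurable M" if "i \<in> I" for i
    using ind that by (auto simp: indep_vars_def)
  have e: "indep_vars (\<lambda>_. borel) (\<lambda>i w. ennreal (exp (X i w))) I"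
    by (rule indep_vars_compose2[OF ind]) simp
  have "emeasure M {w \<in> space M. 0 \<le> (\<Sum>i\<in>I. X i w)} = (\<integral>\<^sup>+w. indicator {w \<in> space M. 0 \<le> (\<Sum>i\<in>I. X i w)} w \<partial>M)"
    by simp
  also have "\<dots> \<le> (\<integral>\<^sup>+w. (\<Prod>i\<in>I. ennreal (exp (X i w))) \<partial>M)"
    by (intro nn_integral_mono) (auto simp: prod_ennreal exp_sum[OF I, symmetric] indicator_def)
  also have "\<dots> = (\<Prod>i\<in>I. \<integral>\<^sup>+w. ennreal (exp (X i w)) \<partial>M)"
    by (rule indep_vars_nn_integral[OF I e]) simp
  also have "\<dots> \<le> (\<Prod>i\<in>I. ennreal \<rho>)"
    by (intro prod_mono_ennreal X)
  also have "\<dots> = ennreal (\<rho> ^ card I)" using \<open>0 \<le> \<rho>\<close> by (simp add: ennreal_power)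
  finally show ?thesis using \<open>0 \<le> \<rho>\<close> by (simp add: emeasure_eq_measure)
qed

text \<open>Locality of the predicates is implied by their monotonicity, as total preorders are reflexive.\<close>

lemma (in prob_space) harris:
  fixes X :: "'i \<Rightarrow> 'a \<Rightarrow> real" and P :: "'k \<Rightarrow> ('i \<Rightarrow> real) \<Rightarrow> bool"
  assumes I: "finite I" and ind: "indep_vars (\<lambda>_. borel) X I" and rv: "\<And>i. random_variable borel (X i)"
    and tot: "\<And>i a b. le i a b \<or> le i b a" and K: "finite K"
    and meas: "\<And>k. k \<in> K \<Longrightarrow> {\<sigma> \<in> space (PiM I (\<lambda>_. borel)). P k \<sigma>} \<in> sets (PiM I (\<lambda>_. borel))"
    and up: "\<And>k \<sigma> \<tau>. \<lbrakk>k \<in> K; P k \<sigma>; \<And>i. i \<in> I \<Longrightarrow> le i (\<sigma> i) (\<tau> i)\<rbrakk> \<Longrightarrow> P k \<tau>"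
  shows "(\<Prod>k\<in>K. prob {w \<in> space M. P k (\<lambda>i. X i w)}) \<le> prob {w \<in> space M. \<forall>k\<in>K. P k (\<lambda>i. X i w)}"
proof (cases "I = {}")
  case True
  \<comment> \<open>Without coordinates monotonicity makes every predicate constant. This case
    stands apart because independence is characterised by the product law for nonempty index sets
    only.\<close>
  have "P k \<sigma> \<longleftrightarrow> P k \<tau>" if "k \<in> K" for k \<sigma> \<tau>
    using up[OF that] True by blast
  then have eq: "P k (\<lambda>i. X i w) \<longleftrightarrow> P k (\<lambda>_. 0)" if "k \<in> K" for k w using that by blast
  then have e2: "(\<forall>k\<in>K. P k (\<lambda>i. X i w)) \<longleftrightarrow> (\<forall>k\<in>K. P k (\<lambda>_. 0))" for w by blast
  have "(\<Prod>k\<in>K. prob {w \<in> space M. P k (\<lambda>i. X i w)}) = (\<Prod>k\<in>K. prob {w \<in> space M. P k (\<lambda>_. 0)})"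
    by (intro prod.cong refl arg_cong[where f = prob] Collect_cong) (auto simp: eq)
  also have "\<dots> \<le> prob {w \<in> space M. \<forall>k\<in>K. P k (\<lambda>_. 0)}"
  proof (cases "\<forall>k\<in>K. P k (\<lambda>_. 0)")
    case True
    then show ?thesis by (simp add: prob_space)
  next
    case False
    then obtain k where "k \<in> K" "\<not> P k (\<lambda>_. 0)" by blast
    then have "(\<Prod>k\<in>K. prob {w \<in> space M. P k (\<lambda>_. 0)}) = 0"
      using K by (intro prod_zero) (auto intro!: bexI[of _ k])
    then show ?thesis by simp
  qed
  finally show ?thesis unfolding e2 .
next
  case False
  let ?Q = "PiM I (\<lambda>i. distr M borel (X i))"
  have Q: "distr M (PiM I (\<lambda>_. borel)) (\<lambda>w. \<lambda>i\<in>I. X i w) = ?Q"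
    using indep_vars_iff_distr_eq_PiM[where I = I and X = X and M' = "\<lambda>_. borel"] False rv ind by simp
  have sQ: "space ?Q = space (PiM I (\<lambda>_. borel :: real measure))" by (simp add: space_PiM)
  have setsQ: "sets ?Q = sets (PiM I (\<lambda>_. borel :: real measure))" by (intro sets_PiM_cong) auto
  have refl: "le i a a" for i a using tot by blast
  have loc: "P k (\<lambda>i\<in>I. X i w) \<longleftrightarrow> P k (\<lambda>i. X i w)" if "k \<in> K" for k w
    using up[OF that, of "\<lambda>i\<in>I. X i w" "\<lambda>i. X i w"] up[OF that, of "\<lambda>i. X i w" "\<lambda>i\<in>I. X i w"] by (auto simp: refl)
  have rv'[measurable]: "(\<lambda>w. \<lambda>i\<in>I. X i w) \<in> measurable M (PiM I (\<lambda>_. borel))"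
    using rv by (intro measurable_restrict) auto
  define E where "E k = {\<sigma> \<in> space (PiM I (\<lambda>_. borel)). P k \<sigma>}" for k
  have sp: "(\<lambda>i\<in>I. X i w) \<in> space (PiM I (\<lambda>_. borel))" for w by (simp add: space_PiM)
  have 1: "measure ?Q (E k) = prob {w \<in> space M. P k (\<lambda>i. X i w)}" if "k \<in> K" for k
    unfolding Q[symmetric] using meas[OF that] loc[OF that] sp
    by (subst measure_distr) (auto simp: E_def intro!: arg_cong[where f = prob])
  have fin: "space ?Q \<inter> (\<Inter>k\<in>K. E k) \<in> sets (PiM I (\<lambda>_. borel))"
  proof (cases "K = {}")
    case True
    then show ?thesis by (simp add: sQ)
  next
    case False
    then have "(\<Inter>k\<in>K. E k) \<in> sets (PiM I (\<lambda>_. borel))" using K meas by (auto simp: E_def)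
    then show ?thesis unfolding sQ by (intro sets.Int sets.top)
  qed
  have 2: "measure ?Q (space ?Q \<inter> (\<Inter>k\<in>K. E k)) = prob {w \<in> space M. \<forall>k\<in>K. P k (\<lambda>i. X i w)}"
    using fin loc sp unfolding Q[symmetric]
    by (subst measure_distr) (auto simp: E_def intro!: arg_cong[where f = prob])
  have "(\<Prod>k\<in>K. measure ?Q (E k)) \<le> measure ?Q (space ?Q \<inter> (\<Inter>k\<in>K. E k))"
  proof (rule harris_events[OF I _ tot K])
    show "prob_space (distr M borel (X i))" for i by (rule prob_space_distr) (rule rv)
    show "E k \<in> sets ?Q" if "k \<in> K" for k unfolding setsQ using meas[OF that] by (simp add: E_def)
    show "y \<in> E k" if "k \<in> K" "x \<in> E k" "y \<in> space ?Q" "\<And>i. i \<in> I \<Longrightarrow> le i (x i) (y i)" for k x y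
      using up[OF that(1), of x y] that unfolding E_def sQ by auto
  qed
  then show ?thesis by (simp add: 1 2)
qed

section \<open>Local functionals of an i.i.d. field\<close>

locale iid_field = prob_space M for M :: "'a measure" +
  fixes \<omega> :: "'v \<Rightarrow> 'a \<Rightarrow> real" and N :: "real measure"
  assumes indep: "indep_vars (\<lambda>_. borel) \<omega> UNIV"
    and law: "distr M borel (\<omega> x) = N"
begin

lemma rv [measurable]: "\<omega> x \<in> borel_measurable M"
  using indep by (auto simp: indep_vars_def)

lemma sets_N [simp, measurable_cong]: "sets N = sets borel" and space_N [simp]: "space N = UNIV"
  using law[of undefined] by (metis sets_distr, metis space_borel space_distr)

lemma prob_space_N: "prob_space N"
  using law[of undefined] by (metis prob_space_distr rv)

lemma indep_on: "indep_vars (\<lambda>_. borel) \<omega> I"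
  by (rule indep_vars_subset[OF indep]) simp

lemma prob_marginal: "A \<in> sets borel \<Longrightarrow> prob {w \<in> space M. \<omega> x w \<in> A} = measure N A"
  unfolding law[of x, symmetric] by (subst measure_distr) (auto intro!: arg_cong[where f = prob])

lemma nn_integral_marginal:
  "f \<in> borel_measurable borel \<Longrightarrow> (\<integral>\<^sup>+w. f (\<omega> x w) \<partial>M) = (\<integral>\<^sup>+y. f y \<partial>N)"
  unfolding law[of x, symmetric] by (subst nn_integral_distr) auto

text \<open>Any injective choice of finitely many vertices sees the same product law. This is the
  common source of the invariance under translations and coordinate permutations, and of the reading
  of a path as an i.i.d. sequence.\<close>

lemma distr_field:
  assumes B: "finite B" and inj: "inj_on \<phi> B"
  shows "distr M (PiM B (\<lambda>_. borel)) (\<lambda>w. \<lambda>i\<in>B. \<omega> (\<phi> i) w) = PiM B (\<lambda>_. N)"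
proof -
  interpret N: prob_space N by (rule prob_space_N)
  interpret P: product_prob_space "\<lambda>_. N" B
    by (simp add: product_prob_space_def product_sigma_finite_def product_prob_space_axioms_def N.prob_space_axioms
          prob_space_imp_sigma_finite)
  have m: "(\<lambda>w. \<lambda>i\<in>B. \<omega> (\<phi> i) w) \<in> measurable M (PiM B (\<lambda>_. borel))"
    by (intro measurable_restrict) simp
  show ?thesis
  proof (rule P.PiM_eqI[OF B])
    show "sets (distr M (PiM B (\<lambda>_. borel)) (\<lambda>w. \<lambda>i\<in>B. \<omega> (\<phi> i) w)) = sets (PiM B (\<lambda>_. N))"
      unfolding sets_distr by (rule sets_PiM_cong) auto
    fix A assume "\<And>i. i \<in> B \<Longrightarrow> A i \<in> sets N"
    then have A: "A i \<in> sets borel" if "i \<in> B" for i using that by simp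
    define A' where "A' x = A (the_inv_into B \<phi> x)" for x
    have A': "A' (\<phi> i) = A i" if "i \<in> B" for i using that inj by (simp add: A'_def the_inv_into_f_f)
    have "emeasure (distr M (PiM B (\<lambda>_. borel)) (\<lambda>w. \<lambda>i\<in>B. \<omega> (\<phi> i) w)) (Pi\<^sub>E B A) =
        prob ((\<lambda>w. \<lambda>i\<in>B. \<omega> (\<phi> i) w) -` Pi\<^sub>E B A \<inter> space M)"
      using A B by (subst emeasure_distr[OF m]) (auto intro!: sets_PiM_I_finite simp: emeasure_eq_measure)
    also have "(\<lambda>w. \<lambda>i\<in>B. \<omega> (\<phi> i) w) -` Pi\<^sub>E B A \<inter> space M = {w \<in> space M. \<forall>x\<in>\<phi> ` B. \<omega> x w \<in> A' x}"
      by (auto simp: A')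
    also have "prob \<dots> = (\<Prod>x\<in>\<phi> ` B. measure N (A' x))"
    proof (cases "B = {}")
      case False
      have "{w \<in> space M. \<forall>x\<in>\<phi> ` B. \<omega> x w \<in> A' x} = (\<Inter>x\<in>\<phi> ` B. \<omega> x -` A' x \<inter> space M)"
        using False by auto
      also have "prob \<dots> = (\<Prod>x\<in>\<phi> ` B. prob (\<omega> x -` A' x \<inter> space M))"
        using A A' B False by (intro indep_varsD[OF indep]) auto
      also have "\<dots> = (\<Prod>x\<in>\<phi> ` B. measure N (A' x))"
      proof (rule prod.cong)
        fix x assume "x \<in> \<phi> ` B"
        then have "A' x \<in> sets borel" using A A' by auto
        then show "prob (\<omega> x -` A' x \<inter> space M) = measure N (A' x)"
          using prob_marginal[of "A' x" x] by (simp add: vimage_def Int_def conj_commute)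
      qed simp
      finally show ?thesis .
    qed (simp add: prob_space)
    also have "\<dots> = (\<Prod>i\<in>B. measure N (A i))"
      using inj A' by (simp add: prod.reindex)
    finally show "emeasure (distr M (PiM B (\<lambda>_. borel)) (\<lambda>w. \<lambda>i\<in>B. \<omega> (\<phi> i) w)) (Pi\<^sub>E B A) = (\<Prod>i\<in>B. emeasure N (A i))"
      by (simp only: N.emeasure_eq_measure prod_ennreal measure_nonneg)
  qed
qed

lemma distr_functional:
  fixes F :: "('i \<Rightarrow> real) \<Rightarrow> 'c"
  assumes B: "finite B" and inj: "inj_on \<phi> B" and F: "F \<in> measurable (PiM B (\<lambda>_. borel)) L"
    and loc: "\<And>\<sigma> \<tau>. (\<And>i. i \<in> B \<Longrightarrow> \<sigma> i = \<tau> i) \<Longrightarrow> F \<sigma> = F \<tau>"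
  shows "distr M L (\<lambda>w. F (\<lambda>i. \<omega> (\<phi> i) w)) = distr (PiM B (\<lambda>_. N)) L F"
proof -
  have "distr M L (\<lambda>w. F (\<lambda>i. \<omega> (\<phi> i) w)) = distr M L (F \<circ> (\<lambda>w. \<lambda>i\<in>B. \<omega> (\<phi> i) w))"
  proof (intro distr_cong refl)
    fix w
    have "F (\<lambda>i. \<omega> (\<phi> i) w) = F (\<lambda>i\<in>B. \<omega> (\<phi> i) w)" by (rule loc) simp
    then show "F (\<lambda>i. \<omega> (\<phi> i) w) = (F \<circ> (\<lambda>w. \<lambda>i\<in>B. \<omega> (\<phi> i) w)) w" by (simp only: o_apply)
  qed
  also have "\<dots> = distr (distr M (PiM B (\<lambda>_. borel)) (\<lambda>w. \<lambda>i\<in>B. \<omega> (\<phi> i) w)) L F"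
    by (rule distr_distr[symmetric, OF F]) (intro measurable_restrict, simp)
  finally show ?thesis by (simp only: distr_field[OF B inj])
qed

lemma prob_functional:
  assumes B: "finite B" and inj: "inj_on \<phi> B" and P: "{\<sigma> \<in> space (PiM B (\<lambda>_. borel)). P \<sigma>} \<in> sets (PiM B (\<lambda>_. borel))"
    and loc: "\<And>\<sigma> \<tau>. (\<And>i. i \<in> B \<Longrightarrow> \<sigma> i = \<tau> i) \<Longrightarrow> P \<sigma> = P \<tau>"
  shows "prob {w \<in> space M. P (\<lambda>i. \<omega> (\<phi> i) w)} = measure (PiM B (\<lambda>_. N)) {\<sigma> \<in> space (PiM B (\<lambda>_. N)). P \<sigma>}"
proof -
  have sB: "space (PiM B (\<lambda>_. N)) = space (PiM B (\<lambda>_. borel :: real measure))" by (simp add: space_PiM)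
  have "measure (PiM B (\<lambda>_. N)) {\<sigma> \<in> space (PiM B (\<lambda>_. N)). P \<sigma>} =
     prob ((\<lambda>w. \<lambda>i\<in>B. \<omega> (\<phi> i) w) -` {\<sigma> \<in> space (PiM B (\<lambda>_. borel)). P \<sigma>} \<inter> space M)"
    unfolding sB unfolding distr_field[OF B inj, symmetric] using P
    by (intro measure_distr measurable_restrict) simp_all
  also have "\<dots> = prob {w \<in> space M. P (\<lambda>i. \<omega> (\<phi> i) w)}"
  proof (rule arg_cong[where f = prob])
    have "P (\<lambda>i\<in>B. \<omega> (\<phi> i) w) = P (\<lambda>i. \<omega> (\<phi> i) w)" for w by (rule loc) simp
    moreover have "(\<lambda>i\<in>B. \<omega> (\<phi> i) w) \<in> space (PiM B (\<lambda>_. borel))" for w by (simp add: space_PiM)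
    ultimately show "(\<lambda>w. \<lambda>i\<in>B. \<omega> (\<phi> i) w) -` {\<sigma> \<in> space (PiM B (\<lambda>_. borel)). P \<sigma>} \<inter> space M = {w \<in> space M. P (\<lambda>i. \<omega> (\<phi> i) w)}"
      by blast
  qed
  finally show ?thesis by simp
qed

end

locale iid_lattice_field = iid_field M \<omega> N
  for M :: "'a measure" and \<omega> :: "int ^ 'd::finite \<Rightarrow> 'a \<Rightarrow> real" and N
begin

text \<open>Lets a threshold of \<open>A\<close> per step be normalised to 0 in the results on
  excursions and on the lower tail.\<close>

lemma diff_const: "iid_lattice_field M (\<lambda>x w. \<omega> x w - A) (distr N borel (\<lambda>y. y - A))"
proof (unfold_locales)
  show "indep_vars (\<lambda>_. borel) (\<lambda>x w. \<omega> x w - A) UNIV"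
    using indep_vars_compose2[OF indep, of "\<lambda>_ y. y - A" "\<lambda>_. borel"] by simp
  show "distr M borel (\<lambda>w. \<omega> x w - A) = distr N borel (\<lambda>y. y - A)" for x
    unfolding law[of x, symmetric] by (subst distr_distr) (auto simp: o_def)
qed

lemma measurable_lpp_field [measurable]: "(\<lambda>w. lpp (\<lambda>x. \<omega> x w) x y) \<in> borel_measurable M"
  by measurable

text \<open>A passage time is a function of the weights in its own box without the starting vertex;
  blocks may thus share the vertex at which one ends and the next begins.\<close>

lemma indep_lpp:
  assumes dis: "disjoint_family_on (\<lambda>i. box_set (x i) (y i) - {x i}) I"
  shows "indep_vars (\<lambda>_. borel) (\<lambda>i w. lpp (\<lambda>z. \<omega> z w) (x i) (y i)) I"
proof -
  let ?K = "\<lambda>i. box_set (x i) (y i) - {x i}"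
  have "indep_vars (\<lambda>i. PiM (?K i) (\<lambda>_. borel)) (\<lambda>i w. restrict (\<lambda>z. \<omega> z w) (?K i)) I"
    by (rule indep_vars_restrict[OF indep _ dis]) simp
  then have "indep_vars (\<lambda>_. borel) (\<lambda>i w. lpp (restrict (\<lambda>z. \<omega> z w) (?K i)) (x i) (y i)) I"
    by (rule indep_vars_compose2) (intro borel_measurable_lpp measurable_component_singleton)
  moreover have "lpp (restrict (\<lambda>z. \<omega> z w) (?K i)) (x i) (y i) = lpp (\<lambda>z. \<omega> z w) (x i) (y i)" for i w
    by (rule lpp_cong) simp
  ultimately show ?thesis by simp
qed

lemma distr_lpp_inj:
  assumes "inj \<phi>"
  shows "distr M borel (\<lambda>w. lpp (\<lambda>z. \<omega> (\<phi> z) w) x y) = distr M borel (\<lambda>w. lpp (\<lambda>z. \<omega> z w) x y)"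
proof -
  have "distr M borel (\<lambda>w. lpp (\<lambda>z. \<omega> (\<phi> z) w) x y) = distr (PiM (box_set x y) (\<lambda>_. N)) borel (\<lambda>\<sigma>. lpp \<sigma> x y)"
    if "inj \<phi>" for \<phi>
    by (rule distr_functional[of "box_set x y" \<phi> "\<lambda>\<sigma>. lpp \<sigma> x y"])
      (auto intro!: finite_box_set borel_measurable_lpp measurable_component_singleton lpp_cong intro: inj_on_subset[OF that])
  from this[OF assms] this[of "\<lambda>z. z"] show ?thesis by simp
qed

lemma distr_lpp_shift:
  assumes "\<And>i. x $ i \<le> y $ i"
  shows "distr M borel (\<lambda>w. lpp (\<lambda>z. \<omega> z w) (x + v) (y + v)) = distr M borel (\<lambda>w. lpp (\<lambda>z. \<omega> z w) x y)"
  using distr_lpp_inj[of "\<lambda>z. z + v"] by (simp add: lpp_shift[OF assms])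

lemma distr_lpp_permv:
  assumes "\<And>i. x $ i \<le> y $ i" "bij p"
  shows "distr M borel (\<lambda>w. lpp (\<lambda>z. \<omega> z w) (permv p x) (permv p y)) = distr M borel (\<lambda>w. lpp (\<lambda>z. \<omega> z w) x y)"
  using distr_lpp_inj[OF inj_permv[OF assms(2)]] by (simp add: lpp_permv[OF assms])

lemma prob_distr_eq:
  assumes "distr M borel f = distr M borel g" "f \<in> borel_measurable M" "g \<in> borel_measurable M" "A \<in> sets borel"
  shows "prob {w \<in> space M. f w \<in> A} = prob {w \<in> space M. (g w :: real) \<in> A}"
proof -
  have "prob {w \<in> space M. h w \<in> A} = measure (distr M borel h) A" if "h \<in> borel_measurable M" for h :: "'a \<Rightarrow> real"
    using that assms(4) by (subst measure_distr) (auto intro!: arg_cong[where f = prob])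
  then show ?thesis using assms by metis
qed

end

section \<open>The lower tail\<close>

context iid_lattice_field
begin

lemma integrable_marginal:
  fixes f :: "real \<Rightarrow> real"
  assumes "integrable N f"
  shows "integrable M (\<lambda>w. f (\<omega> x w))" "(\<integral>w. f (\<omega> x w) \<partial>M) = (\<integral>y. f y \<partial>N)"
proof -
  have f: "f \<in> borel_measurable borel" using borel_measurable_integrable[OF assms] by simp
  show "integrable M (\<lambda>w. f (\<omega> x w))"
    using assms unfolding law[of x, symmetric] by (rule integrable_distr[OF rv])
  show "(\<integral>w. f (\<omega> x w) \<partial>M) = (\<integral>y. f y \<partial>N)"
    using f unfolding law[of x, symmetric] by (subst integral_distr) simp_all
qed

text \<open>Turns a passage time that is large with high probability into an exponential moment
  below 1. On the good event the exponential is at most \<open>q\<close>. On the bad event the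
  passage time is bounded below by one fixed path, and the second moment of that bound stays
  controlled because \<open>s\<close> decreases like \<open>1 / b\<close>.\<close>

lemma block_exponential:
  assumes \<delta>: "\<delta> > 0" and H1: "(\<lambda>n. prob {w \<in> space M. lpp (\<lambda>z. \<omega> z w) 0 (diag n) < \<delta> * real n}) \<longlonglongrightarrow> 0"
    and s0: "s0 > 0" and H2: "integrable N (\<lambda>y. exp (- s0 * y))"
  obtains b s \<rho> where "b \<ge> 1" "s > 0" "0 < \<rho>" "\<rho> < 1"
    "(\<integral>\<^sup>+w. ennreal (exp (- s * lpp (\<lambda>z. \<omega> z w) 0 (diag b))) \<partial>M) \<le> ennreal \<rho>"
proof -
  define D where "D = CARD('d)"
  have D: "D \<ge> 1" by (simp add: D_def Suc_leI)
  \<comment> \<open>This is \<open>exp (- s * (\<delta> * b))\<close> for the \<open>s\<close>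
    chosen below, independently of the block length \<open>b\<close>. The two remaining terms
    receive \<open>(1 - q) / 4\<close> each, which leaves the bound
    \<open>(1 + q) / 2\<close>.\<close>
  define q where "q = exp (- s0 * \<delta> / (2 * real D))"
  have q: "0 < q" "q < 1" using s0 \<delta> D by (auto simp: q_def)
  define M0 where "M0 = (\<integral>y. exp (- s0 * y) \<partial>N)"
  have M0: "M0 \<ge> 0" by (simp add: M0_def)
  define \<kappa> where "\<kappa> = (1 - q) / (4 * (M0 + 1))"
  have \<kappa>: "\<kappa> > 0" using q M0 by (simp add: \<kappa>_def)
  have \<kappa>M: "\<kappa> * M0 \<le> (1 - q) / 4"
  proof -
    have "\<kappa> * M0 \<le> \<kappa> * (M0 + 1)" using \<kappa> by simp
    also have "\<dots> = (1 - q) / 4"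
    proof -
      have "(1 - q) / (4 * c) * c = (1 - q) / 4" if "c \<noteq> 0" for c using that by simp
      from this[of "M0 + 1"] show ?thesis using M0 by (simp only: \<kappa>_def)
    qed
    finally show ?thesis .
  qed
  have "eventually (\<lambda>n. prob {w \<in> space M. lpp (\<lambda>z. \<omega> z w) 0 (diag n) < \<delta> * real n} < \<kappa> * (1 - q) / 4) sequentially"
    using \<kappa> q by (intro order_tendstoD(2)[OF H1]) simp
  then obtain b0 where b0: "prob {w \<in> space M. lpp (\<lambda>z. \<omega> z w) 0 (diag n) < \<delta> * real n} < \<kappa> * (1 - q) / 4" if "n \<ge> b0" for n
    by (auto simp: eventually_sequentially)
  define b where "b = max b0 1"
  have b: "b \<ge> 1" "b \<ge> b0" by (auto simp: b_def)
  define m where "m = D * b"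
  have m: "m \<ge> 1" using D b by (simp add: m_def)
  define s where "s = s0 / (2 * real m)"
  have s: "s > 0" using s0 m by (simp add: s_def)
  obtain \<pi> where \<pi>: "steps (0 :: int ^ 'd) \<pi> (diag b)"
    using steps_exist[of 0 "diag b"] by (auto simp: diag_def)
  have len: "length \<pi> = m"
    using steps_level[OF \<pi>] by (simp add: m_def D_def flip: of_nat_mult)
  have card: "card (set \<pi>) = m" using steps_distinct[OF \<pi>] len by (simp add: distinct_card)
  define B where "B = {w \<in> space M. lpp (\<lambda>z. \<omega> z w) 0 (diag b) < \<delta> * real b}"
  have [measurable]: "B \<in> sets M" unfolding B_def by measurable
  define U where "U w = q + \<kappa> * ((\<Sum>z\<in>set \<pi>. exp (- s0 * \<omega> z w)) / real m) + indicator B w / \<kappa>" for w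
  have bound: "exp (- s * lpp (\<lambda>z. \<omega> z w) 0 (diag b)) \<le> U w" if w: "w \<in> space M" for w
  proof (cases "w \<in> B")
    case False
    then have "lpp (\<lambda>z. \<omega> z w) 0 (diag b) \<ge> \<delta> * real b" using w by (auto simp: B_def)
    then have "s * (\<delta> * real b) \<le> s * lpp (\<lambda>z. \<omega> z w) 0 (diag b)" using s by (intro mult_left_mono) auto
    moreover have "s * (\<delta> * real b) = s0 * \<delta> / (2 * real D)"
      using b D by (simp add: s_def m_def)
    ultimately have "exp (- s * lpp (\<lambda>z. \<omega> z w) 0 (diag b)) \<le> q" by (simp add: q_def)
    moreover have "0 \<le> \<kappa> * ((\<Sum>z\<in>set \<pi>. exp (- s0 * \<omega> z w)) / real m)" using \<kappa> by (simp add: sum_nonneg)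
    ultimately show ?thesis using False by (simp add: U_def)
  next
    case True
    define t where "t = wt (\<lambda>z. \<omega> z w) \<pi>"
    define a where "a = exp (- s * t)"
    have "exp (- s * lpp (\<lambda>z. \<omega> z w) 0 (diag b)) \<le> a"
      using s lpp_ge[OF \<pi>, of "\<lambda>z. \<omega> z w"] by (simp add: a_def t_def)
    \<comment> \<open>A pointwise substitute for the Cauchy-Schwarz inequality: either
      \<open>a \<le> 1 / \<kappa>\<close> or \<open>a \<le> \<kappa> * a\<^sup>2\<close>. The first
      term is paid for by the probability of \<open>B\<close>, the second by the smallness of
      \<open>\<kappa>\<close>.\<close>
    also have "a \<le> \<kappa> * a\<^sup>2 + 1 / \<kappa>"
    proof (cases "a \<le> 1 / \<kappa>")
      case True
      have "0 \<le> \<kappa> * a\<^sup>2" using \<kappa> by simp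
      then show ?thesis using True by linarith
    next
      case False
      then have "1 \<le> \<kappa> * a" using \<kappa> by (simp add: field_simps)
      then have "1 * a \<le> \<kappa> * a * a" by (intro mult_right_mono) (auto simp: a_def)
      then show ?thesis using \<kappa> by (simp add: power2_eq_square mult.assoc) (smt (verit) divide_nonneg_pos)
    qed
    also have "a\<^sup>2 = exp (\<Sum>z\<in>set \<pi>. (1 / real m) *\<^sub>R (- s0 * \<omega> z w))"
    proof -
      have "a\<^sup>2 = exp (- (2 * s) * t)" by (simp add: a_def power2_eq_square flip: exp_add)
      also have "- (2 * s) * t = (\<Sum>z\<in>set \<pi>. (1 / real m) *\<^sub>R (- s0 * \<omega> z w))"
        using m by (simp add: t_def wt_distinct[OF steps_distinct[OF \<pi>]] s_def sum_distrib_left field_simps sum_negf)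
      finally show ?thesis .
    qed
    \<comment> \<open>Jensen's inequality: since \<open>2 * s * m = s0\<close>, the exponent is an
      average, and the resulting expectation \<open>M0\<close> does not depend on the block
      length.\<close>
    also have "\<dots> \<le> (\<Sum>z\<in>set \<pi>. (1 / real m) * exp (- s0 * \<omega> z w))"
      using card m by (intro convex_on_sum[OF _ _ exp_convex]) auto
    also have "\<dots> = (\<Sum>z\<in>set \<pi>. exp (- s0 * \<omega> z w)) / real m"
      by (simp add: sum_divide_distrib)
    finally have "exp (- s * lpp (\<lambda>z. \<omega> z w) 0 (diag b)) \<le> \<kappa> * ((\<Sum>z\<in>set \<pi>. exp (- s0 * \<omega> z w)) / real m) + 1 / \<kappa>"
      using \<kappa> by simp
    then show ?thesis using True q by (simp add: U_def)
  qed
  note I = integrable_marginal[OF H2]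
  have iB: "integrable M (indicat_real B)"
    by (rule integrable_const_bound[where B = 1]) (auto simp: indicator_def)
  have intU: "integrable M U"
    unfolding U_def using I iB by (intro Bochner_Integration.integrable_add integrable_mult_right integrable_divide Bochner_Integration.integrable_sum) auto
  have "(\<integral>w. U w \<partial>M) = q + \<kappa> * ((\<Sum>z\<in>set \<pi>. M0) / real m) + prob B / \<kappa>"
    unfolding U_def M0_def using I iB by (simp add: prob_space)
  also have "(\<Sum>z\<in>set \<pi>. M0) / real m = M0" using card m by simp
  finally have "(\<integral>w. U w \<partial>M) = q + \<kappa> * M0 + prob B / \<kappa>" .
  moreover have "prob B / \<kappa> \<le> (1 - q) / 4"
    using b0[OF b(2)] \<kappa> by (simp add: B_def field_simps)
  ultimately have EU: "(\<integral>w. U w \<partial>M) \<le> (1 + q) / 2" using \<kappa>M by argo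
  have "(\<integral>\<^sup>+w. ennreal (exp (- s * lpp (\<lambda>z. \<omega> z w) 0 (diag b))) \<partial>M) \<le> (\<integral>\<^sup>+w. ennreal (U w) \<partial>M)"
    by (intro nn_integral_mono ennreal_leI bound)
  also have "\<dots> = ennreal (\<integral>w. U w \<partial>M)"
    by (rule nn_integral_eq_integral[OF intU])
       (use \<kappa> q in \<open>auto simp: U_def intro!: AE_I2 add_nonneg_nonneg mult_nonneg_nonneg divide_nonneg_nonneg sum_nonneg\<close>)
  also have "\<dots> \<le> ennreal ((1 + q) / 2)" by (rule ennreal_leI[OF EU])
  finally show ?thesis using that[OF b(1) s, of "(1 + q) / 2"] q by auto
qed

text \<open>For a negative passage time all \<open>J\<close> tubes of about \<open>n / b\<close>
  independent blocks have to fail, and \<open>J\<close> can be taken as large as \<open>R\<close>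
  requires. A successful tube makes up for its two connecting pieces, whose length does not grow
  with \<open>n\<close>, unless one of their vertices has a weight of order \<open>- n\<close>; by
  \<open>H3\<close> this is as rare as desired. The two failures are combined by a union bound, so
  no independence between tubes and connecting pieces is needed.\<close>

lemma lower_tail_superexponential:
  assumes dim: "CARD('d) \<ge> 2"
    and \<delta>: "\<delta> > 0" and H1: "(\<lambda>n. prob {w \<in> space M. lpp (\<lambda>z. \<omega> z w) 0 (diag n) < \<delta> * real n}) \<longlonglongrightarrow> 0"
    and s0: "s0 > 0" and H2: "integrable N (\<lambda>y. exp (- s0 * y))"
    and H3: "\<And>R. \<forall>\<^sub>F t in at_top. measure N {..< - t} \<le> exp (- R * t)"
  shows "\<forall>\<^sub>F n in sequentially. prob {w \<in> space M. lpp (\<lambda>z. \<omega> z w) 0 (diag n) < 0} \<le> exp (- R * real n)"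
proof -
  obtain i1 i2 :: 'd where i12: "i1 \<noteq> i2"
  proof -
    have "\<not> card (UNIV :: 'd set) \<le> Suc 0" using dim by simp
    then show ?thesis using that by (auto simp: card_le_Suc0_iff_eq)
  qed
  obtain b s \<rho> where b: "b \<ge> 1" and s: "s > 0" and \<rho>: "0 < \<rho>" "\<rho> < 1"
    and E: "(\<integral>\<^sup>+w. ennreal (exp (- s * lpp (\<lambda>z. \<omega> z w) 0 (diag b))) \<partial>M) \<le> ennreal \<rho>"
    using block_exponential[OF \<delta> H1 s0 H2] .
  define D where "D = CARD('d)"
  have D: "D \<ge> 1" by (simp add: D_def Suc_leI)
  \<comment> \<open>Half of the available exponent pays for the gain \<open>a\<close> demanded of a
    block: \<open>\<rho>'\<close> is the square root of \<open>\<rho>\<close>, hence still below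
    1.\<close>
  define a where "a = - ln \<rho> / (2 * s)"
  have a: "a > 0" using \<rho> s by (simp add: a_def divide_neg_pos ln_less_zero)
  define \<rho>' where "\<rho>' = exp (s * a) * \<rho>"
  have "ln \<rho>' = ln \<rho> / 2" using \<rho> s by (simp add: \<rho>'_def ln_mult a_def)
  moreover have "ln \<rho> < 0" using \<rho> by simp
  ultimately have \<rho>': "0 < \<rho>'" "ln \<rho>' < 0" using \<rho> unfolding \<rho>'_def by (simp, linarith)
  \<comment> \<open>The exponent \<open>J * K * (- ln \<rho>')\<close> has to reach
    \<open>(\<bar>R\<bar> + 1) * n\<close>, where the number \<open>K\<close> of blocks satisfies
    \<open>n \<le> 2 * K * b\<close>.\<close>
  define J where "J = nat \<lceil>2 * real b * (\<bar>R\<bar> + 1) / (- ln \<rho>')\<rceil> + 1"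
  have "2 * real b * (\<bar>R\<bar> + 1) / (- ln \<rho>') \<le> real J" unfolding J_def by linarith
  then have J: "2 * real b * (\<bar>R\<bar> + 1) \<le> real J * (- ln \<rho>')" using \<rho>' by (simp only: pos_divide_le_eq[of "- ln \<rho>'"] neg_0_less_iff_less)
  \<comment> \<open>In tube \<open>j\<close> the difference of the coordinates \<open>i1\<close> and
    \<open>i2\<close> stays within \<open>b\<close> of \<open>j * W\<close>, so a spacing of
    \<open>2 * b + 1\<close> makes different tubes disjoint.\<close>
  define W where "W = 2 * b + 1"
  define v where "v j = ((\<chi> i. if i = i1 then int (j * W) else 0) :: int ^ 'd)" for j
  define u where "u j k = v j + (diag (k * b) :: int ^ 'd)" for j k
  have u_nth: "u j k $ i = (if i = i1 then int (j * W) else 0) + int (k * b)" for j k i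
    by (simp add: u_def v_def diag_def)
  have u_le: "u j k $ i \<le> u j (Suc k) $ i" for j k i by (simp add: u_nth)
  have level_v: "level (v j) = int (j * W)" for j by (simp add: level_def v_def)
  have level_u: "level (u j k) = int (j * W + D * (k * b))" for j k
    by (simp add: u_def level_v D_def)
  let ?B = "\<lambda>(j, k). box_set (u j k) (u j (Suc k)) - {u j k}"
  have dis: "disjoint_family_on ?B UNIV"
  proof (unfold disjoint_family_on_def, intro ballI impI)
    fix p q :: "nat \<times> nat" assume "p \<noteq> q"
    obtain j k j' k' where pq: "p = (j, k)" "q = (j', k')" by (cases p, cases q)
    show "?B p \<inter> ?B q = {}"
    proof (rule ccontr)
      assume "?B p \<inter> ?B q \<noteq> {}"
      then obtain z where z: "z \<in> ?B p" "z \<in> ?B q" by blast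
      then have z1: "u j k $ i \<le> z $ i" "z $ i \<le> u j (Suc k) $ i" "u j' k' $ i \<le> z $ i" "z $ i \<le> u j' (Suc k') $ i" for i
        by (auto simp: pq box_set_def)
      have "int (j * W) - int b \<le> z $ i1 - z $ i2" "z $ i1 - z $ i2 \<le> int (j * W) + int b"
        "int (j' * W) - int b \<le> z $ i1 - z $ i2" "z $ i1 - z $ i2 \<le> int (j' * W) + int b"
        using z1[of i1] z1[of i2] i12 by (auto simp: u_nth algebra_simps)
      then have "\<bar>int (j * W) - int (j' * W)\<bar> \<le> 2 * int b" by linarith
      moreover have "\<bar>int (j * W) - int (j' * W)\<bar> = \<bar>int j - int j'\<bar> * int W"
        by (simp add: abs_mult flip: left_diff_distrib)
      moreover have "1 * int W \<le> \<bar>int j - int j'\<bar> * int W" if "j \<noteq> j'"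
        using that by (intro mult_right_mono) auto
      moreover have "int W = 2 * int b + 1" by (simp add: W_def)
      ultimately have jj: "j = j'" by linarith
      \<comment> \<open>Within one tube a common point of two different blocks can only be the lower
        corner of the later one, and this corner is the excluded starting vertex.\<close>
      have le: "k \<le> k'" if "z $ i2 \<le> u j (Suc k') $ i2" "u j k $ i2 \<le> z $ i2" "z \<noteq> u j k"
          "\<And>i. u j k $ i \<le> z $ i" "\<And>i. z $ i \<le> u j (Suc k') $ i" for k k'
      proof (rule ccontr)
        assume "\<not> k \<le> k'"
        then have "Suc k' \<le> k" by simp
        then have "Suc k' * b \<le> k * b" by (intro mult_right_mono) auto
        then have "u j (Suc k') $ i \<le> u j k $ i" for i
          unfolding u_nth by (simp only: of_nat_le_iff add_le_cancel_left)
        then have "z = u j k" using that(4,5) by (simp add: vec_eq_iff) (meson order_antisym order_trans)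
        then show False using that by simp
      qed
      have "k \<le> k'" "k' \<le> k" using le[of k' k] le[of k k'] z1 z jj by (auto simp: pq)
      then show False using jj \<open>p \<noteq> q\<close> pq by simp
    qed
  qed
  let ?G = "\<lambda>p w. lpp (\<lambda>z. \<omega> z w) (u (fst p) (snd p)) (u (fst p) (Suc (snd p)))"
  have ind: "indep_vars (\<lambda>_. borel) (\<lambda>p w. s * (a - ?G p w)) I" for I
  proof -
    have "indep_vars (\<lambda>_. borel) ?G I"
      by (rule indep_lpp) (rule disjoint_family_on_mono[OF subset_UNIV dis[unfolded case_prod_unfold]])
    from indep_vars_compose2[OF this, of "\<lambda>_ y. s * (a - y)" "\<lambda>_. borel"] show ?thesis by simp
  qed
  have EG: "(\<integral>\<^sup>+w. ennreal (exp (s * (a - ?G p w))) \<partial>M) \<le> ennreal \<rho>'" for p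
  proof -
    obtain j k where p: "p = (j, k)" by (cases p)
    have "u j (Suc k) = diag b + u j k" by (simp add: u_def diag_def vec_eq_iff)
    then have d: "distr M borel (?G p) = distr M borel (\<lambda>w. lpp (\<lambda>z. \<omega> z w) 0 (diag b))"
      using distr_lpp_shift[of 0 "diag b" "u j k"] by (simp add: p diag_def)
    have "(\<integral>\<^sup>+w. ennreal (exp (s * (a - ?G p w))) \<partial>M) = (\<integral>\<^sup>+y. ennreal (exp (s * (a - y))) \<partial>distr M borel (?G p))"
      by (subst nn_integral_distr) auto
    also have "\<dots> = (\<integral>\<^sup>+w. ennreal (exp (s * (a - lpp (\<lambda>z. \<omega> z w) 0 (diag b)))) \<partial>M)"
      unfolding d by (subst nn_integral_distr) auto
    also have "\<dots> = (\<integral>\<^sup>+w. ennreal (exp (s * a)) * ennreal (exp (- s * lpp (\<lambda>z. \<omega> z w) 0 (diag b))) \<partial>M)"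
      by (intro nn_integral_cong) (simp add: ennreal_mult[symmetric] exp_add[symmetric] algebra_simps)
    also have "\<dots> \<le> ennreal (exp (s * a)) * ennreal \<rho>"
      using E by (subst nn_integral_cmult) (auto intro!: mult_left_mono)
    finally show ?thesis using \<rho> by (simp add: \<rho>'_def ennreal_mult)
  qed
  have tubes: "prob {w \<in> space M. \<forall>j<J. (\<Sum>k<K. ?G (j, k) w) \<le> a * real K} \<le> \<rho>' ^ (J * K)" for K
  proof -
    have "prob {w \<in> space M. \<forall>j<J. (\<Sum>k<K. ?G (j, k) w) \<le> a * real K} \<le>
       prob {w \<in> space M. 0 \<le> (\<Sum>p\<in>{..<J} \<times> {..<K}. s * (a - ?G p w))}"
    proof (rule finite_measure_mono)
      show "{w \<in> space M. \<forall>j<J. (\<Sum>k<K. ?G (j, k) w) \<le> a * real K} \<subseteq>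
         {w \<in> space M. 0 \<le> (\<Sum>p\<in>{..<J} \<times> {..<K}. s * (a - ?G p w))}"
      proof (intro subsetI CollectI conjI)
        fix w assume w: "w \<in> {w \<in> space M. \<forall>j<J. (\<Sum>k<K. ?G (j, k) w) \<le> a * real K}"
        then show "w \<in> space M" by simp
        have "(\<Sum>p\<in>{..<J} \<times> {..<K}. s * (a - ?G p w)) = (\<Sum>j<J. s * (a * real K - (\<Sum>k<K. ?G (j, k) w)))"
          using sum.cartesian_product[of "\<lambda>j k. s * (a - ?G (j, k) w)" "{..<K}" "{..<J}"]
          by (auto simp: sum_distrib_left[symmetric] sum_subtractf case_prod_unfold mult.commute)
        also have "\<dots> \<ge> 0" using w s by (intro sum_nonneg mult_nonneg_nonneg) auto
        finally show "0 \<le> (\<Sum>p\<in>{..<J} \<times> {..<K}. s * (a - ?G p w))" .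
      qed
    qed measurable
    also have "\<dots> \<le> \<rho>' ^ card ({..<J} \<times> {..<K})"
      using \<rho>' by (intro chernoff ind EG) auto
    finally show ?thesis by simp
  qed
  \<comment> \<open>\<open>m0\<close> bounds the length of each connecting piece. \<open>c0\<close>
    is such that weights of at least \<open>- c0 * n\<close> along both pieces cost no more than the
    gain \<open>a * K\<close> of a tube. \<open>R'\<close> also absorbs the number of connecting
    vertices.\<close>
  define m0 where "m0 = D * (J * W + b) + 1"
  have m0: "m0 \<ge> 1" by (simp add: m0_def)
  define c0 where "c0 = a / (4 * real m0 * real b)"
  have c0: "c0 > 0" using a b m0 by (simp add: c0_def)
  have J1: "J \<ge> 1" by (simp add: J_def)
  define R' where "R' = (\<bar>R\<bar> + ln (4 * real J * real m0)) / c0"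
  have "\<forall>\<^sub>F t in at_top. measure N {..< - t} \<le> exp (- R' * t)" by (rule H3)
  moreover have "filterlim (\<lambda>n. c0 * real n) at_top sequentially"
    using c0 by real_asymp
  ultimately have ev1: "\<forall>\<^sub>F n in sequentially. measure N {..< - (c0 * real n)} \<le> exp (- R' * (c0 * real n))"
    by (rule eventually_compose_filterlim)
  have ev2: "\<forall>\<^sub>F n in sequentially. n \<ge> 2 * (J * W + b) + 1" by (rule eventually_ge_at_top)
  show ?thesis using ev1 ev2
  proof eventually_elim
    case (elim n)
    define K where "K = (n - J * W) div b"
    define \<tau> where "\<tau> = c0 * real n"
    have Kb: "K * b \<le> n - J * W" "n - J * W < K * b + b"
      using b dividend_less_times_div[of b "n - J * W"] by (auto simp: K_def mult.commute)
    have nK: "n < K * b + (J * W + b)" using Kb(2) elim(2) by (simp add: less_diff_conv2 algebra_simps)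
    have "n < 2 * x" if "n < x + y" "2 * y + 1 \<le> n" for x y :: nat using that by linarith
    from this[OF nK elim(2)] have "n < 2 * (K * b)" .
    then have Kn: "real n \<le> 2 * (real K * real b)" by (simp flip: of_nat_mult)
    have end_le: "u j K $ i \<le> (diag n :: int ^ 'd) $ i" if "j < J" for j i
    proof -
      have "j * W \<le> J * W" using that by (intro mult_right_mono) auto
      moreover have "x + y \<le> n" if "x \<le> z" "y \<le> n - z" "2 * (z + b) + 1 \<le> n" for x y z :: nat
        using that by presburger
      ultimately have "j * W + K * b \<le> n" using Kb(1) elim(2) by blast
      then have "int (j * W) + int (K * b) \<le> int n" by (simp only: of_nat_add[symmetric] of_nat_le_iff)
      moreover have "0 \<le> int (j * W)" by simp
      moreover have "(if c then x else 0) + y \<le> z" if "x + y \<le> z" "0 \<le> x" for c and x y z :: int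
        using that by auto
      ultimately have "(if i = i1 then int (j * W) else 0) + int (K * b) \<le> int n" by blast
      then show ?thesis unfolding u_nth diag_def vec_lambda_beta .
    qed
    have "\<exists>\<pi>. steps 0 \<pi> (u j 0)" for j by (rule steps_exist) (simp add: u_nth)
    then obtain \<pi>1 where \<pi>1: "steps 0 (\<pi>1 j) (u j 0)" for j by metis
    have "\<exists>\<pi>. j < J \<longrightarrow> steps (u j K) \<pi> (diag n)" for j using steps_exist[OF end_le] by blast
    then obtain \<pi>2 where \<pi>2: "j < J \<Longrightarrow> steps (u j K) (\<pi>2 j) (diag n)" for j by metis
    have l1: "length (\<pi>1 j) \<le> m0" if "j < J" for j
    proof -
      have "length (\<pi>1 j) = j * W" using steps_level[OF \<pi>1, of j] by (simp add: level_u flip: of_nat_mult)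
      also have "\<dots> \<le> J * W" using that by (intro mult_right_mono) auto
      also have "\<dots> \<le> D * (J * W)" using D by simp
      finally show ?thesis by (simp add: m0_def algebra_simps)
    qed
    have l2: "length (\<pi>2 j) \<le> m0" if "j < J" for j
    proof -
      have "D * n = j * W + D * (K * b) + length (\<pi>2 j)"
        using steps_level[OF \<pi>2[OF that]] unfolding level_u level_diag D_def[symmetric] by (simp only: of_nat_add[symmetric] of_nat_eq_iff)
      then have "length (\<pi>2 j) + D * (K * b) \<le> D * n" by simp
      also have "\<dots> \<le> D * (J * W + b + K * b)" using nK by (intro mult_left_mono) auto
      finally show ?thesis by (simp add: m0_def algebra_simps)
    qed
    define V where "V = (\<Union>j<J. set (\<pi>1 j) \<union> set (\<pi>2 j))"
    have V: "finite V" by (simp add: V_def)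
    have cV: "real (card V) \<le> 2 * real J * real m0"
    proof -
      have "card V \<le> (\<Sum>j<J. card (set (\<pi>1 j) \<union> set (\<pi>2 j)))"
        unfolding V_def by (rule card_UN_le) simp
      also have "\<dots> \<le> (\<Sum>j<J. 2 * m0)"
      proof (rule sum_mono)
        fix j assume "j \<in> {..<J}"
        then show "card (set (\<pi>1 j) \<union> set (\<pi>2 j)) \<le> 2 * m0"
          using l1[of j] l2[of j] card_length[of "\<pi>1 j"] card_length[of "\<pi>2 j"] card_Un_le[of "set (\<pi>1 j)" "set (\<pi>2 j)"] by simp
      qed
      finally have "card V \<le> 2 * J * m0" by (simp add: algebra_simps)
      then have "real (card V) \<le> real (2 * J * m0)" by (simp only: of_nat_le_iff)
      then show ?thesis by simp
    qed
    have \<tau>: "2 * real m0 * \<tau> \<le> a * real K"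
    proof -
      have "2 * real m0 * \<tau> = a * real n / (2 * real b)" using m0 b by (simp add: \<tau>_def c0_def field_simps)
      also have "\<dots> \<le> a * (2 * (real K * real b)) / (2 * real b)"
        using a Kn b by (intro divide_right_mono mult_left_mono) auto
      also have "\<dots> = a * real K" using b by simp
      finally show ?thesis .
    qed
    have sub: "{w \<in> space M. lpp (\<lambda>z. \<omega> z w) 0 (diag n) < 0} \<subseteq>
       {w \<in> space M. \<forall>j<J. (\<Sum>k<K. ?G (j, k) w) \<le> a * real K} \<union> (\<Union>z\<in>V. {w \<in> space M. \<omega> z w < - \<tau>})"
    proof (rule subsetI, rule ccontr)
      fix w assume w: "w \<in> {w \<in> space M. lpp (\<lambda>z. \<omega> z w) 0 (diag n) < 0}"
        and nw: "w \<notin> {w \<in> space M. \<forall>j<J. (\<Sum>k<K. ?G (j, k) w) \<le> a * real K} \<union> (\<Union>z\<in>V. {w \<in> space M. \<omega> z w < - \<tau>})"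
      then obtain j where j: "j < J" "(\<Sum>k<K. ?G (j, k) w) > a * real K" by auto
      let ?\<sigma> = "\<lambda>z. \<omega> z w"
      have vert: "?\<sigma> z \<ge> - \<tau>" if "z \<in> V" for z using nw w that by auto
      have \<tau>0: "\<tau> \<ge> 0" using c0 by (simp add: \<tau>_def)
      have w1: "wt ?\<sigma> (\<pi>1 j) \<ge> - \<tau> * real m0"
      proof -
        have "- \<tau> * real (length (\<pi>1 j)) \<le> wt ?\<sigma> (\<pi>1 j)"
          using vert j by (intro wt_ge_const) (auto simp: V_def)
        moreover have "\<tau> * real (length (\<pi>1 j)) \<le> \<tau> * real m0" using l1[OF j(1)] \<tau>0 by (intro mult_left_mono) auto
        ultimately show ?thesis by simp
      qed
      have w2: "wt ?\<sigma> (\<pi>2 j) \<ge> - \<tau> * real m0"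
      proof -
        have "- \<tau> * real (length (\<pi>2 j)) \<le> wt ?\<sigma> (\<pi>2 j)"
          using vert j by (intro wt_ge_const) (auto simp: V_def)
        moreover have "\<tau> * real (length (\<pi>2 j)) \<le> \<tau> * real m0" using l2[OF j(1)] \<tau>0 by (intro mult_left_mono) auto
        ultimately show ?thesis by simp
      qed
      have mid: "(\<Sum>k<K. ?G (j, k) w) \<le> lpp ?\<sigma> (u j 0) (u j K)" and ule: "\<And>i. u j 0 $ i \<le> u j K $ i"
        using lpp_chain[of K "u j" ?\<sigma>] u_le by auto
      have "wt ?\<sigma> (\<pi>1 j) + lpp ?\<sigma> (u j 0) (u j K) + wt ?\<sigma> (\<pi>2 j) \<le> lpp ?\<sigma> 0 (diag n)"
      proof -
        have "0 $ i \<le> u j 0 $ i" for i by (simp add: u_nth)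
        have "wt ?\<sigma> (\<pi>1 j) \<le> lpp ?\<sigma> 0 (u j 0)" "wt ?\<sigma> (\<pi>2 j) \<le> lpp ?\<sigma> (u j K) (diag n)"
          using lpp_ge[OF \<pi>1] lpp_ge[OF \<pi>2[OF j(1)]] by auto
        moreover have "lpp ?\<sigma> 0 (u j 0) + lpp ?\<sigma> (u j 0) (u j K) \<le> lpp ?\<sigma> 0 (u j K)"
          using ule by (intro lpp_superadd) (auto simp: u_nth)
        moreover have "lpp ?\<sigma> 0 (u j K) + lpp ?\<sigma> (u j K) (diag n) \<le> lpp ?\<sigma> 0 (diag n)"
          using end_le[OF j(1)] by (intro lpp_superadd) (auto simp: u_nth)
        ultimately show ?thesis by linarith
      qed
      then have "0 < lpp ?\<sigma> 0 (diag n)" using w1 w2 mid j(2) \<tau> by (simp add: algebra_simps)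
      then show False using w by simp
    qed
    have "prob {w \<in> space M. lpp (\<lambda>z. \<omega> z w) 0 (diag n) < 0} \<le>
       prob ({w \<in> space M. \<forall>j<J. (\<Sum>k<K. ?G (j, k) w) \<le> a * real K} \<union> (\<Union>z\<in>V. {w \<in> space M. \<omega> z w < - \<tau>}))"
      using V by (intro finite_measure_mono[OF sub] sets.Un sets.finite_UN) measurable
    also have "\<dots> \<le> prob {w \<in> space M. \<forall>j<J. (\<Sum>k<K. ?G (j, k) w) \<le> a * real K} + prob (\<Union>z\<in>V. {w \<in> space M. \<omega> z w < - \<tau>})"
      using V by (intro measure_Un_le sets.finite_UN) measurable
    finally have split: "prob {w \<in> space M. lpp (\<lambda>z. \<omega> z w) 0 (diag n) < 0} \<le>
       prob {w \<in> space M. \<forall>j<J. (\<Sum>k<K. ?G (j, k) w) \<le> a * real K} + prob (\<Union>z\<in>V. {w \<in> space M. \<omega> z w < - \<tau>})" .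
    have "prob (\<Union>z\<in>V. {w \<in> space M. \<omega> z w < - \<tau>}) \<le> (\<Sum>z\<in>V. prob {w \<in> space M. \<omega> z w < - \<tau>})"
      using V by (intro measure_UNION_le) measurable
    also have "\<dots> = real (card V) * measure N {..< - \<tau>}"
      using prob_marginal[of "{..< - \<tau>}"] by simp
    also have "\<dots> \<le> (2 * real J * real m0) * exp (- R' * \<tau>)"
      using cV elim(1) by (intro mult_mono) (auto simp: \<tau>_def)
    also have "\<dots> \<le> exp (- R * real n) / 2"
    proof -
      have n1: "real n \<ge> 1" using elim(2) by simp
      have Jm: "4 * real J * real m0 \<ge> 1"
      proof -
        have "4 * J * m0 \<ge> 1" using J1 m0 by simp
        then have "real (4 * J * m0) \<ge> real 1" by (simp only: of_nat_le_iff)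
        then show ?thesis by simp
      qed
      have "- R' * \<tau> = - \<bar>R\<bar> * real n - ln (4 * real J * real m0) * real n"
      proof -
        have "R' * \<tau> = (\<bar>R\<bar> + ln (4 * real J * real m0)) * real n" using c0 by (simp add: R'_def \<tau>_def)
        then show ?thesis by (simp add: distrib_right)
      qed
      also have "\<dots> \<le> - R * real n - ln (4 * real J * real m0)"
      proof -
        have "R * real n \<le> \<bar>R\<bar> * real n" by (intro mult_right_mono) auto
        moreover have "ln (4 * real J * real m0) * 1 \<le> ln (4 * real J * real m0) * real n"
          using Jm n1 by (intro mult_left_mono) auto
        ultimately show ?thesis by simp
      qed
      finally have "exp (- R' * \<tau>) \<le> exp (- R * real n - ln (4 * real J * real m0))" by simp
      also have "\<dots> = exp (- R * real n) / (4 * real J * real m0)" using Jm by (simp add: exp_diff)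
      finally have "(2 * real J * real m0) * exp (- R' * \<tau>) \<le> (2 * real J * real m0) * (exp (- R * real n) / (4 * real J * real m0))"
        by (intro mult_left_mono) auto
      also have "\<dots> = exp (- R * real n) / 2" using J1 m0 by simp
      finally show ?thesis .
    qed
    finally have conn: "prob (\<Union>z\<in>V. {w \<in> space M. \<omega> z w < - \<tau>}) \<le> exp (- R * real n) / 2" .
    have "prob {w \<in> space M. \<forall>j<J. (\<Sum>k<K. ?G (j, k) w) \<le> a * real K} \<le> exp (- R * real n) / 2"
    proof -
      have n1: "real n \<ge> 1" using elim(2) by simp
      have "real (J * K) * ln \<rho>' \<le> - R * real n - 1"
      proof -
        have "(\<bar>R\<bar> + 1) * real n \<le> (\<bar>R\<bar> + 1) * (2 * (real K * real b))" using Kn by (intro mult_left_mono) auto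
        also have "\<dots> = (2 * real b * (\<bar>R\<bar> + 1)) * real K" by simp
        also have "\<dots> \<le> (real J * (- ln \<rho>')) * real K" using J by (intro mult_right_mono) auto
        finally have "(\<bar>R\<bar> + 1) * real n \<le> - (real (J * K) * ln \<rho>')" by (simp add: algebra_simps)
        moreover have "R * real n + 1 \<le> (\<bar>R\<bar> + 1) * real n"
        proof -
          have "R * real n \<le> \<bar>R\<bar> * real n" by (intro mult_right_mono) auto
          moreover have "(\<bar>R\<bar> + 1) * real n = \<bar>R\<bar> * real n + real n" by (simp add: distrib_right)
          ultimately show ?thesis using n1 by linarith
        qed
        ultimately show ?thesis by linarith
      qed
      then have "exp (real (J * K) * ln \<rho>') \<le> exp (- R * real n) * exp (- 1)" by (simp flip: exp_add)
      also have "\<dots> \<le> exp (- R * real n) * (1 / 2)"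
        using exp_ge_add_one_self[of 1] by (intro mult_left_mono) (auto simp: exp_minus field_simps)
      finally have "exp (real (J * K) * ln \<rho>') \<le> exp (- R * real n) / 2" by simp
      moreover have "exp (real (J * K) * ln \<rho>') = \<rho>' ^ (J * K)"
        using \<rho>' unfolding exp_of_nat_mult by simp
      ultimately show ?thesis using tubes[of K] by linarith
    qed
    then show ?case using split conn by simp
  qed
qed

end

section \<open>Excursions\<close>

lemma steps_nth_diff: "steps x \<pi> y \<Longrightarrow> y $ i - x $ i \<le> int (length \<pi>)"
proof (induction \<pi> arbitrary: x)
  case (Cons z \<pi>)
  then obtain j where "z - x = axis j 1" and s: "steps z \<pi> y" by (auto simp: steps_Cons)
  moreover from this(1) have "z $ i - x $ i = axis j 1 $ i" by (metis vector_minus_component)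
  moreover have "axis j 1 $ i \<le> (1 :: int)" by (simp add: axis_def)
  ultimately show ?case using Cons.IH[OF s] by simp
qed simp

lemma steps_segment:
  fixes \<gamma> :: "(int ^ 'd::finite) list"
  assumes "directed_path \<gamma>" "a \<le> b" "b < length \<gamma>"
  shows "steps (\<gamma> ! a) (map ((!) \<gamma>) [Suc a..<Suc b]) (\<gamma> ! b)"
  using assms(2,3)
proof (induction b)
  case (Suc b)
  show ?case
  proof (cases "a = Suc b")
    case False
    then have ab: "a \<le> b" using Suc.prems by simp
    then have "steps (\<gamma> ! a) (map ((!) \<gamma>) [Suc a..<Suc b]) (\<gamma> ! b)" using Suc by simp
    moreover have "steps (\<gamma> ! b) [\<gamma> ! Suc b] (\<gamma> ! Suc b)"
      using assms(1) Suc.prems by (auto simp: steps_Cons directed_path_def successively_conv_nth)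
    ultimately have "steps (\<gamma> ! a) (map ((!) \<gamma>) [Suc a..<Suc b] @ [\<gamma> ! Suc b]) (\<gamma> ! Suc b)"
      by (rule steps_appendI)
    then show ?thesis using ab by simp
  qed simp
qed simp

lemma paths_directed: "\<gamma> \<in> paths n \<Longrightarrow> directed_path \<gamma>"
  by (simp add: paths_def)

lemma paths_nth_box:
  fixes \<gamma> :: "(int ^ 'd::finite) list"
  assumes \<gamma>: "\<gamma> \<in> paths n" and k: "k < length \<gamma>"
  shows "0 \<le> (\<gamma> ! k) $ i" "(\<gamma> ! k) $ i \<le> int n"
proof -
  have d: "directed_path \<gamma>" and ne: "\<gamma> \<noteq> []" and h: "\<gamma> ! 0 = 0" and l: "\<gamma> ! (length \<gamma> - 1) = diag n"
    using \<gamma> by (auto simp: paths_def hd_conv_nth last_conv_nth diag_def)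
  show "0 \<le> (\<gamma> ! k) $ i" using steps_le[OF steps_segment[OF d, of 0 k]] k h by (metis le0 zero_index)
  show "(\<gamma> ! k) $ i \<le> int n" using steps_le[OF steps_segment[OF d, of k "length \<gamma> - 1"]] k l ne
    by (simp add: diag_def)
qed

text \<open>The detours of a competitor: it leaves \<open>\<gamma>\<close> at index
  \<open>p\<close>, rejoins it at index \<open>q\<close>, and \<open>\<pi>\<close> lists only the
  vertices strictly between. An index of \<open>C\<close> lies between \<open>p\<close> and
  \<open>q\<close>. The set \<open>I\<close> of allowed values of \<open>q - p\<close> serves to
  treat one scale at a time.\<close>

definition excursions :: "(int ^ 'd) list \<Rightarrow> nat set \<Rightarrow> nat set \<Rightarrow> (int ^ 'd) list set" where
  "excursions \<gamma> C I = {\<pi>. \<exists>p q c. c \<in> C \<and> p < c \<and> c < q \<and> q < length \<gamma> \<and> q - p \<in> I \<and>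
     steps (\<gamma> ! p) (\<pi> @ [\<gamma> ! q]) (\<gamma> ! q) \<and> set \<pi> \<inter> set \<gamma> = {}}"

lemma excursions_box:
  fixes \<gamma> :: "(int ^ 'd::finite) list"
  assumes \<gamma>: "\<gamma> \<in> paths n" and \<pi>: "\<pi> \<in> excursions \<gamma> C I"
  shows "set \<pi> \<subseteq> box_set 0 (diag n) - set \<gamma>"
proof
  fix z assume z: "z \<in> set \<pi>"
  obtain p q where pq: "p < q" "q < length \<gamma>" "steps (\<gamma> ! p) (\<pi> @ [\<gamma> ! q]) (\<gamma> ! q)" "set \<pi> \<inter> set \<gamma> = {}"
    using \<pi> unfolding excursions_def by (auto dest: less_trans)
  have "z \<in> box_set (\<gamma> ! p) (\<gamma> ! q)" using steps_box[OF pq(3), of z] z by auto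
  moreover have "0 \<le> (\<gamma> ! p) $ i" "(\<gamma> ! q) $ i \<le> int n" for i
    using paths_nth_box[OF \<gamma>] pq by auto
  ultimately have "z \<in> box_set 0 (diag n)"
    by (auto simp: box_set_def diag_def intro: order_trans)
  then show "z \<in> box_set 0 (diag n) - set \<gamma>" using z pq(4) by auto
qed

lemma finite_excursions:
  fixes \<gamma> :: "(int ^ 'd::finite) list"
  assumes \<gamma>: "\<gamma> \<in> paths n"
  shows "finite (excursions \<gamma> C I)"
proof (rule finite_subset)
  show "excursions \<gamma> C I \<subseteq> {\<pi>. set \<pi> \<subseteq> box_set 0 (diag n) \<and> distinct \<pi>}"
  proof
    fix \<pi> assume \<pi>: "\<pi> \<in> excursions \<gamma> C I"
    then obtain x y where "steps x (\<pi> @ [y]) y" by (auto simp: excursions_def)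
    then have "distinct \<pi>" using steps_distinct by fastforce
    then show "\<pi> \<in> {\<pi>. set \<pi> \<subseteq> box_set 0 (diag n) \<and> distinct \<pi>}"
      using excursions_box[OF \<gamma> \<pi>] by auto
  qed
  show "finite {\<pi> :: (int ^ 'd) list. set \<pi> \<subseteq> box_set 0 (diag n) \<and> distinct \<pi>}"
    by (rule finite_subset_distinct) (rule finite_box_set)
qed

lemma card_box_set_shift:
  fixes x y v :: "int ^ 'd::finite"
  shows "card (box_set (x + v) (y + v)) = card (box_set x y)"
proof -
  have "bij_betw (\<lambda>z. z + v) (box_set x y) (box_set (x + v) (y + v))"
    by (rule bij_betwI[where g = "\<lambda>z. z - v"]) (auto simp: box_set_def algebra_simps)
  then show ?thesis by (simp add: bij_betw_same_card)
qed

text \<open>Composition with the transposition of \<open>i\<close> and \<open>j\<close> permutes the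
  bijections. Hence the sum of all permuted copies of a vector has equal coordinates.\<close>

lemma sum_bij_const:
  fixes v :: "int ^ 'd::finite" and i j :: 'd
  shows "(\<Sum>p | bij p. v $ p i) = (\<Sum>p | bij p. v $ p j)"
  by (rule sum.reindex_bij_witness[where i = "\<lambda>p. p \<circ> Transposition.transpose i j" and j = "\<lambda>p. p \<circ> Transposition.transpose i j"])
     (auto simp: o_assoc[symmetric] intro!: bij_comp)

section \<open>Excursions around finitely many points of a path, on one scale and on all
  scales\<close>

context iid_lattice_field
begin

text \<open>Concatenating the images of a vector under all coordinate permutations gives a diagonal vector, so
  superadditivity reduces a general direction to the diagonal one.\<close>

lemma directional_upper_tail:
  fixes \<delta> :: real
  assumes H: "(\<lambda>m. prob {w \<in> space M. lpp (\<lambda>z. \<omega> z w) 0 (diag m) > - \<delta> * real m}) \<longlonglongrightarrow> 0" and e: "e > 0"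
  shows "\<exists>l0. \<forall>x y. (\<forall>i. x $ i \<le> y $ i) \<longrightarrow> level y - level x \<ge> int l0 \<longrightarrow>
     prob {w \<in> space M. lpp (\<lambda>z. \<omega> z w) x y > - (\<delta> / CARD('d)) * real_of_int (level y - level x)} \<le> e"
proof -
  define D where "D = CARD('d)"
  have D: "D \<ge> 1" by (simp add: D_def Suc_leI)
  have fin: "finite {p :: 'd \<Rightarrow> 'd. bij p}" by simp
  then obtain ps where ps: "set ps = {p :: 'd \<Rightarrow> 'd. bij p}" "distinct ps" using finite_distinct_list by blast
  define K where "K = length ps"
  have "id \<in> set ps" by (simp add: ps)
  then have K: "K \<ge> 1" by (cases ps) (auto simp: K_def)
  have "eventually (\<lambda>m. prob {w \<in> space M. lpp (\<lambda>z. \<omega> z w) 0 (diag m) > - \<delta> * real m} < e ^ K) sequentially"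
    using e by (intro order_tendstoD(2)[OF H]) simp
  then obtain m0 where m0: "prob {w \<in> space M. lpp (\<lambda>z. \<omega> z w) 0 (diag m) > - \<delta> * real m} < e ^ K" if "m \<ge> m0" for m
    by (auto simp: eventually_sequentially)
  show ?thesis
  proof (intro exI allI impI)
    fix x y :: "int ^ 'd"
    assume le: "\<forall>i. x $ i \<le> y $ i" and lev: "level y - level x \<ge> int (D * m0)"
    define v where "v = y - x"
    have v0: "v $ i \<ge> 0" for i using le by (simp add: v_def)
    define l where "l = level v"
    have l: "l = level y - level x" by (simp add: l_def v_def)
    define a where "a = - (\<delta> / CARD('d)) * real_of_int l"
    \<comment> \<open>A chain of points whose increments are the permuted copies of
      \<open>v\<close>. It ends on the diagonal at height \<open>c\<close>, where
      \<open>D * c = K * l\<close>, so the threshold \<open>a\<close> for each increment adds up to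
      the diagonal threshold \<open>- \<delta> * c\<close>.\<close>
    define s where "s k = (\<Sum>i<k. permv (ps ! i) v)" for k
    have s_Suc: "s (Suc k) = permv (ps ! k) v + s k" for k by (simp add: s_def)
    have s_le: "s k $ i \<le> s (Suc k) $ i" for k i using v0 by (simp add: s_Suc)
    have s_mono: "s k $ i \<le> s k' $ i" if "k \<le> k'" for k k' i
      using that by (rule lift_Suc_mono_le[of "\<lambda>k. s k $ i", OF s_le])
    define c where "c = (\<Sum>p | bij p. v $ p (undefined :: 'd))"
    have sK: "s K $ i = c" for i
    proof -
      have "s K $ i = (\<Sum>k<K. v $ (ps ! k) i)" by (simp add: s_def)
      also have "\<dots> = (\<Sum>p\<in>set ps. v $ p i)"
        using ps(2) by (intro sum.reindex_bij_betw bij_betw_nth) (auto simp: K_def)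
      also have "\<dots> = c" unfolding ps c_def by (rule sum_bij_const)
      finally show ?thesis .
    qed
    have c0: "c \<ge> 0" unfolding c_def using v0 by (intro sum_nonneg) auto
    have sKd: "s K = diag (nat c)" using c0 sK by (simp add: vec_eq_iff diag_def)
    have level_s: "level (s k) = int k * l" if "k \<le> K" for k
      using that
    proof (induction k)
      case (Suc k)
      then have "ps ! k \<in> set ps" by (simp add: K_def)
      then show ?case using Suc ps(1) by (simp add: s_Suc level_permv l_def algebra_simps)
    qed (simp add: s_def)
    have Dc: "int D * c = int K * l"
      using level_s[of K] c0 unfolding sKd by (simp add: D_def)
    have ind: "indep_vars (\<lambda>_. borel) (\<lambda>k w. lpp (\<lambda>z. \<omega> z w) (s k) (s (Suc k))) {..<K}"
    proof (rule indep_lpp, unfold disjoint_family_on_def, intro ballI impI)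
      have *: "(box_set (s k) (s (Suc k)) - {s k}) \<inter> (box_set (s k') (s (Suc k')) - {s k'}) = {}" if "k < k'" for k k'
      proof (rule ccontr)
        assume "\<not> ?thesis"
        then obtain z where z: "z \<in> box_set (s k) (s (Suc k))" "z \<in> box_set (s k') (s (Suc k'))" "z \<noteq> s k'" by blast
        have "z $ i \<le> s k' $ i" for i 
        proof -
          have "z $ i \<le> s (Suc k) $ i" using z(1) by (auto simp: box_set_def)
          also have "\<dots> \<le> s k' $ i" using that by (intro s_mono) simp
          finally show ?thesis .
        qed
        then have "z = s k'" using z(2) by (auto simp: box_set_def vec_eq_iff intro: order_antisym)
        then show False using z(3) by simp
      qed
      fix k k' :: nat assume "k \<noteq> k'"
      then show "(box_set (s k) (s (Suc k)) - {s k}) \<inter> (box_set (s k') (s (Suc k')) - {s k'}) = {}"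
        using *[of k k'] *[of k' k] by (cases "k < k'") (auto simp: Int_commute)
    qed
    define P where "P = prob {w \<in> space M. lpp (\<lambda>z. \<omega> z w) x y > a}"
    have pk: "prob ((\<lambda>w. lpp (\<lambda>z. \<omega> z w) (s k) (s (Suc k))) -` {a<..} \<inter> space M) = P" if "k < K" for k
    proof -
      have b: "bij (ps ! k)" using that ps(1) nth_mem[of k ps] by (auto simp: K_def)
      have "distr M borel (\<lambda>w. lpp (\<lambda>z. \<omega> z w) (0 + s k) (permv (ps ! k) v + s k)) =
          distr M borel (\<lambda>w. lpp (\<lambda>z. \<omega> z w) (permv (ps ! k) 0) (permv (ps ! k) v))"
        using v0 by (subst distr_lpp_shift) (auto simp: permv_def zero_vec_def)
      also have "\<dots> = distr M borel (\<lambda>w. lpp (\<lambda>z. \<omega> z w) 0 v)"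
        using v0 b by (intro distr_lpp_permv) auto
      also have "\<dots> = distr M borel (\<lambda>w. lpp (\<lambda>z. \<omega> z w) (0 + x) (v + x))"
        using v0 by (subst distr_lpp_shift) auto
      finally have d: "distr M borel (\<lambda>w. lpp (\<lambda>z. \<omega> z w) (s k) (s (Suc k))) = distr M borel (\<lambda>w. lpp (\<lambda>z. \<omega> z w) x y)"
        by (simp add: s_Suc v_def)
      from prob_distr_eq[OF d, of "{a<..}"] show ?thesis
        by (simp add: P_def vimage_def Int_def conj_commute)
    qed
    \<comment> \<open>The \<open>K\<close> passage times along the chain are independent, and by
      invariance each exceeds \<open>a\<close> with the same probability \<open>P\<close>. If all of
      them do, the diagonal passage time exceeds its own threshold, whence
      \<open>P ^ K < e ^ K\<close>. The bound is uniform in the direction because only the level of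
      \<open>v\<close> enters the choice of \<open>m0\<close>.\<close>
    have "P ^ K = (\<Prod>k<K. prob ((\<lambda>w. lpp (\<lambda>z. \<omega> z w) (s k) (s (Suc k))) -` {a<..} \<inter> space M))"
      by (simp add: pk)
    also have "\<dots> = prob (\<Inter>k<K. (\<lambda>w. lpp (\<lambda>z. \<omega> z w) (s k) (s (Suc k))) -` {a<..} \<inter> space M)"
      using K by (intro indep_varsD[OF ind, symmetric]) (auto simp: lessThan_empty_iff)
    also have "\<dots> \<le> prob {w \<in> space M. lpp (\<lambda>z. \<omega> z w) 0 (diag (nat c)) > - \<delta> * real (nat c)}"
    proof (rule finite_measure_mono)
      show "(\<Inter>k<K. (\<lambda>w. lpp (\<lambda>z. \<omega> z w) (s k) (s (Suc k))) -` {a<..} \<inter> space M) \<subseteq>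
          {w \<in> space M. lpp (\<lambda>z. \<omega> z w) 0 (diag (nat c)) > - \<delta> * real (nat c)}"
      proof (intro subsetI CollectI conjI)
        fix w assume w: "w \<in> (\<Inter>k<K. (\<lambda>w. lpp (\<lambda>z. \<omega> z w) (s k) (s (Suc k))) -` {a<..} \<inter> space M)"
        then have wk: "w \<in> (\<lambda>w. lpp (\<lambda>z. \<omega> z w) (s k) (s (Suc k))) -` {a<..} \<inter> space M" if "k < K" for k
          using that by blast
        then show "w \<in> space M" using K by auto
        have "(\<Sum>k<K. a) < (\<Sum>k<K. lpp (\<lambda>z. \<omega> z w) (s k) (s (Suc k)))"
          using wk K by (intro sum_strict_mono) (auto simp: lessThan_empty_iff)
        also have "\<dots> \<le> lpp (\<lambda>z. \<omega> z w) (s 0) (s K)" using lpp_chain[of K s] s_le by blast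
        finally have "(\<Sum>k<K. a) < lpp (\<lambda>z. \<omega> z w) (s 0) (s K)" .
        moreover have "s 0 = 0" by (simp add: s_def)
        ultimately have "real K * a < lpp (\<lambda>z. \<omega> z w) 0 (diag (nat c))" by (simp add: sKd)
        moreover have "real K * a = - \<delta> * real (nat c)"
        proof -
          have "real D * real_of_int c = real K * real_of_int l" using Dc by (metis of_int_mult of_int_of_nat_eq)
          then have "real K * real_of_int l / real D = real_of_int c" using D by (simp add: field_simps)
          moreover have "real K * a = - \<delta> * (real K * real_of_int l / real D)" by (simp add: a_def D_def)
          ultimately show ?thesis using c0 by simp
        qed
        ultimately show "- \<delta> * real (nat c) < lpp (\<lambda>z. \<omega> z w) 0 (diag (nat c))" by simp
      qed
    qed measurable
    also have "\<dots> < e ^ K"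
    proof (rule m0)
      have "int D * int m0 \<le> 1 * l" using lev l by simp
      also have "\<dots> \<le> int K * l"
      proof (rule mult_right_mono)
        show "0 \<le> l" unfolding l_def level_def using v0 by (intro sum_nonneg) auto
      qed (use K in simp)
      also have "\<dots> = int D * c" using Dc by simp
      finally show "m0 \<le> nat c" using D c0 by (simp add: le_nat_iff)
    qed
    finally have "P < e" using e by (meson less_imp_le power_less_imp_less_base)
    then show "prob {w \<in> space M. lpp (\<lambda>z. \<omega> z w) x y > - (\<delta> / CARD('d)) * real_of_int (level y - level x)} \<le> e"
      by (simp add: P_def a_def l)
  qed
qed


lemma excursion_event_sets:
  fixes \<gamma> :: "(int ^ 'd) list"
  assumes \<gamma>: "\<gamma> \<in> paths n" and B: "box_set 0 (diag n) - set \<gamma> \<subseteq> B"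
  shows "{\<sigma> \<in> space (PiM B (\<lambda>_. borel)). \<forall>\<pi>\<in>excursions \<gamma> C I. wt \<sigma> \<pi> \<le> 0} \<in> sets (PiM B (\<lambda>_. borel))"
proof (rule sets.sets_Collect_finite_All[OF _ finite_excursions[OF \<gamma>]])
  fix \<pi> assume \<pi>: "\<pi> \<in> excursions \<gamma> C I"
  have "(\<lambda>\<sigma>. wt \<sigma> \<pi>) \<in> borel_measurable (PiM B (\<lambda>_. borel))"
    using excursions_box[OF \<gamma> \<pi>] B by (intro borel_measurable_wt measurable_component_singleton) auto
  then show "{\<sigma> \<in> space (PiM B (\<lambda>_. borel)). wt \<sigma> \<pi> \<le> 0} \<in> sets (PiM B (\<lambda>_. borel))" by measurable
qed

lemma excursion_event_measurable:
  fixes \<gamma> :: "(int ^ 'd) list"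
  assumes \<gamma>: "\<gamma> \<in> paths n"
  shows "{w \<in> space M. \<forall>\<pi>\<in>excursions \<gamma> C I. wt (\<lambda>z. \<omega> z w) \<pi> \<le> 0} \<in> sets M"
  by (rule sets.sets_Collect_finite_All[OF _ finite_excursions[OF \<gamma>]]) measurable

text \<open>Excursions of bounded length around \<open>c\<close> stay in a cube about
  \<open>\<gamma> ! c\<close> whose size depends neither on \<open>n\<close> nor on
  \<open>\<gamma>\<close>. It is enough that all weights in these boundedly many vertices are at
  most 0.\<close>

lemma excursions_small_scale:
  assumes p: "measure N {..0} > 0"
  shows "\<exists>c>0. \<forall>n \<gamma> C. \<gamma> \<in> paths n \<longrightarrow> finite C \<longrightarrow> card C \<le> d0 \<longrightarrow>
     prob {w \<in> space M. \<forall>\<pi>\<in>excursions \<gamma> C {..<2 * R}. wt (\<lambda>z. \<omega> z w) \<pi> \<le> 0} \<ge> c"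
proof -
  interpret N: prob_space N by (rule prob_space_N)
  define m where "m = card (box_set (- diag (2 * R)) (diag (2 * R)) :: (int ^ 'd) set)"
  show ?thesis
  proof (intro exI[of _ "measure N {..0} ^ (d0 * m)"] conjI allI impI)
    show "measure N {..0} ^ (d0 * m) > 0" using p by simp
    fix n and C :: "nat set" and \<gamma> :: "(int ^ 'd) list"
    assume \<gamma>: "\<gamma> \<in> paths n" and C: "finite C" "card C \<le> d0"
    define V where "V = (\<Union>c\<in>C. box_set (\<gamma> ! c - diag (2 * R)) (\<gamma> ! c + diag (2 * R)))"
    have finV: "finite V" using C by (simp add: V_def finite_box_set)
    have "card V \<le> (\<Sum>c\<in>C. card (box_set (\<gamma> ! c - diag (2 * R)) (\<gamma> ! c + diag (2 * R))))"
      unfolding V_def by (rule card_UN_le) (rule C)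
    also have "\<dots> = (\<Sum>c\<in>C. m)"
    proof (rule sum.cong)
      fix c show "card (box_set (\<gamma> ! c - diag (2 * R)) (\<gamma> ! c + diag (2 * R))) = m"
        using card_box_set_shift[of "- diag (2 * R)" "\<gamma> ! c" "diag (2 * R)"] by (simp add: m_def add.commute)
    qed simp
    also have "\<dots> \<le> d0 * m" using C by simp
    finally have cV: "card V \<le> d0 * m" .
    have "measure N {..0} ^ (d0 * m) \<le> measure N {..0} ^ card V"
      using p cV by (intro power_decreasing) auto
    also have "\<dots> = (\<Prod>z\<in>V. prob (\<omega> z -` {..0} \<inter> space M))"
      using prob_marginal[of "{..0}"] by (simp add: vimage_def Int_def conj_commute)
    also have "\<dots> = prob {w \<in> space M. \<forall>z\<in>V. \<omega> z w \<le> 0}"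
    proof (cases "V = {}")
      case False
      have "(\<Prod>z\<in>V. prob (\<omega> z -` {..0} \<inter> space M)) = prob (\<Inter>z\<in>V. \<omega> z -` {..0} \<inter> space M)"
        using False finV by (intro indep_varsD[OF indep, symmetric]) auto
      also have "(\<Inter>z\<in>V. \<omega> z -` {..0} \<inter> space M) = {w \<in> space M. \<forall>z\<in>V. \<omega> z w \<le> 0}" using False by fastforce
      finally show ?thesis .
    qed (simp add: prob_space)
    also have "\<dots> \<le> prob {w \<in> space M. \<forall>\<pi>\<in>excursions \<gamma> C {..<2 * R}. wt (\<lambda>z. \<omega> z w) \<pi> \<le> 0}"
    proof (rule finite_measure_mono[OF _ excursion_event_measurable[OF \<gamma>]])
      have sub: "set \<pi> \<subseteq> V" if exc: "\<pi> \<in> excursions \<gamma> C {..<2 * R}" for \<pi>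
      proof
        fix z assume z: "z \<in> set \<pi>"
        obtain p q c where c: "c \<in> C" "p < c" "c < q" "q < length \<gamma>" "q - p < 2 * R"
            "steps (\<gamma> ! p) (\<pi> @ [\<gamma> ! q]) (\<gamma> ! q)"
          using exc unfolding excursions_def by auto
        note d = paths_directed[OF \<gamma>]
        have 1: "z \<in> box_set (\<gamma> ! p) (\<gamma> ! q)" using steps_box[OF c(6), of z] z by auto
        have 2: "(\<gamma> ! p) $ i \<le> (\<gamma> ! c) $ i" "(\<gamma> ! c) $ i \<le> (\<gamma> ! q) $ i"
            "(\<gamma> ! q) $ i - (\<gamma> ! p) $ i \<le> int (2 * R)" for i
          using steps_le[OF steps_segment[OF d, of p c]] steps_le[OF steps_segment[OF d, of c q]]
            steps_nth_diff[OF steps_segment[OF d, of p q], of i] c by auto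
        have "z \<in> box_set (\<gamma> ! c - diag (2 * R)) (\<gamma> ! c + diag (2 * R))"
        proof (unfold box_set_def, intro CollectI allI conjI)
          fix i
          have z: "(\<gamma> ! p) $ i \<le> z $ i" "z $ i \<le> (\<gamma> ! q) $ i" using 1 by (auto simp: box_set_def)
          show "(\<gamma> ! c - diag (2 * R)) $ i \<le> z $ i" "z $ i \<le> (\<gamma> ! c + diag (2 * R)) $ i"
            using z 2[of i] unfolding vector_minus_component vector_add_component diag_def vec_lambda_beta by linarith+
        qed
        then show "z \<in> V" using c(1) by (auto simp: V_def)
      qed
      show "{w \<in> space M. \<forall>z\<in>V. \<omega> z w \<le> 0} \<subseteq> {w \<in> space M. \<forall>\<pi>\<in>excursions \<gamma> C {..<2 * R}. wt (\<lambda>z. \<omega> z w) \<pi> \<le> 0}"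
      proof (intro subsetI CollectI conjI ballI)
        fix w \<pi> assume w: "w \<in> {w \<in> space M. \<forall>z\<in>V. \<omega> z w \<le> 0}"
        then show "w \<in> space M" by simp
        assume "\<pi> \<in> excursions \<gamma> C {..<2 * R}"
        from sub[OF this] have "wt (\<lambda>z. \<omega> z w) \<pi> \<le> 0 * real (length \<pi>)"
          using w by (intro wt_le_const) auto
        then show "wt (\<lambda>z. \<omega> z w) \<pi> \<le> 0" by simp
      qed
    qed
    finally show "measure N {..0} ^ (d0 * m) \<le> prob {w \<in> space M. \<forall>\<pi>\<in>excursions \<gamma> C {..<2 * R}. wt (\<lambda>z. \<omega> z w) \<pi> \<le> 0}" .
  qed
qed

lemma wt_segment_ge:
  assumes "finite I" "{a..<b} \<subseteq> I"
  shows "- (\<Sum>j\<in>I. \<bar>\<sigma> (f j)\<bar>) \<le> wt \<sigma> (map f [a..<b])"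
proof -
  have "wt \<sigma> (map f [a..<b]) = (\<Sum>j\<in>{a..<b}. \<sigma> (f j))"
    by (simp add: wt_def o_def interv_sum_list_conv_sum_set_nat)
  moreover have "- (\<Sum>j\<in>{a..<b}. \<bar>\<sigma> (f j)\<bar>) \<le> (\<Sum>j\<in>{a..<b}. \<sigma> (f j))"
    unfolding sum_negf[symmetric] by (intro sum_mono) auto
  moreover have "(\<Sum>j\<in>{a..<b}. \<bar>\<sigma> (f j)\<bar>) \<le> (\<Sum>j\<in>I. \<bar>\<sigma> (f j)\<bar>)"
    using assms by (intro sum_mono2) auto
  ultimately show ?thesis by linarith
qed

text \<open>A sum of absolute values dominates the weights of all subsegments at once, so one event
  for each rounded position controls every segment of \<open>\<gamma>\<close> that starts or ends
  there.\<close>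

lemma absolute_sum_tail:
  assumes B: "(\<integral>\<^sup>+y. ennreal (exp (s * (\<bar>y\<bar> - B))) \<partial>N) \<le> ennreal (1 / 2)" and s: "s > 0"
    and I: "finite I" "inj_on f I"
  shows "prob {w \<in> space M. B * real (card I) \<le> (\<Sum>j\<in>I. \<bar>\<omega> (f j) w\<bar>)} \<le> (1 / 2) ^ card I"
proof -
  have "indep_vars (\<lambda>_. borel) (\<lambda>z w. s * (\<bar>\<omega> z w\<bar> - B)) (f ` I)"
    using indep_vars_compose2[OF indep_on, where Y = "\<lambda>_ y. s * (\<bar>y\<bar> - B)" and N = "\<lambda>_. borel"] by simp
  then have "prob {w \<in> space M. 0 \<le> (\<Sum>z\<in>f ` I. s * (\<bar>\<omega> z w\<bar> - B))} \<le> (1 / 2) ^ card (f ` I)"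
    using I B by (intro chernoff) (auto simp: nn_integral_marginal[of "\<lambda>y. ennreal (exp (s * (\<bar>y\<bar> - B)))"])
  also have "{w \<in> space M. 0 \<le> (\<Sum>z\<in>f ` I. s * (\<bar>\<omega> z w\<bar> - B))} = {w \<in> space M. B * real (card I) \<le> (\<Sum>j\<in>I. \<bar>\<omega> (f j) w\<bar>)}"
    using s I by (auto simp: sum.reindex sum_distrib_left[symmetric] sum_subtractf zero_le_mult_iff mult.commute card_image)
  finally show ?thesis using I by (simp add: card_image)
qed

text \<open>At scale \<open>R\<close> the end points of an excursion are rounded to multiples of \<open>r = R div J\<close>, which leaves a number
  of pairs that does not depend on \<open>R\<close>.\<close>

lemma excursions_large_scale:
  fixes \<delta> s :: real and d0 :: nat
  assumes H: "(\<lambda>m. prob {w \<in> space M. lpp (\<lambda>z. \<omega> z w) 0 (diag m) > - \<delta> * real m}) \<longlonglongrightarrow> 0"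
    and \<delta>: "\<delta> > 0" and s: "s > 0" and E: "(\<integral>\<^sup>+y. ennreal (exp (s * \<bar>y\<bar>)) \<partial>N) < \<infinity>"
  shows "\<exists>R0. \<forall>R\<ge>R0. \<forall>n \<gamma> C. \<gamma> \<in> paths n \<longrightarrow> finite C \<longrightarrow> card C \<le> d0 \<longrightarrow>
     prob {w \<in> space M. \<forall>\<pi>\<in>excursions \<gamma> C {R..<2 * R}. wt (\<lambda>z. \<omega> z w) \<pi> \<le> 0} \<ge> 1 / 2"
proof -
  define D where "D = CARD('d)"
  have D: "D \<ge> 1" by (simp add: D_def Suc_leI)
  define \<delta>' where "\<delta>' = \<delta> / real D"
  have \<delta>': "\<delta>' > 0" using \<delta> D by (simp add: \<delta>'_def)
  obtain M1 where M1: "M1 \<ge> 0" "(\<integral>\<^sup>+y. ennreal (exp (s * \<bar>y\<bar>)) \<partial>N) = ennreal M1"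
    using E by (cases "\<integral>\<^sup>+y. ennreal (exp (s * \<bar>y\<bar>)) \<partial>N") auto
  \<comment> \<open>Chosen so that the exponential moment of \<open>s * (\<bar>y\<bar> - B)\<close>
    is at most 1/2, which is the hypothesis of \<open>absolute_sum_tail\<close>.\<close>
  define B where "B = ln (2 * (M1 + 1)) / s"
  have B0: "B > 0" using M1 s by (simp add: B_def)
  have B: "(\<integral>\<^sup>+y. ennreal (exp (s * (\<bar>y\<bar> - B))) \<partial>N) \<le> ennreal (1 / 2)"
  proof -
    have eB: "exp (- (s * B)) = 1 / (2 * (M1 + 1))" using M1 s by (simp add: B_def exp_minus field_simps)
    have "(\<integral>\<^sup>+y. ennreal (exp (s * (\<bar>y\<bar> - B))) \<partial>N) = (\<integral>\<^sup>+y. ennreal (exp (- (s * B))) * ennreal (exp (s * \<bar>y\<bar>)) \<partial>N)"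
      by (intro nn_integral_cong) (simp add: ennreal_mult[symmetric] exp_add[symmetric] algebra_simps)
    also have "\<dots> = ennreal (exp (- (s * B)) * M1)"
      using M1 by (subst nn_integral_cmult) (auto simp: ennreal_mult)
    also have "\<dots> \<le> ennreal (1 / 2)" using M1 unfolding eB by (intro ennreal_leI) (simp add: field_simps)
    finally show ?thesis .
  qed
  \<comment> \<open>The two end pieces of length at most \<open>r\<close> cost at most
    \<open>2 * B * (r + 1)\<close>, and this has to stay below the loss \<open>\<delta>' * R\<close>
    of a long path. With \<open>r = R div J\<close> this leads to
    \<open>4 * B \<le> \<delta>' * J\<close>, the rest being covered by taking \<open>R\<close>
    large.\<close>
  define J where "J = nat \<lceil>4 * B / \<delta>'\<rceil> + 1"
  have J: "J \<ge> 1" "4 * B \<le> \<delta>' * real J"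
  proof -
    have "4 * B / \<delta>' \<le> real J" unfolding J_def by linarith
    then show "4 * B \<le> \<delta>' * real J" using \<delta>' by (simp add: field_simps)
  qed (simp add: J_def)
  \<comment> \<open>The rounded end points of an excursion around \<open>c\<close> lie within
    \<open>3 * R \<le> 6 * J * r\<close> of \<open>c\<close>, hence at most \<open>T\<close> of them
    on each side. The constants \<open>e1\<close> and \<open>r0\<close> then distribute the total
    failure probability 1/2: one half to the passage times, a quarter to each family of end
    pieces.\<close>
  define T where "T = 6 * J + 1"
  have T: "T \<ge> 1" by (simp add: T_def)
  define e1 where "e1 = 1 / (4 * (real d0 + 1) * (real T)\<^sup>2)"
  have e1: "e1 > 0" using T by (simp add: e1_def)
  obtain l0 where l0: "prob {w \<in> space M. lpp (\<lambda>z. \<omega> z w) x y > - \<delta>' * real_of_int (level y - level x)} \<le> e1"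
    if "\<And>i. x $ i \<le> y $ i" "level y - level x \<ge> int l0" for x y
    using directional_upper_tail[OF H e1] unfolding \<delta>'_def D_def by blast
  have "((\<lambda>k. (1 / 2 :: real) ^ k) \<longlonglongrightarrow> 0)" by (rule LIMSEQ_power_zero) simp
  then have "eventually (\<lambda>k. (1 / 2 :: real) ^ k < 1 / (8 * (real d0 + 1) * real T)) sequentially"
    using T by (intro order_tendstoD(2)) auto
  then obtain r0 where r0: "(1 / 2 :: real) ^ k < 1 / (8 * (real d0 + 1) * real T)" if "k \<ge> r0" for k
    by (auto simp: eventually_sequentially)
  define R0 where "R0 = max (max l0 (J * (r0 + 1))) (nat \<lceil>4 * B / \<delta>'\<rceil>)"
  show ?thesis
  proof (intro exI[of _ R0] allI impI)
    fix R n and C :: "nat set" and \<gamma> :: "(int ^ 'd) list"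
    assume R: "R \<ge> R0" and \<gamma>: "\<gamma> \<in> paths n" and C: "finite C" "card C \<le> d0"
    have Rl0: "R \<ge> l0" and RJ: "R \<ge> J * (r0 + 1)" using R by (auto simp: R0_def)
    have RB: "4 * B \<le> \<delta>' * real R"
    proof -
      have "4 * B / \<delta>' \<le> real R" using R unfolding R0_def by linarith
      then show ?thesis using \<delta>' by (simp add: field_simps)
    qed
    define r where "r = R div J"
    have r: "r \<ge> r0" "r \<ge> 1"
    proof -
      have "r0 + 1 \<le> r" unfolding r_def using RJ J by (simp add: less_eq_div_iff_mult_less_eq mult.commute)
      then show "r \<ge> r0" "r \<ge> 1" by auto
    qed
    have Jr: "J * r \<le> R" by (simp add: r_def)
    have R2: "R \<le> 2 * (J * r)"
    proof -
      have "R < J * r + J * 1" using J dividend_less_times_div[of J R] by (simp add: r_def)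
      also have "\<dots> \<le> J * r + J * r" using r by (intro add_left_mono mult_left_mono) auto
      finally show ?thesis by simp
    qed
    have rR: "r \<le> R" using Jr J by (metis dual_order.trans mult_le_mono1 nat_mult_1)
    define L where "L = length \<gamma> - 1"
    have L: "length \<gamma> = Suc L" using paths_length[OF \<gamma>] by (simp add: L_def)
    note d = paths_directed[OF \<gamma>]
    have lev: "level (\<gamma> ! k) = int k" if "k \<le> L" for k
      using directed_path_sum[OF d, of k] that L \<gamma> by (simp add: level_def paths_def hd_conv_nth[symmetric])
    have levd: "level (\<gamma> ! q) - level (\<gamma> ! p) = int (q - p)" if "p \<le> q" "q \<le> L" for p q
      using lev[of q] lev[of p] that by simp
    define U where "U c = {u. r * u \<le> c \<and> c \<le> r * u + 3 * R}" for c
    define V where "V c = {u. c \<le> r * u \<and> r * u \<le> c + 3 * R}" for c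
    have RT: "3 * R \<le> r * (6 * J)" using R2 by (simp add: algebra_simps)
    have Usub: "U c \<subseteq> {c div r - 6 * J..c div r}" for c
    proof
      fix u assume "u \<in> U c"
      then have u: "r * u \<le> c" "c \<le> r * u + 3 * R" by (auto simp: U_def)
      have "u \<le> c div r" using u(1) r by (simp add: less_eq_div_iff_mult_less_eq mult.commute)
      moreover have "c \<le> r * (u + 6 * J)" using u(2) RT by (simp add: algebra_simps)
      then have "c div r \<le> r * (u + 6 * J) div r" by (rule div_le_mono)
      then have "c div r \<le> u + 6 * J" using r by simp
      ultimately show "u \<in> {c div r - 6 * J..c div r}" by simp
    qed
    have Vsub: "V c \<subseteq> {c div r..c div r + 6 * J}" for c
    proof
      fix u assume "u \<in> V c"
      then have u: "c \<le> r * u" "r * u \<le> c + 3 * R" by (auto simp: V_def)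
      have "c div r \<le> r * u div r" using u(1) by (rule div_le_mono)
      then have 1: "c div r \<le> u" using r by simp
      have "r * u \<le> c + r * (6 * J)" using u(2) RT by linarith
      then have "r * u div r \<le> (c + r * (6 * J)) div r" by (rule div_le_mono)
      then have "u \<le> c div r + 6 * J" using r by simp
      then show "u \<in> {c div r..c div r + 6 * J}" using 1 by simp
    qed
    have fU: "finite (U c)" and fV: "finite (V c)" for c
      by (rule finite_subset[OF Usub], simp, rule finite_subset[OF Vsub], simp)
    have cU: "card (U c) \<le> T" for c
    proof -
      have "card (U c) \<le> card {c div r - 6 * J..c div r}" by (rule card_mono[OF _ Usub]) simp
      then show ?thesis by (simp add: T_def)
    qed
    have cV: "card (V c) \<le> T" for c
    proof -
      have "card (V c) \<le> card {c div r..c div r + 6 * J}" by (rule card_mono[OF _ Vsub]) simp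
      then show ?thesis by (simp add: T_def)
    qed
    \<comment> \<open>Rounding up may overshoot the end of \<open>\<gamma>\<close>; the last vertex
      is then used. The index conditions inside the bad events make them empty when the positions
      are out of range or too close.\<close>
    define q' where "q' v = min L (r * v)" for v
    define bad1 where "bad1 u v = {w \<in> space M. r * u + R \<le> q' v \<and>
        lpp (\<lambda>z. \<omega> z w) (\<gamma> ! (r * u)) (\<gamma> ! q' v) > - \<delta>' * real_of_int (level (\<gamma> ! q' v) - level (\<gamma> ! (r * u)))}" for u v
    define bad2 where "bad2 u = {w \<in> space M. r * u + r \<le> L \<and> B * real (card {r * u..r * u + r}) \<le> (\<Sum>j\<in>{r * u..r * u + r}. \<bar>\<omega> (\<gamma> ! j) w\<bar>)}" for u
    define bad3 where "bad3 v = {w \<in> space M. r \<le> q' v \<and> B * real (card {q' v - r..q' v}) \<le> (\<Sum>j\<in>{q' v - r..q' v}. \<bar>\<omega> (\<gamma> ! j) w\<bar>)}" for v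
    have m1[measurable]: "bad1 u v \<in> sets M" for u v unfolding bad1_def by measurable
    have m2[measurable]: "bad2 u \<in> sets M" for u unfolding bad2_def by measurable
    have m3[measurable]: "bad3 v \<in> sets M" for v unfolding bad3_def by measurable
    have p1: "prob (bad1 u v) \<le> e1" for u v
    proof (cases "r * u + R \<le> q' v")
      case True
      have qL: "q' v \<le> L" by (simp add: q'_def)
      have "prob {w \<in> space M. lpp (\<lambda>z. \<omega> z w) (\<gamma> ! (r * u)) (\<gamma> ! q' v) > - \<delta>' * real_of_int (level (\<gamma> ! q' v) - level (\<gamma> ! (r * u)))} \<le> e1"
      proof (rule l0)
        show "(\<gamma> ! (r * u)) $ i \<le> (\<gamma> ! q' v) $ i" for i
          using True qL L by (intro steps_le[OF steps_segment[OF d]]) auto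
        show "int l0 \<le> level (\<gamma> ! q' v) - level (\<gamma> ! (r * u))"
        proof -
          have "r * u \<le> q' v" "l0 \<le> q' v - r * u" using True Rl0 by linarith+
          then show ?thesis using levd[of "r * u" "q' v"] qL by (simp only: of_nat_le_iff)
        qed
      qed
      then show ?thesis using True by (simp add: bad1_def)
    qed (use e1 in \<open>simp add: bad1_def\<close>)
    have injg: "inj_on ((!) \<gamma>) I" if "I \<subseteq> {..L}" for I
      using paths_distinct[OF \<gamma>] L that by (intro inj_on_nth) (auto simp: less_Suc_eq_le)
    have half: "(1 / 2 :: real) ^ Suc r \<le> 1 / (8 * (real d0 + 1) * real T)" using r0[of "Suc r"] r by simp
    have p2: "prob (bad2 u) \<le> 1 / (8 * (real d0 + 1) * real T)" for u
    proof (cases "r * u + r \<le> L")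
      case True
      have "prob {w \<in> space M. B * real (card {r * u..r * u + r}) \<le> (\<Sum>j\<in>{r * u..r * u + r}. \<bar>\<omega> (\<gamma> ! j) w\<bar>)} \<le> (1 / 2) ^ card {r * u..r * u + r}"
        using True by (intro absolute_sum_tail[OF B s] injg) auto
      then show ?thesis using True half by (simp add: bad2_def)
    qed (simp add: bad2_def)
    have p3: "prob (bad3 v) \<le> 1 / (8 * (real d0 + 1) * real T)" for v
    proof (cases "r \<le> q' v")
      case True
      have "prob {w \<in> space M. B * real (card {q' v - r..q' v}) \<le> (\<Sum>j\<in>{q' v - r..q' v}. \<bar>\<omega> (\<gamma> ! j) w\<bar>)} \<le> (1 / 2) ^ card {q' v - r..q' v}"
        by (intro absolute_sum_tail[OF B s] injg) (auto simp: q'_def)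
      then show ?thesis using True half by (simp add: bad3_def)
    qed (simp add: bad3_def)
    define bad where "bad = (\<Union>c\<in>C. (\<Union>u\<in>U c. \<Union>v\<in>V c. bad1 u v) \<union> (\<Union>u\<in>U c. bad2 u) \<union> (\<Union>v\<in>V c. bad3 v))"
    have mbad[measurable]: "bad \<in> sets M"
      unfolding bad_def using C fU fV by (intro sets.finite_UN sets.Un m1 m2 m3) auto
    have pc: "prob ((\<Union>u\<in>U c. \<Union>v\<in>V c. bad1 u v) \<union> (\<Union>u\<in>U c. bad2 u) \<union> (\<Union>v\<in>V c. bad3 v)) \<le> 1 / (2 * (real d0 + 1))" for c
    proof -
      have "prob (\<Union>u\<in>U c. \<Union>v\<in>V c. bad1 u v) \<le> (\<Sum>u\<in>U c. \<Sum>v\<in>V c. prob (bad1 u v))"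
        using fU fV by (intro order_trans[OF measure_UNION_le] sum_mono sets.finite_UN measure_UNION_le m1) auto
      also have "\<dots> \<le> (\<Sum>u\<in>U c. \<Sum>v\<in>V c. e1)" by (intro sum_mono p1)
      also have "\<dots> = real (card (U c)) * (real (card (V c)) * e1)" by simp
      also have "\<dots> \<le> real T * (real T * e1)" using cU cV e1 by (intro mult_mono) auto
      also have "\<dots> = 1 / (4 * (real d0 + 1))" using T by (simp add: e1_def power2_eq_square)
      finally have A1: "prob (\<Union>u\<in>U c. \<Union>v\<in>V c. bad1 u v) \<le> 1 / (4 * (real d0 + 1))" .
      have cancel: "real T * (1 / (8 * (real d0 + 1) * real T)) = 1 / (8 * (real d0 + 1))" using T by simp
      have "prob (\<Union>u\<in>U c. bad2 u) \<le> (\<Sum>u\<in>U c. prob (bad2 u))" using fU by (intro measure_UNION_le) auto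
      also have "\<dots> \<le> (\<Sum>u\<in>U c. 1 / (8 * (real d0 + 1) * real T))" by (intro sum_mono p2)
      also have "\<dots> = real (card (U c)) * (1 / (8 * (real d0 + 1) * real T))" by simp
      also have "\<dots> \<le> real T * (1 / (8 * (real d0 + 1) * real T))" using cU by (intro mult_right_mono) auto
      finally have A2: "prob (\<Union>u\<in>U c. bad2 u) \<le> 1 / (8 * (real d0 + 1))" unfolding cancel .
      have "prob (\<Union>v\<in>V c. bad3 v) \<le> (\<Sum>v\<in>V c. prob (bad3 v))" using fV by (intro measure_UNION_le) auto
      also have "\<dots> \<le> (\<Sum>v\<in>V c. 1 / (8 * (real d0 + 1) * real T))" by (intro sum_mono p3)
      also have "\<dots> = real (card (V c)) * (1 / (8 * (real d0 + 1) * real T))" by simp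
      also have "\<dots> \<le> real T * (1 / (8 * (real d0 + 1) * real T))" using cV by (intro mult_right_mono) auto
      finally have A3: "prob (\<Union>v\<in>V c. bad3 v) \<le> 1 / (8 * (real d0 + 1))" unfolding cancel .
      have "prob ((\<Union>u\<in>U c. \<Union>v\<in>V c. bad1 u v) \<union> (\<Union>u\<in>U c. bad2 u) \<union> (\<Union>v\<in>V c. bad3 v)) \<le>
         prob (\<Union>u\<in>U c. \<Union>v\<in>V c. bad1 u v) + prob (\<Union>u\<in>U c. bad2 u) + prob (\<Union>v\<in>V c. bad3 v)"
        using fU fV by (intro order_trans[OF measure_Un_le] add_mono order_refl measure_Un_le sets.Un sets.finite_UN m1 m2 m3) auto
      also have "\<dots> \<le> 1 / (4 * (real d0 + 1)) + 1 / (8 * (real d0 + 1)) + 1 / (8 * (real d0 + 1))"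
        using A1 A2 A3 by (intro add_mono)
      also have "\<dots> = 1 / (2 * (real d0 + 1))"
      proof -
        have "1 / (4 * x) + 1 / (8 * x) + 1 / (8 * x) = 1 / (2 * x)" if "x \<noteq> 0" for x :: real
          using that by (simp add: field_simps)
        from this[of "real d0 + 1"] show ?thesis by simp
      qed
      finally show ?thesis .
    qed
    have "prob bad \<le> (\<Sum>c\<in>C. prob ((\<Union>u\<in>U c. \<Union>v\<in>V c. bad1 u v) \<union> (\<Union>u\<in>U c. bad2 u) \<union> (\<Union>v\<in>V c. bad3 v)))"
      unfolding bad_def using C fU fV by (intro measure_UNION_le sets.Un sets.finite_UN m1 m2 m3) auto
    also have "\<dots> \<le> (\<Sum>c\<in>C. 1 / (2 * (real d0 + 1)))" by (intro sum_mono pc)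
    also have "\<dots> = real (card C) * (1 / (2 * (real d0 + 1)))" by simp
    also have "\<dots> \<le> (real d0 + 1) * (1 / (2 * (real d0 + 1)))" using C by (intro mult_right_mono) auto
    also have "\<dots> = 1 / 2" by (simp add: field_simps)
    finally have pbad: "prob bad \<le> 1 / 2" .
    have "1 / 2 \<le> prob (space M - bad)" using pbad by (subst prob_compl) auto
    also have "\<dots> \<le> prob {w \<in> space M. \<forall>\<pi>\<in>excursions \<gamma> C {R..<2 * R}. wt (\<lambda>z. \<omega> z w) \<pi> \<le> 0}"
    proof (rule finite_measure_mono[OF _ excursion_event_measurable[OF \<gamma>]], intro subsetI CollectI conjI ballI)
      fix w \<pi> assume w: "w \<in> space M - bad"
      then show "w \<in> space M" by simp
      assume "\<pi> \<in> excursions \<gamma> C {R..<2 * R}"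
      then obtain p q c where c: "c \<in> C" "p < c" "c < q" "q < length \<gamma>" "R \<le> q - p" "q - p < 2 * R"
          "steps (\<gamma> ! p) (\<pi> @ [\<gamma> ! q]) (\<gamma> ! q)"
        unfolding excursions_def by auto
      define u where "u = p div r"
      define v where "v = q div r + 1"
      let ?\<sigma> = "\<lambda>z. \<omega> z w"
      have u: "r * u \<le> p" "p < r * u + r" using r dividend_less_times_div[of r p] by (auto simp: u_def)
      have v: "q < r * v" "r * v \<le> q + r" using r dividend_less_times_div[of r q] by (auto simp: v_def)
      have qv: "q \<le> q' v" "q' v \<le> q + r" "q' v \<le> L" using v c(4) L by (auto simp: q'_def)
      have uU: "u \<in> U c" using u c rR by (auto simp: U_def)
      have vV: "v \<in> V c" using v c rR by (auto simp: V_def)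
      have cL: "c \<le> L" using c L by simp
      have g1: "r * u + R \<le> q' v" using u qv c by linarith
      have g2: "r * u + r \<le> L" using g1 rR qv by linarith
      have g3: "r \<le> q' v" using g1 rR by linarith
      have "w \<notin> bad1 u v" "w \<notin> bad2 u" "w \<notin> bad3 v" using w uU vV c(1) by (auto simp: bad_def)
      then have b1: "lpp ?\<sigma> (\<gamma> ! (r * u)) (\<gamma> ! q' v) \<le> - \<delta>' * real_of_int (level (\<gamma> ! q' v) - level (\<gamma> ! (r * u)))"
        and b2: "(\<Sum>j\<in>{r * u..r * u + r}. \<bar>\<omega> (\<gamma> ! j) w\<bar>) \<le> B * real (r + 1)"
        and b3: "(\<Sum>j\<in>{q' v - r..q' v}. \<bar>\<omega> (\<gamma> ! j) w\<bar>) \<le> B * real (r + 1)"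
        using w g1 g2 g3 by (auto simp: bad1_def bad2_def bad3_def algebra_simps)
      \<comment> \<open>The excursion is prolonged along \<open>\<gamma>\<close> to the two rounded
        points, between which the passage time is controlled. The vertex \<open>\<gamma> ! q\<close>
        is counted with the final piece, as it does not belong to \<open>\<pi>\<close>.\<close>
      define \<rho>1 where "\<rho>1 = map ((!) \<gamma>) [Suc (r * u)..<Suc p]"
      define \<rho>3 where "\<rho>3 = map ((!) \<gamma>) [Suc q..<Suc (q' v)]"
      have "steps (\<gamma> ! (r * u)) \<rho>1 (\<gamma> ! p)" unfolding \<rho>1_def using u c by (intro steps_segment[OF d]) auto
      moreover have "steps (\<gamma> ! q) \<rho>3 (\<gamma> ! q' v)" unfolding \<rho>3_def using qv L by (intro steps_segment[OF d]) auto
      ultimately have "steps (\<gamma> ! (r * u)) (\<rho>1 @ (\<pi> @ [\<gamma> ! q]) @ \<rho>3) (\<gamma> ! q' v)"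
        using c(7) by (blast intro: steps_appendI)
      then have "wt ?\<sigma> (\<rho>1 @ (\<pi> @ [\<gamma> ! q]) @ \<rho>3) \<le> lpp ?\<sigma> (\<gamma> ! (r * u)) (\<gamma> ! q' v)" by (rule lpp_ge)
      also note b1
      also have "- \<delta>' * real_of_int (level (\<gamma> ! q' v) - level (\<gamma> ! (r * u))) \<le> - \<delta>' * real R"
        proof -
          have *: "r * u \<le> q' v" "R \<le> q' v - r * u" using g1 by linarith+
          have "real R \<le> real (q' v - r * u)" using *(2) by (simp only: of_nat_le_iff)
          then show ?thesis unfolding levd[OF *(1) qv(3)] of_int_of_nat_eq using \<delta>' by (intro mult_left_mono_neg) auto
        qed
      finally have tot: "wt ?\<sigma> \<rho>1 + wt ?\<sigma> \<pi> + wt ?\<sigma> (\<gamma> ! q # \<rho>3) \<le> - \<delta>' * real R" by simp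
      have w1: "- (B * real (r + 1)) \<le> wt ?\<sigma> \<rho>1"
      proof -
        have "- (\<Sum>j\<in>{r * u..r * u + r}. \<bar>?\<sigma> (\<gamma> ! j)\<bar>) \<le> wt ?\<sigma> \<rho>1"
          unfolding \<rho>1_def using u by (intro wt_segment_ge) auto
        then show ?thesis using b2 by linarith
      qed
      have w3: "- (B * real (r + 1)) \<le> wt ?\<sigma> (\<gamma> ! q # \<rho>3)"
      proof -
        have "\<gamma> ! q # \<rho>3 = map ((!) \<gamma>) [q..<Suc (q' v)]"
          unfolding \<rho>3_def using qv by (subst (2) upt_conv_Cons) auto
        moreover have "- (\<Sum>j\<in>{q' v - r..q' v}. \<bar>?\<sigma> (\<gamma> ! j)\<bar>) \<le> wt ?\<sigma> (map ((!) \<gamma>) [q..<Suc (q' v)])"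
          using qv by (intro wt_segment_ge) auto
        ultimately show ?thesis using b3 by (simp del: upt_Suc)
      qed
      have "2 * B * real (r + 1) \<le> \<delta>' * real R"
      proof -
        have "4 * B * real r \<le> \<delta>' * real J * real r" using J by (intro mult_right_mono) auto
        also have "\<dots> = \<delta>' * real (J * r)" by simp
        also have "\<dots> \<le> \<delta>' * real R" using Jr \<delta>' by (intro mult_left_mono) (simp_all only: of_nat_le_iff)
        finally have "4 * B * real r \<le> \<delta>' * real R" .
        then show ?thesis using RB by (simp add: algebra_simps)
      qed
      then show "wt ?\<sigma> \<pi> \<le> 0" using tot w1 w3 by linarith
    qed
    finally show "1 / 2 \<le> prob {w \<in> space M. \<forall>\<pi>\<in>excursions \<gamma> C {R..<2 * R}. wt (\<lambda>z. \<omega> z w) \<pi> \<le> 0}" .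
  qed
qed

lemma excursions_lower_bound:
  fixes \<delta> s :: real and d0 :: nat
  assumes H: "(\<lambda>m. prob {w \<in> space M. lpp (\<lambda>z. \<omega> z w) 0 (diag m) > - \<delta> * real m}) \<longlonglongrightarrow> 0"
    and \<delta>: "\<delta> > 0" and s: "s > 0" and E: "(\<integral>\<^sup>+y. ennreal (exp (s * \<bar>y\<bar>)) \<partial>N) < \<infinity>"
    and p: "measure N {..0} > 0"
  shows "\<exists>c>0. \<forall>n \<gamma> C K. \<gamma> \<in> paths n \<longrightarrow> finite C \<longrightarrow> card C \<le> d0 \<longrightarrow> length \<gamma> \<le> 2 ^ K \<longrightarrow>
     c ^ K \<le> prob {w \<in> space M. \<forall>\<pi>\<in>excursions \<gamma> C UNIV. wt (\<lambda>z. \<omega> z w) \<pi> \<le> 0}"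
proof -
  obtain R0 where R0: "1 / 2 \<le> prob {w \<in> space M. \<forall>\<pi>\<in>excursions \<gamma> C {R..<2 * R}. wt (\<lambda>z. \<omega> z w) \<pi> \<le> 0}"
    if "R \<ge> R0" "\<gamma> \<in> paths n" "finite C" "card C \<le> d0" for R n \<gamma> C
    using excursions_large_scale[OF H \<delta> s E, of d0] by blast
  obtain c0 where c0: "c0 > 0" and c0_le: "\<And>n \<gamma> C. \<lbrakk>\<gamma> \<in> paths n; finite C; card C \<le> d0\<rbrakk> \<Longrightarrow>
      c0 \<le> prob {w \<in> space M. \<forall>\<pi>\<in>excursions \<gamma> C {..<2 * R0}. wt (\<lambda>z. \<omega> z w) \<pi> \<le> 0}"
    using excursions_small_scale[OF p, of d0 R0] by blast
  define c where "c = min c0 (1 / 2)"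
  have c: "c > 0" "c \<le> c0" "c \<le> 1 / 2" using c0 by (auto simp: c_def)
  show ?thesis
  proof (intro exI[of _ c] conjI allI impI c(1))
    fix n K and C :: "nat set" and \<gamma> :: "(int ^ 'd) list"
    assume \<gamma>: "\<gamma> \<in> paths n" and C: "finite C" "card C \<le> d0" and K: "length \<gamma> \<le> 2 ^ K"
    \<comment> \<open>All scales below \<open>R0\<close> refer to the same small-scale event,
      repeated for each such \<open>k\<close>, so that every factor has the same lower bound
      \<open>c\<close>.\<close>
    define J where "J k = (if 2 ^ k < R0 then {..<2 * R0} else {2 ^ k..<2 * 2 ^ k})" for k
    define P where "P k \<sigma> \<longleftrightarrow> (\<forall>\<pi>\<in>excursions \<gamma> C (J k). wt \<sigma> \<pi> \<le> 0)" for k and \<sigma> :: "int ^ 'd \<Rightarrow> real"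
    have "c \<le> prob {w \<in> space M. P k (\<lambda>z. \<omega> z w)}" for k
      using c0_le[OF \<gamma> C] R0[OF _ \<gamma> C, of "2 ^ k"] c by (auto simp: P_def J_def)
    then have "(\<Prod>k<K. c) \<le> (\<Prod>k<K. prob {w \<in> space M. P k (\<lambda>z. \<omega> z w)})"
      using c by (intro prod_mono) auto
    also have "\<dots> \<le> prob {w \<in> space M. \<forall>k\<in>{..<K}. P k (\<lambda>z. \<omega> z w)}"
    \<comment> \<open>The order is reversed because the events ask the weights of excursions to be
      small.\<close>
    proof (rule harris[where I = "box_set 0 (diag n)" and le = "\<lambda>_ a b. b \<le> a"])
      show "{\<sigma> \<in> space (PiM (box_set 0 (diag n)) (\<lambda>_. borel)). P k \<sigma>} \<in> sets (PiM (box_set 0 (diag n)) (\<lambda>_. borel))" for k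
        unfolding P_def by (rule excursion_event_sets[OF \<gamma>]) auto
      fix k and \<sigma> \<tau> :: "int ^ 'd \<Rightarrow> real"
      assume P: "P k \<sigma>" and le: "\<And>i. i \<in> box_set 0 (diag n) \<Longrightarrow> \<tau> i \<le> \<sigma> i"
      show "P k \<tau>"
        unfolding P_def
      proof
        fix \<pi> assume \<pi>: "\<pi> \<in> excursions \<gamma> C (J k)"
        have "wt \<tau> \<pi> \<le> wt \<sigma> \<pi>" using excursions_box[OF \<gamma> \<pi>] le by (intro wt_mono) auto
        then show "wt \<tau> \<pi> \<le> 0" using P \<pi> unfolding P_def by force
      qed
    qed (auto intro: finite_box_set indep_on)
    also have "\<dots> \<le> prob {w \<in> space M. \<forall>\<pi>\<in>excursions \<gamma> C UNIV. wt (\<lambda>z. \<omega> z w) \<pi> \<le> 0}"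
    proof (rule finite_measure_mono[OF _ excursion_event_measurable[OF \<gamma>]], intro subsetI CollectI conjI ballI)
      fix w \<pi> assume w: "w \<in> {w \<in> space M. \<forall>k\<in>{..<K}. P k (\<lambda>z. \<omega> z w)}"
      then show "w \<in> space M" by simp
      assume "\<pi> \<in> excursions \<gamma> C UNIV"
      then obtain p q c where *: "c \<in> C" "p < c" "c < q" "q < length \<gamma>"
          "steps (\<gamma> ! p) (\<pi> @ [\<gamma> ! q]) (\<gamma> ! q)" "set \<pi> \<inter> set \<gamma> = {}"
        unfolding excursions_def by auto
      then have "1 \<le> q - p" by simp
      then obtain k where k: "2 ^ k \<le> q - p" "q - p < 2 ^ (k + 1)" using ex_power_ivl1[of 2 "q - p"] by auto
      have "(2 :: nat) ^ k < 2 ^ K" using k(1) *(4) K by linarith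
      then have "k < K" by simp
      have "q - p \<in> J k" using k by (auto simp: J_def)
      then have "\<pi> \<in> excursions \<gamma> C (J k)" using * unfolding excursions_def by blast
      then show "wt (\<lambda>z. \<omega> z w) \<pi> \<le> 0" using w \<open>k < K\<close> unfolding P_def by blast
    qed
    finally show "c ^ K \<le> prob {w \<in> space M. \<forall>\<pi>\<in>excursions \<gamma> C UNIV. wt (\<lambda>z. \<omega> z w) \<pi> \<le> 0}" by simp
  qed
qed

end

section \<open>The corner path\<close>

lemma wt_nth: "wt \<sigma> \<gamma> = (\<Sum>m<length \<gamma>. \<sigma> (\<gamma> ! m))"
  by (simp add: wt_def sum_list_sum_nth lessThan_atLeast0)

lemma wt_map_upt: "wt \<sigma> (map f [a..<b]) = (\<Sum>j\<in>{a..<b}. \<sigma> (f j))"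
  by (simp add: wt_def o_def interv_sum_list_conv_sum_set_nat)

lemma paths_level_nth:
  fixes \<gamma> :: "(int ^ 'd::finite) list"
  assumes "\<gamma> \<in> paths n" "k < length \<gamma>"
  shows "level (\<gamma> ! k) = int k"
  using directed_path_sum[OF paths_directed[OF assms(1)] assms(2)] assms(1)
  by (simp add: level_def paths_def hd_conv_nth[symmetric])

text \<open>A competitor \<open>\<gamma>'\<close> is cut at its meeting points with \<open>\<gamma>\<close>. Both paths reach level \<open>k\<close> after \<open>k\<close> steps, so they meet
  at equal indices.\<close>

lemma geodesic_if_excursions:
  fixes \<gamma> :: "(int ^ 'd::finite) list"
  assumes \<gamma>: "\<gamma> \<in> paths n"
    and on: "\<And>p q c. \<lbrakk>c \<in> C; p < c; c < q; q < length \<gamma>\<rbrakk> \<Longrightarrow> 0 \<le> (\<Sum>k\<in>{p<..<q}. \<sigma> (\<gamma> ! k) - A)"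
    and off: "\<And>\<pi>. \<pi> \<in> excursions \<gamma> C UNIV \<Longrightarrow> wt (\<lambda>z. \<sigma> z - A) \<pi> \<le> 0"
    and straight: "\<And>p q \<pi>. \<lbrakk>p < q; q < length \<gamma>; \<And>c. c \<in> C \<Longrightarrow> p < c \<Longrightarrow> c < q \<Longrightarrow> False; steps (\<gamma> ! p) \<pi> (\<gamma> ! q)\<rbrakk> \<Longrightarrow>
       \<pi> = map ((!) \<gamma>) [Suc p..<Suc q]"
    and \<gamma>': "\<gamma>' \<in> paths n"
  shows "wt \<sigma> \<gamma>' \<le> wt \<sigma> \<gamma>"
proof -
  have len: "length \<gamma>' = length \<gamma>" using paths_length[OF \<gamma>] paths_length[OF \<gamma>'] by simp
  define L where "L = length \<gamma> - 1"
  have L: "length \<gamma> = Suc L" using paths_length[OF \<gamma>] by (simp add: L_def)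
  have ends: "\<gamma>' ! 0 = \<gamma> ! 0" "\<gamma>' ! L = \<gamma> ! L"
    using \<gamma> \<gamma>' len L by (auto simp: paths_def hd_conv_nth last_conv_nth)
  have claim: "(\<Sum>m\<le>k. \<sigma> (\<gamma>' ! m)) \<le> (\<Sum>m\<le>k. \<sigma> (\<gamma> ! m))" if "k \<le> L" "\<gamma>' ! k = \<gamma> ! k" for k
    using that
  proof (induction k rule: less_induct)
    case (less k)
    show ?case
    proof (cases "k = 0")
      case True
      then show ?thesis using less.prems by simp
    next
      case False
      let ?S = "{p. p < k \<and> \<gamma>' ! p = \<gamma> ! p}"
      \<comment> \<open>The last meeting index before \<open>k\<close>. Up to \<open>p\<close> the
        induction hypothesis applies, and between \<open>p\<close> and \<open>k\<close> the two
        paths do not meet.\<close>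
      define p where "p = Max ?S"
      have "0 \<in> ?S" using False ends by simp
      then have pS: "p \<in> ?S" unfolding p_def by (intro Max_in) auto
      have pmax: "\<gamma>' ! m \<noteq> \<gamma> ! m" if "p < m" "m < k" for m
        using that Max_ge[of ?S m] unfolding p_def by fastforce
      have IH: "(\<Sum>m\<le>p. \<sigma> (\<gamma>' ! m)) \<le> (\<Sum>m\<le>p. \<sigma> (\<gamma> ! m))"
        using pS less.prems by (intro less.IH) auto
      have mid: "(\<Sum>m\<in>{p<..<k}. \<sigma> (\<gamma>' ! m)) \<le> (\<Sum>m\<in>{p<..<k}. \<sigma> (\<gamma> ! m))"
      proof (cases "k = Suc p")
        case True
        then have "{p<..<k} = {}" by auto
        then show ?thesis by simp
      next
        case False
        then have pk: "Suc p < k" using pS by simp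
        have st: "steps (\<gamma> ! p) (map ((!) \<gamma>') [Suc p..<Suc k]) (\<gamma> ! k)"
          using steps_segment[OF paths_directed[OF \<gamma>'], of p k] pS less.prems len L by simp
        \<comment> \<open>With no index of \<open>C\<close> in between, uniqueness of the path would
          make the two segments equal, so they would already meet at \<open>Suc p\<close>.\<close>
        have "\<exists>c. c \<in> C \<and> p < c \<and> c < k"
        proof (rule ccontr)
          assume "\<not> ?thesis"
          then have "map ((!) \<gamma>') [Suc p..<Suc k] = map ((!) \<gamma>) [Suc p..<Suc k]"
            using pk less.prems L by (intro straight[OF _ _ _ st]) auto
          then have "\<gamma>' ! Suc p = \<gamma> ! Suc p" using pk by (simp del: upt_Suc)
          then show False using pmax[of "Suc p"] pk by simp
        qed
        then obtain c where c: "c \<in> C" "p < c" "c < k" by blast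
        define \<pi> where "\<pi> = map ((!) \<gamma>') [Suc p..<k]"
        have "set \<pi> \<inter> set \<gamma> = {}"
        proof (rule ccontr)
          assume "set \<pi> \<inter> set \<gamma> \<noteq> {}"
          then obtain z where z: "z \<in> set \<pi>" "z \<in> set \<gamma>" by blast
          obtain l where l: "l < length \<gamma>" "\<gamma> ! l = z" using z(2) by (auto simp: in_set_conv_nth)
          obtain m where m: "p < m" "m < k" "\<gamma>' ! m = z" using z(1) by (auto simp: \<pi>_def Suc_le_eq)
          note ml = m(1,2) l(1) trans[OF m(3) l(2)[symmetric]]
          then have "int m = int l"
            using paths_level_nth[OF \<gamma>, of l] paths_level_nth[OF \<gamma>', of m] len L less.prems by simp
          then show False using ml pmax[of m] by simp
        qed
        moreover have "steps (\<gamma> ! p) (\<pi> @ [\<gamma> ! k]) (\<gamma> ! k)"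
          using st pk less.prems by (simp add: \<pi>_def)
        ultimately have "\<pi> \<in> excursions \<gamma> C UNIV"
          unfolding excursions_def using c less.prems L by (auto simp: less_Suc_eq_le)
        \<comment> \<open>Both segments have equally many vertices, so the constant \<open>A\<close>
          cancels: the competitor gains at most \<open>A\<close> per vertex, \<open>\<gamma>\<close>
          at least \<open>A\<close>.\<close>
        from off[OF this] have "(\<Sum>m\<in>{Suc p..<k}. \<sigma> (\<gamma>' ! m) - A) \<le> 0" by (simp add: \<pi>_def wt_map_upt)
        also have "0 \<le> (\<Sum>m\<in>{p<..<k}. \<sigma> (\<gamma> ! m) - A)" using c less.prems L by (intro on[of c]) auto
        finally show ?thesis by (simp add: sum_subtractf atLeastSucLessThan_greaterThanLessThan)
      qed
      have split: "(\<Sum>m\<le>k. f m) = (\<Sum>m\<le>p. f m) + (\<Sum>m\<in>{p<..<k}. f m) + f k" for f :: "nat \<Rightarrow> real"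
      proof -
        have "{..k} = {..p} \<union> {p<..<k} \<union> {k}" using pS by auto
        also have "sum f \<dots> = (\<Sum>m\<le>p. f m) + (\<Sum>m\<in>{p<..<k}. f m) + f k"
          using pS by (subst sum.union_disjoint; (subst sum.union_disjoint)?) auto
        finally show ?thesis .
      qed
      show ?thesis unfolding split using IH mid less.prems by simp
    qed
  qed
  have "(\<Sum>m\<le>L. \<sigma> (\<gamma>' ! m)) \<le> (\<Sum>m\<le>L. \<sigma> (\<gamma> ! m))" using ends by (intro claim) auto
  then show ?thesis by (simp add: wt_nth len L lessThan_Suc_atMost)
qed

text \<open>A directed path cannot undo a step, so a step in any direction other than
  \<open>i\<close> would overshoot the end point.\<close>

lemma steps_straight_unique:
  fixes x y :: "int ^ 'd::finite"
  assumes "steps x \<pi> y" "steps x \<pi>' y" "\<And>j. j \<noteq> i \<Longrightarrow> x $ j = y $ j"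
  shows "\<pi> = \<pi>'"
  using assms
proof (induction \<pi> arbitrary: x \<pi>')
  case Nil
  then show ?case using steps_level[of x \<pi>' y] by simp
next
  case (Cons z \<pi>)
  have "length \<pi>' = length (z # \<pi>)" using Cons.prems(1,2)[THEN steps_level] by simp
  then obtain z' \<rho> where \<pi>': "\<pi>' = z' # \<rho>" by (cases \<pi>') auto
  have next_eq: "u = x + axis i 1" if "steps x (u # \<tau>) y" for u \<tau>
  proof -
    obtain j where j: "u - x = axis j 1" and s: "steps u \<tau> y" using \<open>steps x (u # \<tau>) y\<close> by (auto simp: steps_Cons)
    have u: "u = x + axis j 1" using j by (metis diff_add_cancel add.commute)
    have "j = i"
    proof (rule ccontr)
      assume "j \<noteq> i"
      then have "x $ j = y $ j" by (rule Cons.prems(3))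
      moreover have "u $ j \<le> y $ j" by (rule steps_le[OF s])
      ultimately show False by (simp add: u axis_def)
    qed
    then show ?thesis using u by simp
  qed
  have "z = x + axis i 1" "z' = x + axis i 1"
    using next_eq Cons.prems(1,2) \<pi>' by auto
  moreover have "\<pi> = \<rho>"
  proof (rule Cons.IH)
    show "steps z \<pi> y" using Cons.prems(1) by (auto simp: steps_Cons)
    show "steps z \<rho> y" using Cons.prems(2) \<pi>' calculation by (auto simp: steps_Cons)
    show "z $ j = y $ j" if "j \<noteq> i" for j using calculation Cons.prems(3)[OF that] that by (simp add: axis_def)
  qed
  ultimately show ?case using \<pi>' by simp
qed

section \<open>Segments and turning points of the corner path\<close>

lemma corner_path_nth_multiple:
  fixes n m :: nat
  defines "ds \<equiv> rev (sorted_list_of_set (UNIV :: 'd::{finite,linorder} set))"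
  assumes "m \<le> CARD('d::{finite,linorder})"
  shows "(corner_path n :: (int ^ 'd::{finite,linorder}) list) ! (m * n) = (\<chi> j. if j \<in> set (take m ds) then int n else 0)"
proof -
  define f where "f = (\<lambda>i. map (\<lambda>m. (\<chi> j. if i < j then int n else if j = i then int m else 0) :: (int, 'd) vec) [1..<Suc n])"
  have len: "length ds = CARD('d)" by (simp add: ds_def)
  have "directed_path (0 # concat (map f (take m ds))) \<and>
     last (0 # concat (map f (take m ds))) = (\<chi> j. if j \<in> set (take m ds) then int n else 0)"
    unfolding f_def by (rule corner_path_prefix[of _ "drop m ds"]) (simp add: ds_def)
  then have last: "last (0 # concat (map f (take m ds))) = (\<chi> j. if j \<in> set (take m ds) then int n else 0)" by blast
  have lenf: "length (concat (map f xs)) = length xs * n" for xs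
    by (induction xs) (auto simp: f_def)
  have "corner_path n = (0 # concat (map f (take m ds))) @ concat (map f (drop m ds))"
    unfolding corner_path_def ds_def[symmetric] f_def[symmetric]
    by (metis append_Cons append_take_drop_id concat_append map_append)
  moreover have "length (0 # concat (map f (take m ds))) = Suc (m * n)"
    using assms(2) len by (simp add: lenf)
  ultimately have "corner_path n ! (m * n) = (0 # concat (map f (take m ds))) ! (m * n)"
    by (simp add: nth_append del: length_Cons append_Cons)
  also have "\<dots> = last (0 # concat (map f (take m ds)))"
    using assms(2) len by (subst last_conv_nth) (auto simp: lenf)
  finally show ?thesis using last by simp
qed

text \<open>The excluded indices \<open>m * n\<close> are those of the d - 1 turning points. If none
  of them lies strictly between \<open>p\<close> and \<open>q\<close>, both indices belong to one
  segment, along which a single coordinate changes.\<close>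

lemma corner_path_straight:
  fixes p q n :: nat
  assumes pq: "p < q" "q < length (corner_path n :: (int ^ 'd::{finite,linorder}) list)"
    and C: "\<And>c. c \<in> (\<lambda>m. m * n) ` {1..<CARD('d::{finite,linorder})} \<Longrightarrow> p < c \<Longrightarrow> c < q \<Longrightarrow> False"
    and st: "steps ((corner_path n :: (int ^ 'd::{finite,linorder}) list) ! p) \<pi> (corner_path n ! q)"
  shows "\<pi> = map ((!) (corner_path n)) [Suc p..<Suc q]"
proof -
  let ?\<gamma> = "corner_path n :: (int, 'd) vec list"
  define ds where "ds = rev (sorted_list_of_set (UNIV :: 'd set))"
  have lds: "length ds = CARD('d)" by (simp add: ds_def)
  have \<gamma>: "?\<gamma> \<in> paths n" by (rule corner_path_in_paths)
  have len: "length ?\<gamma> = Suc (CARD('d) * n)" by (rule paths_length[OF \<gamma>])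
  note d = paths_directed[OF \<gamma>]
  have n: "n \<ge> 1" using pq len by (cases n) auto
  define m where "m = p div n"
  have m1: "m * n \<le> p" by (simp add: m_def)
  have m2: "p < Suc m * n" using n dividend_less_div_times[of n p] by (simp add: m_def)
  have m3: "m < CARD('d)"
  proof (rule ccontr)
    assume "\<not> m < CARD('d)"
    then have "CARD('d) * n \<le> m * n" by simp
    then show False using m1 pq len by linarith
  qed
  have m4: "q \<le> Suc m * n"
  proof (rule ccontr)
    assume a: "\<not> q \<le> Suc m * n"
    then have "Suc m * n < CARD('d) * n" using pq len by linarith
    then have "Suc m < CARD('d)" by (simp only: mult_less_cancel2)
    then have "Suc m * n \<in> (\<lambda>m. m * n) ` {1..<CARD('d)}" by (intro image_eqI[where x = "Suc m"]) auto
    then show False using C m2 a by (meson not_le_imp_less)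
  qed
  have m5: "Suc m * n < length ?\<gamma>"
  proof -
    have "Suc m * n \<le> CARD('d) * n" using m3 by (intro mult_right_mono) auto
    then show ?thesis using len by simp
  qed
  define i where "i = ds ! m"
  have eq: "(?\<gamma> ! p) $ j = (?\<gamma> ! q) $ j" if "j \<noteq> i" for j
  proof -
    have "set (take (Suc m) ds) = insert i (set (take m ds))"
      using m3 lds by (simp add: take_Suc_conv_app_nth i_def)
    then have "(?\<gamma> ! (m * n)) $ j = (?\<gamma> ! (Suc m * n)) $ j"
      using that m3 corner_path_nth_multiple[of m n, where 'd = 'd] corner_path_nth_multiple[of "Suc m" n, where 'd = 'd]
      unfolding ds_def[symmetric] by (simp del: mult_Suc)
    moreover have "(?\<gamma> ! (m * n)) $ j \<le> (?\<gamma> ! p) $ j"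
      using m1 pq by (intro steps_le[OF steps_segment[OF d]]) auto
    moreover have "(?\<gamma> ! p) $ j \<le> (?\<gamma> ! q) $ j"
      using pq by (intro steps_le[OF steps_segment[OF d]]) auto
    moreover have "(?\<gamma> ! q) $ j \<le> (?\<gamma> ! (Suc m * n)) $ j"
      using m4 m5 by (intro steps_le[OF steps_segment[OF d]]) auto
    ultimately show ?thesis by linarith
  qed
  show ?thesis
    by (rule steps_straight_unique[OF st steps_segment[OF d less_imp_le[OF pq(1)] pq(2)] eq])
qed

section \<open>Tilted independent sequences\<close>

lemma indep_vars_coordinates:
  fixes N :: "real measure"
  assumes N: "prob_space N" "sets N = sets borel" and I: "I \<noteq> {}"
  shows "prob_space.indep_vars (PiM I (\<lambda>_. N)) (\<lambda>_. borel) (\<lambda>i x. x i) I"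
proof -
  interpret P: prob_space "PiM I (\<lambda>_. N)" by (intro prob_space_PiM N)
  have rv: "(\<lambda>x. x i) \<in> borel_measurable (PiM I (\<lambda>_. N))" if "i \<in> I" for i
  proof -
    have "(\<lambda>x. x i) \<in> measurable (PiM I (\<lambda>_. N)) N" using that by (rule measurable_component_singleton)
    then show ?thesis using N(2) measurable_cong_sets by blast
  qed
  have "distr (PiM I (\<lambda>_. N)) (PiM I (\<lambda>_. borel)) (\<lambda>x. \<lambda>i\<in>I. x i) = distr (PiM I (\<lambda>_. N)) (PiM I (\<lambda>_. N)) (\<lambda>x. x)"
  proof (rule distr_cong)
    show "sets (PiM I (\<lambda>_. borel)) = sets (PiM I (\<lambda>_. N))" using N(2) by (intro sets_PiM_cong) auto
    show "(\<lambda>i\<in>I. x i) = x" if "x \<in> space (PiM I (\<lambda>_. N))" for x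
      using that by (auto simp: space_PiM PiE_def extensional_restrict)
  qed simp
  also have "\<dots> = PiM I (\<lambda>_. N)" by (rule distr_id)
  also have "\<dots> = PiM I (\<lambda>i. distr (PiM I (\<lambda>_. N)) borel (\<lambda>x. x i))"
  proof (rule PiM_cong)
    fix i assume i: "i \<in> I"
    have "distr (PiM I (\<lambda>_. N)) borel (\<lambda>x. x i) = distr (PiM I (\<lambda>_. N)) N (\<lambda>x. x i)"
      using N(2) by (intro distr_cong) auto
    also have "\<dots> = N" using N(1) i by (intro distr_PiM_component) auto
    finally show "N = distr (PiM I (\<lambda>_. N)) borel (\<lambda>x. x i)" by simp
  qed simp
  finally show ?thesis using rv I by (subst P.indep_vars_iff_distr_eq_PiM') auto
qed

lemma chernoff_PiM:
  fixes N :: "real measure"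
  assumes N: "prob_space N" "sets N = sets borel" and I: "finite I" "J \<subseteq> I" "J \<noteq> {}" and \<rho>: "0 \<le> \<rho>"
    and g: "g \<in> borel_measurable borel" and E: "(\<integral>\<^sup>+y. ennreal (exp (g y)) \<partial>N) \<le> ennreal \<rho>"
  shows "measure (PiM I (\<lambda>_. N)) {x \<in> space (PiM I (\<lambda>_. N)). 0 \<le> (\<Sum>i\<in>J. g (x i))} \<le> \<rho> ^ card J"
proof -
  interpret P: prob_space "PiM I (\<lambda>_. N)" by (intro prob_space_PiM N)
  have "P.indep_vars (\<lambda>_. borel) (\<lambda>i x. x i) I"
    using I by (intro indep_vars_coordinates N) auto
  then have "P.indep_vars (\<lambda>_. borel) (\<lambda>i x. x i) J" by (rule P.indep_vars_subset) (rule I)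
  from P.indep_vars_compose2[OF this, where Y = "\<lambda>_. g" and N = "\<lambda>_. borel"]
  have ind: "P.indep_vars (\<lambda>_. borel) (\<lambda>i x. g (x i)) J" using g by simp
  have "(\<integral>\<^sup>+x. ennreal (exp (g (x i))) \<partial>PiM I (\<lambda>_. N)) \<le> ennreal \<rho>" if "i \<in> J" for i
  proof -
    have gN: "g \<in> borel_measurable N" using g N(2) measurable_cong_sets by blast
    have "(\<integral>\<^sup>+x. ennreal (exp (g (x i))) \<partial>PiM I (\<lambda>_. N)) = (\<integral>\<^sup>+y. ennreal (exp (g y)) \<partial>distr (PiM I (\<lambda>_. N)) N (\<lambda>x. x i))"
      using that I gN by (subst nn_integral_distr) (auto intro!: measurable_component_singleton)
    also have "distr (PiM I (\<lambda>_. N)) N (\<lambda>x. x i) = N"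
      using N(1) that I by (intro distr_PiM_component) auto
    finally show ?thesis using E by simp
  qed
  then show ?thesis
    using I by (intro P.chernoff ind \<rho>) (auto intro: finite_subset)
qed

lemma measure_PiM_coordinates:
  fixes N :: "real measure"
  assumes N: "prob_space N" "sets N = sets borel" and I: "finite I" "J \<subseteq> I" and A: "A \<in> sets borel"
  shows "measure (PiM I (\<lambda>_. N)) {x \<in> space (PiM I (\<lambda>_. N)). \<forall>i\<in>J. x i \<in> A} = measure N A ^ card J"
proof -
  interpret N: prob_space N by (rule N)
  interpret P: product_prob_space "\<lambda>_. N" I
    by (simp add: product_prob_space_def product_sigma_finite_def product_prob_space_axioms_def N prob_space_imp_sigma_finite)
  have sN: "space N = UNIV" using sets_eq_imp_space_eq[OF N(2)] by simp
  have "{x \<in> space (PiM I (\<lambda>_. N)). \<forall>i\<in>J. x i \<in> A} = Pi\<^sub>E I (\<lambda>i. if i \<in> J then A else UNIV)"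
    using I(2) by (auto simp: space_PiM sN PiE_def Pi_def)
  moreover have "emeasure (PiM I (\<lambda>_. N)) (Pi\<^sub>E I (\<lambda>i. if i \<in> J then A else UNIV)) =
      ennreal (\<Prod>i\<in>I. measure N (if i \<in> J then A else UNIV))"
    using I A N(2) by (subst P.emeasure_PiM) (auto simp: N.emeasure_eq_measure prod_ennreal)
  ultimately have "measure (PiM I (\<lambda>_. N)) {x \<in> space (PiM I (\<lambda>_. N)). \<forall>i\<in>J. x i \<in> A} =
      (\<Prod>i\<in>I. measure N (if i \<in> J then A else UNIV))"
    by (simp add: measure_def prod_nonneg)
  also have "\<dots> = (\<Prod>i\<in>I. if i \<in> J then measure N A else 1)"
    using N.prob_space sN by (intro prod.cong) auto
  also have "\<dots> = (\<Prod>i\<in>J. measure N A)"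
    using I by (simp add: prod.If_cases Int_absorb1)
  finally show ?thesis by simp
qed

text \<open>Under the tilted law the partial sums of \<open>x k - A\<close> have positive drift, so with probability bounded away from
  zero all sums over index intervals around a point of \<open>C\<close> are nonnegative. Undoing the tilt on the event that the total is at most
  \<open>B * (L + 1)\<close> costs the stated exponential factor.\<close>

lemma tilted_interval_sums:
  fixes N :: "real measure" and t s A B :: real and d0 :: nat
  assumes N: "prob_space N" "sets N = sets borel" and t: "t \<ge> 0" and s: "s > 0"
    and int: "integrable N (\<lambda>y. exp ((t - s) * y))" "integrable N (\<lambda>y. exp (t * y))" "integrable N (\<lambda>y. exp ((t + s) * y))"
    and A: "exp (s * A) * (\<integral>y. exp ((t - s) * y) \<partial>N) < (\<integral>y. exp (t * y) \<partial>N)"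
    and B: "exp (- s * B) * (\<integral>y. exp ((t + s) * y) \<partial>N) < (\<integral>y. exp (t * y) \<partial>N)"
  shows "\<exists>c>0. \<exists>\<rho>. 0 \<le> \<rho> \<and> \<rho> < 1 \<and> (\<forall>C L. finite C \<longrightarrow> card C \<le> d0 \<longrightarrow>
     (c - \<rho> ^ Suc L) * ((\<integral>y. exp (t * y) \<partial>N) * exp (- t * B)) ^ Suc L \<le>
     measure (PiM {..L} (\<lambda>_. N)) {x \<in> space (PiM {..L} (\<lambda>_. N)). \<forall>c\<in>C. \<forall>p<c. \<forall>q\<in>{c<..L}. 0 \<le> (\<Sum>k\<in>{p<..<q}. x k - A)})"
proof -
  interpret N: prob_space N by (rule N)
  have [measurable_cong]: "sets N = sets borel" by (rule N)
  have sN: "space N = UNIV" using sets_eq_imp_space_eq[OF N(2)] by simp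
  define Z where "Z = (\<integral>y. exp (t * y) \<partial>N)"
  have Z: "Z > 0"
  proof -
    have "0 \<le> exp (s * A) * (\<integral>y. exp ((t - s) * y) \<partial>N)" by simp
    from le_less_trans[OF this A] show ?thesis by (simp add: Z_def)
  qed
  \<comment> \<open>Density of the tilted law \<open>Q\<close> with respect to \<open>N\<close>. Its
    exponential moments are quotients of those of \<open>N\<close> at shifted arguments.\<close>
  define f where "f y = exp (t * y) / Z" for y
  have f[measurable]: "f \<in> borel_measurable N" unfolding f_def by measurable
  have f0: "f y > 0" for y using Z by (simp add: f_def)
  define Q where "Q = density N (\<lambda>y. ennreal (f y))"
  have setsQ[measurable_cong]: "sets Q = sets borel" by (simp add: Q_def N)
  have nnQ: "(\<integral>\<^sup>+y. ennreal (exp (u * y + v)) \<partial>Q) = ennreal (exp v * (\<integral>y. exp ((t + u) * y) \<partial>N) / Z)"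
    if "integrable N (\<lambda>y. exp ((t + u) * y))" for u v
  proof -
    have "(\<integral>\<^sup>+y. ennreal (exp (u * y + v)) \<partial>Q) = (\<integral>\<^sup>+y. ennreal (f y) * ennreal (exp (u * y + v)) \<partial>N)"
      unfolding Q_def by (rule nn_integral_density) measurable
    also have "\<dots> = (\<integral>\<^sup>+y. ennreal (exp v / Z * exp ((t + u) * y)) \<partial>N)"
      using f0 Z by (intro nn_integral_cong) (simp add: f_def ennreal_mult[symmetric] exp_add[symmetric] field_simps)
    also have "\<dots> = ennreal (\<integral>y. exp v / Z * exp ((t + u) * y) \<partial>N)"
      using that Z by (intro nn_integral_eq_integral) auto
    finally show ?thesis by simp
  qed
  have "prob_space Q"
  proof
    have "emeasure Q (space Q) = (\<integral>\<^sup>+y. ennreal (exp (0 * y + 0)) \<partial>Q)" by simp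
    also have "\<dots> = 1" using nnQ[of 0 0] int(2) Z by (simp add: Z_def)
    finally show "emeasure Q (space Q) = 1" .
  qed
  then interpret Q: prob_space Q .
  \<comment> \<open>The hypotheses \<open>A\<close> and \<open>B\<close> say that
    \<open>- s * (y - A)\<close> and \<open>s * (y - B)\<close> have exponential moments below 1
    under \<open>Q\<close>. They express that \<open>Q\<close> has its mean between \<open>A\<close>
    and \<open>B\<close> in the form in which Chernoff's bound uses it.\<close>
  define \<rho>1 where "\<rho>1 = exp (s * A) * (\<integral>y. exp ((t - s) * y) \<partial>N) / Z"
  define \<rho>2 where "\<rho>2 = exp (- s * B) * (\<integral>y. exp ((t + s) * y) \<partial>N) / Z"
  have \<rho>1: "0 \<le> \<rho>1" "\<rho>1 < 1" using A Z by (auto simp: \<rho>1_def Z_def[symmetric])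
  have \<rho>2: "0 \<le> \<rho>2" "\<rho>2 < 1" using B Z by (auto simp: \<rho>2_def Z_def[symmetric])
  have E1: "(\<integral>\<^sup>+y. ennreal (exp (- s * (y - A))) \<partial>Q) = ennreal \<rho>1"
    using nnQ[of "- s" "s * A"] int(1) by (simp add: \<rho>1_def algebra_simps)
  have E2: "(\<integral>\<^sup>+y. ennreal (exp (s * (y - B))) \<partial>Q) = ennreal \<rho>2"
    using nnQ[of s "- s * B"] int(3) by (simp add: \<rho>2_def algebra_simps)
  define p where "p = measure Q {A..}"
  \<comment> \<open>If \<open>y < A\<close> held almost surely under \<open>Q\<close>, the moment
    \<open>\<rho>1\<close> would be at least 1.\<close>
  have p: "p > 0"
  proof (rule ccontr)
    assume "\<not> p > 0"
    then have "measure Q {A..} = 0" using measure_nonneg[of Q "{A..}"] by (simp add: p_def)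
    then have "AE y in Q. y \<notin> {A..}"
      by (intro AE_not_in) (simp add: null_sets_def Q.emeasure_eq_measure setsQ)
    then have "AE y in Q. 1 \<le> ennreal (exp (- s * (y - A)))"
    proof eventually_elim
      case (elim y)
      then have "s * (y - A) \<le> 0" using s by (intro mult_nonneg_nonpos) auto
      then have "1 \<le> exp (- s * (y - A))" by simp
      then show ?case by (metis ennreal_1 ennreal_leI)
    qed
    then have "(\<integral>\<^sup>+y. 1 \<partial>Q) \<le> (\<integral>\<^sup>+y. ennreal (exp (- s * (y - A))) \<partial>Q)" by (rule nn_integral_mono_AE)
    then have "1 \<le> ennreal \<rho>1" unfolding E1 by (simp add: Q.emeasure_space_1)
    then show False using \<rho>1 by simp
  qed
  \<comment> \<open>An interval with \<open>n\<close> summands around a given point has at most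
    \<open>n\<close> positions, and each fails with probability at most \<open>\<rho>1 ^ n\<close>.
    Beyond \<open>n0\<close> the tail of this series is small enough for all points of
    \<open>C\<close> together.\<close>
  have "summable (\<lambda>n. real (Suc n) * \<rho>1 ^ n)"
    using geometric_deriv_sums[of \<rho>1] \<rho>1 by (auto simp: sums_iff)
  from suminf_exist_split[OF _ this, of "1 / (2 * (real d0 + 1))"]
  obtain n0 where n0: "norm (\<Sum>i. real (Suc (i + n0)) * \<rho>1 ^ (i + n0)) < 1 / (2 * (real d0 + 1))" by fastforce
  have sumtail: "summable (\<lambda>i. real (Suc (i + n0)) * \<rho>1 ^ (i + n0))"
    using \<open>summable (\<lambda>n. real (Suc n) * \<rho>1 ^ n)\<close> by (subst summable_iff_shift)
  have tail: "(\<Sum>n\<in>{n0..m}. real n * \<rho>1 ^ n) \<le> 1 / (2 * (real d0 + 1))" for m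
  proof -
    have "(\<Sum>n\<in>{n0..m}. real n * \<rho>1 ^ n) \<le> (\<Sum>n\<in>{n0..m}. real (Suc n) * \<rho>1 ^ n)"
      using \<rho>1 by (intro sum_mono mult_right_mono) auto
    also have "\<dots> \<le> (\<Sum>n\<in>{n0..<n0 + Suc m}. real (Suc n) * \<rho>1 ^ n)"
      using \<rho>1 by (intro sum_mono2) auto
    also have "\<dots> = (\<Sum>i<Suc m. real (Suc (i + n0)) * \<rho>1 ^ (i + n0))"
      using sum.shift_bounds_nat_ivl[of "\<lambda>n. real (Suc n) * \<rho>1 ^ n" 0 n0 "Suc m"]
      by (simp add: atLeast0LessThan add.commute)
    also have "\<dots> \<le> (\<Sum>i. real (Suc (i + n0)) * \<rho>1 ^ (i + n0))"
      using sumtail \<rho>1 by (intro sum_le_suminf) auto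
    finally show ?thesis using n0 by simp
  qed
  define c0 where "c0 = p ^ (d0 * (2 * n0 + 1)) * (1 / 2)"
  have c0: "c0 > 0" using p by (simp add: c0_def)
  show ?thesis
  proof (rule exI[of _ c0], intro conjI c0, rule exI[of _ \<rho>2], intro conjI \<rho>2 allI impI)
    fix C :: "nat set" and L :: nat assume C: "finite C" "card C \<le> d0"
    let ?I = "{..L}"
    define P where "P = PiM ?I (\<lambda>_. N)"
    define R where "R = PiM ?I (\<lambda>_. Q)"
    interpret P: prob_space P unfolding P_def by (intro prob_space_PiM N)
    interpret R: prob_space R unfolding R_def by (intro prob_space_PiM) (rule Q.prob_space_axioms)
    have spaces: "space P = space R" by (simp add: P_def R_def space_PiM Q_def)
    have setsPR: "sets P = sets R" unfolding P_def R_def by (intro sets_PiM_cong) (auto simp: Q_def)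
    have comp[measurable]: "(\<lambda>x. x k) \<in> borel_measurable R" if "k \<le> L" for k
    proof -
      have "(\<lambda>x. x k) \<in> measurable R Q" unfolding R_def using that by (intro measurable_component_singleton) auto
      then show ?thesis using setsQ measurable_cong_sets by blast
    qed
    have RD: "R = density P (\<lambda>x. \<Prod>i\<in>?I. ennreal (f (x i)))"
      unfolding R_def Q_def P_def
      by (rule prob_density_PiM) (auto simp: N f Q.prob_space_axioms[unfolded Q_def])
    define S where "S = {x \<in> space R. \<forall>c\<in>C. \<forall>p<c. \<forall>q\<in>{c<..L}. 0 \<le> (\<Sum>k\<in>{p<..<q}. x k - A)}"
    define T where "T = {x \<in> space R. (\<Sum>k\<in>?I. x k) \<le> B * real (Suc L)}"
    have sumS: "{x \<in> space R. 0 \<le> (\<Sum>k\<in>{p<..<q}. x k - A)} \<in> sets R" if "q \<le> L" for p q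
    proof -
      have "(\<lambda>x. \<Sum>k\<in>{p<..<q}. x k - A) \<in> borel_measurable R"
        using that by (intro borel_measurable_sum borel_measurable_diff comp borel_measurable_const) auto
      then show ?thesis by measurable
    qed
    have mS: "S \<in> sets R" unfolding S_def
    proof (intro sets.sets_Collect_finite_All[OF _ C(1)])
      fix c assume "c \<in> C"
      have "{x \<in> space R. \<forall>p\<in>{..<c}. \<forall>q\<in>{c<..L}. 0 \<le> (\<Sum>k\<in>{p<..<q}. x k - A)} \<in> sets R"
        by (intro sets.sets_Collect_finite_All sumS) auto
      then show "{x \<in> space R. \<forall>p<c. \<forall>q\<in>{c<..L}. 0 \<le> (\<Sum>k\<in>{p<..<q}. x k - A)} \<in> sets R" by simp
    qed
    have mT: "T \<in> sets R" unfolding T_def by measurable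
    \<comment> \<open>Short intervals around \<open>C\<close> are made nonnegative term by term, by
      requiring \<open>x k \<ge> A\<close> at the boundedly many indices in \<open>K\<close>. The
      positive drift takes care of the long ones.\<close>
    define K where "K = {k \<in> ?I. \<exists>c\<in>C. k \<in> {c - n0..c + n0}}"
    have cK: "card K \<le> d0 * (2 * n0 + 1)"
    proof -
      have "K \<subseteq> (\<Union>c\<in>C. {c - n0..c + n0})" by (auto simp: K_def)
      then have "card K \<le> card (\<Union>c\<in>C. {c - n0..c + n0})" using C by (intro card_mono) auto
      also have "\<dots> \<le> (\<Sum>c\<in>C. card {c - n0..c + n0})" by (rule card_UN_le) (rule C)
      also have "\<dots> \<le> (\<Sum>c\<in>C. 2 * n0 + 1)" by (intro sum_mono) auto
      also have "\<dots> = card C * (2 * n0 + 1)" by simp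
      also have "\<dots> \<le> d0 * (2 * n0 + 1)" using C by (intro mult_right_mono) auto
      finally show ?thesis .
    qed
    define S1 where "S1 = {x \<in> space R. \<forall>k\<in>K. x k \<in> {A..}}"
    define S2 where "S2 = {x \<in> space R. \<forall>c\<in>C. \<forall>p<c. \<forall>q\<in>{c<..L}. p + n0 < q \<longrightarrow> 0 \<le> (\<Sum>k\<in>{p<..<q}. x k - A)}"
    have mS1: "S1 \<in> sets R" unfolding S1_def
    proof (intro sets.sets_Collect_finite_All)
      show "finite K" by (simp add: K_def)
      fix k assume "k \<in> K"
      then have "k \<le> L" by (simp add: K_def)
      note comp[OF this, measurable]
      show "{x \<in> space R. x k \<in> {A..}} \<in> sets R" by measurable
    qed
    have mS2: "S2 \<in> sets R" unfolding S2_def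
    proof (intro sets.sets_Collect_finite_All[OF _ C(1)])
      fix c assume "c \<in> C"
      have "{x \<in> space R. \<forall>p\<in>{..<c}. \<forall>q\<in>{c<..L}. p + n0 < q \<longrightarrow> 0 \<le> (\<Sum>k\<in>{p<..<q}. x k - A)} \<in> sets R"
        by (intro sets.sets_Collect_finite_All sets.sets_Collect_imp sumS sets.sets_Collect_const) auto
      then show "{x \<in> space R. \<forall>p<c. \<forall>q\<in>{c<..L}. p + n0 < q \<longrightarrow> 0 \<le> (\<Sum>k\<in>{p<..<q}. x k - A)} \<in> sets R" by simp
    qed
    have "R.prob S1 = p ^ card K"
      unfolding S1_def R_def p_def
      by (rule measure_PiM_coordinates) (auto simp: Q.prob_space_axioms setsQ K_def)
    also have "\<dots> \<ge> p ^ (d0 * (2 * n0 + 1))"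
      using cK p by (intro power_decreasing) (auto simp: p_def)
    finally have pS1: "R.prob S1 \<ge> p ^ (d0 * (2 * n0 + 1))" .
    define W where "W c n l = {x \<in> space R. l + n < L \<and> 0 \<le> (\<Sum>k\<in>{l<..<l + Suc n}. - s * (x k - A))}" for c n l :: nat
    have mW: "W c n l \<in> sets R" for c n l
    proof (cases "l + n < L")
      case True
      have "(\<lambda>x. \<Sum>k\<in>{l<..<l + Suc n}. - s * (x k - A)) \<in> borel_measurable R"
        using True by (intro borel_measurable_sum borel_measurable_times borel_measurable_diff comp borel_measurable_const) auto
      then show ?thesis unfolding W_def using True by simp
    qed (simp add: W_def)
    have pW: "R.prob (W c n l) \<le> \<rho>1 ^ n" for c n l
    proof (cases "l + n < L \<and> n > 0")
      case True
      have "Suc l \<in> {l<..<l + Suc n}" using True by simp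
      then have ne: "{l<..<l + Suc n} \<noteq> {}" by blast
      have "R.prob {x \<in> space R. 0 \<le> (\<Sum>k\<in>{l<..<l + Suc n}. - s * (x k - A))} \<le> \<rho>1 ^ card {l<..<l + Suc n}"
        unfolding R_def using True E1 \<rho>1
        by (intro ne chernoff_PiM[where g = "\<lambda>y. - s * (y - A)"]) (auto simp: Q.prob_space_axioms setsQ)
      then show ?thesis using True by (simp add: W_def)
    next
      case False
      then show ?thesis by (cases "n = 0") (auto simp: W_def \<rho>1)
    qed
    \<comment> \<open>The number of summands is \<open>n = q - l - 1\<close>, and
      \<open>l < c < q\<close> forces \<open>c - n \<le> l\<close>; this gives the count of
      positions.\<close>
    have sub2: "space R - S2 \<subseteq> (\<Union>c\<in>C. \<Union>n\<in>{n0..L}. \<Union>l\<in>{c - n..<c}. W c n l)"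
    proof
      fix x assume "x \<in> space R - S2"
      then obtain c l q where x: "x \<in> space R" "c \<in> C" "l < c" "c < q" "q \<le> L" "l + n0 < q" "(\<Sum>k\<in>{l<..<q}. x k - A) < 0"
        unfolding S2_def by force
      define n where "n = q - l - 1"
      have q: "q = l + Suc n" using x by (simp add: n_def)
      have "s * (\<Sum>k\<in>{l<..<q}. x k - A) \<le> 0" using x s by (intro mult_nonneg_nonpos) auto
      then have "0 \<le> (\<Sum>k\<in>{l<..<l + Suc n}. - s * (x k - A))"
        unfolding sum_distrib_left[symmetric] q by simp
      then have "x \<in> W c n l" using x q by (simp add: W_def)
      moreover have "n \<in> {n0..L}" "l \<in> {c - n..<c}" using x q by auto
      ultimately show "x \<in> (\<Union>c\<in>C. \<Union>n\<in>{n0..L}. \<Union>l\<in>{c - n..<c}. W c n l)" using x(2) by blast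
    qed
    have "R.prob (space R - S2) \<le> R.prob (\<Union>c\<in>C. \<Union>n\<in>{n0..L}. \<Union>l\<in>{c - n..<c}. W c n l)"
      using C by (intro R.finite_measure_mono sub2 sets.finite_UN mW) auto
    also have "\<dots> \<le> (\<Sum>c\<in>C. R.prob (\<Union>n\<in>{n0..L}. \<Union>l\<in>{c - n..<c}. W c n l))"
      using C by (intro measure_UNION_le sets.finite_UN mW) auto
    also have "\<dots> \<le> (\<Sum>c\<in>C. 1 / (2 * (real d0 + 1)))"
    proof (rule sum_mono)
      fix c
      have "R.prob (\<Union>n\<in>{n0..L}. \<Union>l\<in>{c - n..<c}. W c n l) \<le> (\<Sum>n\<in>{n0..L}. R.prob (\<Union>l\<in>{c - n..<c}. W c n l))"
        by (intro measure_UNION_le sets.finite_UN mW) auto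
      also have "\<dots> \<le> (\<Sum>n\<in>{n0..L}. real n * \<rho>1 ^ n)"
      proof (rule sum_mono)
        fix n
        have "R.prob (\<Union>l\<in>{c - n..<c}. W c n l) \<le> (\<Sum>l\<in>{c - n..<c}. R.prob (W c n l))"
          by (intro measure_UNION_le mW) auto
        also have "\<dots> \<le> (\<Sum>l\<in>{c - n..<c}. \<rho>1 ^ n)" by (intro sum_mono pW)
        also have "\<dots> = real (card {c - n..<c}) * \<rho>1 ^ n" by simp
        also have "\<dots> \<le> real n * \<rho>1 ^ n" using \<rho>1 by (intro mult_right_mono) auto
        finally show "R.prob (\<Union>l\<in>{c - n..<c}. W c n l) \<le> real n * \<rho>1 ^ n" .
      qed
      also have "\<dots> \<le> 1 / (2 * (real d0 + 1))" by (rule tail)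
      finally show "R.prob (\<Union>n\<in>{n0..L}. \<Union>l\<in>{c - n..<c}. W c n l) \<le> 1 / (2 * (real d0 + 1))" .
    qed
    also have "\<dots> = real (card C) * (1 / (2 * (real d0 + 1)))" by simp
    also have "\<dots> \<le> (real d0 + 1) * (1 / (2 * (real d0 + 1)))" using C by (intro mult_right_mono) auto
    also have "\<dots> = 1 / 2" by (simp add: field_simps)
    finally have pS2: "R.prob S2 \<ge> 1 / 2" using R.prob_compl[OF mS2] by simp
    have "c0 \<le> R.prob S1 * R.prob S2"
      unfolding c0_def using pS1 pS2 p by (intro mult_mono) auto
    \<comment> \<open>Both events are increasing in the sequence, so Harris' inequality for this
      pair, indexed by \<open>bool\<close>, bounds the probability of their intersection below by
      \<open>c0\<close>.\<close>
    also have "\<dots> = (\<Prod>b\<in>UNIV. R.prob (if b then S1 else S2))" by (simp add: UNIV_bool)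
    also have "\<dots> \<le> R.prob (space R \<inter> (\<Inter>b\<in>UNIV. if b then S1 else S2))"
      unfolding R_def
    proof (rule harris_events[where le = "\<lambda>_ a b. a \<le> b"])
      fix b :: bool and x y :: "nat \<Rightarrow> real"
      assume x: "x \<in> (if b then S1 else S2)" and y: "y \<in> space (PiM {..L} (\<lambda>_. Q))" and le: "\<And>i. i \<in> {..L} \<Longrightarrow> x i \<le> y i"
      have yR: "y \<in> space R" using y by (simp add: R_def)
      show "y \<in> (if b then S1 else S2)"
      proof (cases b)
        case True
        then have "x \<in> S1" using x by simp
        moreover have "x k \<le> y k" if "k \<in> K" for k using that le by (auto simp: K_def)
        ultimately have "y \<in> S1" using yR unfolding S1_def by (force intro: order_trans)
        then show ?thesis using True by simp
      next
        case False
        then have x2: "x \<in> S2" using x by simp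
        have "y \<in> S2"
          unfolding S2_def
        proof (intro CollectI conjI yR ballI allI impI)
          fix c l q assume c: "c \<in> C" "l < c" "q \<in> {c<..L}" "l + n0 < q"
          then have "0 \<le> (\<Sum>k\<in>{l<..<q}. x k - A)" using x2 unfolding S2_def by blast
          also have "\<dots> \<le> (\<Sum>k\<in>{l<..<q}. y k - A)"
            using le c by (intro sum_mono) auto
          finally show "0 \<le> (\<Sum>k\<in>{l<..<q}. y k - A)" .
        qed
        then show ?thesis using False by simp
      qed
    next
      show "(if b then S1 else S2) \<in> sets (PiM {..L} (\<lambda>_. Q))" for b
        using mS1 mS2 by (simp add: R_def)
    qed (auto simp: Q.prob_space_axioms)
    also have "space R \<inter> (\<Inter>b\<in>UNIV. if b then S1 else S2) \<subseteq> S"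
    proof
      fix x assume "x \<in> space R \<inter> (\<Inter>b\<in>UNIV. if b then S1 else S2)"
      then have x: "x \<in> S1" "x \<in> S2" by (auto split: if_splits dest: spec[of _ True] spec[of _ False])
      show "x \<in> S" unfolding S_def
      proof (intro CollectI conjI ballI allI impI)
        show "x \<in> space R" using x by (simp add: S1_def)
        fix c l q assume c: "c \<in> C" "l < c" "q \<in> {c<..L}"
        show "0 \<le> (\<Sum>k\<in>{l<..<q}. x k - A)"
        proof (cases "l + n0 < q")
          case True
          then show ?thesis using x(2) c unfolding S2_def by blast
        next
          case False
          then have "k \<in> K" if "k \<in> {l<..<q}" for k using that c by (auto simp: K_def intro!: bexI[of _ c])
          then have "x k \<ge> A" if "k \<in> {l<..<q}" for k using that x(1) unfolding S1_def by blast
          then show ?thesis by (intro sum_nonneg) auto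
        qed
      qed
    qed
    then have "R.prob (space R \<inter> (\<Inter>b\<in>UNIV. if b then S1 else S2)) \<le> R.prob S"
      by (intro R.finite_measure_mono mS)
    finally have cS: "c0 \<le> R.prob S" .
    have "R.prob (space R - T) \<le> R.prob {x \<in> space R. 0 \<le> (\<Sum>k\<in>?I. s * (x k - B))}"
    proof (rule R.finite_measure_mono)
      show "space R - T \<subseteq> {x \<in> space R. 0 \<le> (\<Sum>k\<in>?I. s * (x k - B))}"
      proof
        fix x assume "x \<in> space R - T"
        then have x: "x \<in> space R" "B * real (Suc L) < (\<Sum>k\<in>?I. x k)" by (auto simp: T_def)
        have "(\<Sum>k\<in>?I. s * (x k - B)) = s * ((\<Sum>k\<in>?I. x k) - B * real (Suc L))"
          by (simp add: sum_distrib_left[symmetric] sum_subtractf algebra_simps)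
        also have "\<dots> \<ge> 0" using x s by (intro mult_nonneg_nonneg) auto
        finally show "x \<in> {x \<in> space R. 0 \<le> (\<Sum>k\<in>?I. s * (x k - B))}" using x by simp
      qed
    qed measurable
    also have "\<dots> \<le> \<rho>2 ^ card ?I"
      unfolding R_def using E2 \<rho>2
      by (intro chernoff_PiM[where g = "\<lambda>y. s * (y - B)"]) (auto simp: Q.prob_space_axioms setsQ)
    finally have pT: "R.prob (space R - T) \<le> \<rho>2 ^ Suc L" by simp
    have "R.prob S \<le> R.prob (S \<inter> T) + R.prob (space R - T)"
    proof -
      have "R.prob S \<le> R.prob ((S \<inter> T) \<union> (space R - T))"
        using mS mT by (intro R.finite_measure_mono) (auto simp: S_def)
      also have "\<dots> \<le> R.prob (S \<inter> T) + R.prob (space R - T)"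
        using mS mT by (intro measure_Un_le) auto
      finally show ?thesis .
    qed
    then have ST: "c0 - \<rho>2 ^ Suc L \<le> R.prob (S \<inter> T)" using cS pT by linarith
    \<comment> \<open>On \<open>T\<close> the density of \<open>R\<close> with respect to
      \<open>P\<close> is at most \<open>1 / G\<close>, because \<open>t \<ge> 0\<close> and the
      total is bounded. The probability under \<open>P\<close> is thus at least \<open>G\<close>
      times that under \<open>R\<close>.\<close>
    define G where "G = (Z * exp (- t * B)) ^ Suc L"
    have G: "G > 0" using Z by (simp add: G_def)
    have "emeasure R (S \<inter> T) = (\<integral>\<^sup>+x. (\<Prod>i\<in>?I. ennreal (f (x i))) * indicator (S \<inter> T) x \<partial>P)"
      unfolding RD
    proof (rule emeasure_density)
      show "S \<inter> T \<in> sets P" using mS mT setsPR by simp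
      show "(\<lambda>x. \<Prod>i\<in>?I. ennreal (f (x i))) \<in> borel_measurable P"
        unfolding P_def by measurable
    qed
    also have "\<dots> \<le> (\<integral>\<^sup>+x. ennreal (1 / G) * indicator (S \<inter> T) x \<partial>P)"
    proof (rule nn_integral_mono)
      fix x
      show "(\<Prod>i\<in>?I. ennreal (f (x i))) * indicator (S \<inter> T) x \<le> ennreal (1 / G) * indicator (S \<inter> T) x"
      proof (cases "x \<in> S \<inter> T")
        case True
        have "(\<Prod>i\<in>?I. f (x i)) = exp (t * (\<Sum>i\<in>?I. x i)) / Z ^ Suc L"
          by (simp add: f_def prod_dividef exp_sum[symmetric] sum_distrib_left)
        also have "\<dots> \<le> exp (t * (B * real (Suc L))) / Z ^ Suc L"
          using True t Z by (intro divide_right_mono) (auto simp: T_def intro: mult_left_mono)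
        also have "exp (t * (B * real (Suc L))) = exp (t * B) ^ Suc L"
          by (simp only: exp_of_nat_mult[symmetric] mult.commute mult.left_commute mult.assoc)
        also have "exp (t * B) ^ Suc L / Z ^ Suc L = 1 / G"
          by (simp add: G_def power_mult_distrib exp_minus power_divide field_simps)
        finally have "(\<Prod>i\<in>?I. f (x i)) \<le> 1 / G" .
        moreover have "(\<Prod>i\<in>?I. ennreal (f (x i))) = ennreal (\<Prod>i\<in>?I. f (x i))"
          using f0 by (intro prod_ennreal) (simp add: less_imp_le)
        ultimately show ?thesis using True by (simp add: ennreal_leI)
      qed simp
    qed
    also have "\<dots> = ennreal (1 / G) * emeasure P (S \<inter> T)"
      using mS mT setsPR by (intro nn_integral_cmult_indicator) simp
    finally have "ennreal (R.prob (S \<inter> T)) \<le> ennreal (1 / G) * ennreal (P.prob (S \<inter> T))"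
      by (simp only: R.emeasure_eq_measure P.emeasure_eq_measure)
    also have "\<dots> = ennreal (1 / G * P.prob (S \<inter> T))"
      by (rule ennreal_mult[symmetric]) (use G in auto)
    finally have "R.prob (S \<inter> T) \<le> 1 / G * P.prob (S \<inter> T)"
      using G by (subst (asm) ennreal_le_iff) auto
    then have "R.prob (S \<inter> T) * G \<le> P.prob (S \<inter> T)" using G by (simp add: field_simps)
    also have "\<dots> \<le> P.prob S" using mS setsPR by (intro P.finite_measure_mono) auto
    finally have "R.prob (S \<inter> T) * G \<le> P.prob S" .
    moreover have "(c0 - \<rho>2 ^ Suc L) * G \<le> R.prob (S \<inter> T) * G" using ST G by (intro mult_right_mono) auto
    ultimately have "(c0 - \<rho>2 ^ Suc L) * G \<le> P.prob S" by linarith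
    then show "(c0 - \<rho>2 ^ Suc L) * ((\<integral>y. exp (t * y) \<partial>N) * exp (- t * B)) ^ Suc L \<le>
       measure (PiM {..L} (\<lambda>_. N)) {x \<in> space (PiM {..L} (\<lambda>_. N)). \<forall>c\<in>C. \<forall>p<c. \<forall>q\<in>{c<..L}. 0 \<le> (\<Sum>k\<in>{p<..<q}. x k - A)}"
      unfolding G_def Z_def[symmetric] S_def spaces[symmetric] P_def[symmetric] .
  qed
qed

section \<open>Lower bound for the corner path\<close>

context iid_lattice_field
begin

text \<open>The vertices of \<open>\<gamma>\<close> are distinct, so the weights along it form an
  i.i.d. sequence and the tilting estimate applies whatever the shape of the path.\<close>

lemma on_event_prob:
  fixes \<gamma> :: "(int ^ 'd) list" and L :: nat
  assumes \<gamma>: "\<gamma> \<in> paths n" and L: "length \<gamma> = Suc L" and C: "finite C"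
  shows "prob {w \<in> space M. \<forall>c\<in>C. \<forall>p<c. \<forall>q\<in>{c<..L}. 0 \<le> (\<Sum>k\<in>{p<..<q}. \<omega> (\<gamma> ! k) w - A)} =
    measure (PiM {..L} (\<lambda>_. N)) {x \<in> space (PiM {..L} (\<lambda>_. N)). \<forall>c\<in>C. \<forall>p<c. \<forall>q\<in>{c<..L}. 0 \<le> (\<Sum>k\<in>{p<..<q}. x k - A)}"
proof (rule prob_functional[where \<phi> = "(!) \<gamma>" and B = "{..L}"])
  show "inj_on ((!) \<gamma>) {..L}" using paths_distinct[OF \<gamma>] L by (intro inj_on_nth) auto
  have S: "{x \<in> space (PiM {..L} (\<lambda>_. borel)). 0 \<le> (\<Sum>k\<in>{p<..<q}. x k - A)} \<in> sets (PiM {..L} (\<lambda>_. borel))"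
    if "q \<le> L" for p q
  proof -
    have "(\<lambda>x. \<Sum>k\<in>{p<..<q}. x k - A) \<in> borel_measurable (PiM {..L} (\<lambda>_. borel))"
      using that by (intro borel_measurable_sum borel_measurable_diff measurable_component_singleton borel_measurable_const) auto
    then show ?thesis by measurable
  qed
  have "{x \<in> space (PiM {..L} (\<lambda>_. borel)). \<forall>c\<in>C. \<forall>p\<in>{..<c}. \<forall>q\<in>{c<..L}. 0 \<le> (\<Sum>k\<in>{p<..<q}. x k - A)} \<in> sets (PiM {..L} (\<lambda>_. borel))"
    by (intro sets.sets_Collect_finite_All S C) auto
  then show "{x \<in> space (PiM {..L} (\<lambda>_. borel)). \<forall>c\<in>C. \<forall>p<c. \<forall>q\<in>{c<..L}. 0 \<le> (\<Sum>k\<in>{p<..<q}. x k - A)} \<in> sets (PiM {..L} (\<lambda>_. borel))"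
    by simp
  fix \<sigma> \<tau> :: "nat \<Rightarrow> real" assume eq: "\<And>i. i \<in> {..L} \<Longrightarrow> \<sigma> i = \<tau> i"
  have *: "\<forall>c\<in>C. \<forall>p<c. \<forall>q\<in>{c<..L}. 0 \<le> (\<Sum>k\<in>{p<..<q}. \<tau> k - A)"
    if a: "\<forall>c\<in>C. \<forall>p<c. \<forall>q\<in>{c<..L}. 0 \<le> (\<Sum>k\<in>{p<..<q}. \<sigma> k - A)"
      and eq: "\<And>i. i \<in> {..L} \<Longrightarrow> \<sigma> i = \<tau> i" for \<sigma> \<tau> :: "nat \<Rightarrow> real"
  proof (intro ballI allI impI)
    fix c p q assume c: "c \<in> C" "p < c" "q \<in> {c<..L}"
    then have "0 \<le> (\<Sum>k\<in>{p<..<q}. \<sigma> k - A)" using a by blast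
    also have "\<dots> = (\<Sum>k\<in>{p<..<q}. \<tau> k - A)" using c eq by (intro sum.cong) auto
    finally show "0 \<le> (\<Sum>k\<in>{p<..<q}. \<tau> k - A)" .
  qed
  show "(\<forall>c\<in>C. \<forall>p<c. \<forall>q\<in>{c<..L}. 0 \<le> (\<Sum>k\<in>{p<..<q}. \<sigma> k - A)) = (\<forall>c\<in>C. \<forall>p<c. \<forall>q\<in>{c<..L}. 0 \<le> (\<Sum>k\<in>{p<..<q}. \<tau> k - A))"
    using *[OF _ eq] *[OF _ eq[symmetric]] by (intro iffI)
qed simp

text \<open>The preorder is increasing at vertices of \<open>\<gamma>\<close> and decreasing
  elsewhere. The first event reads weights of \<open>\<gamma>\<close> only, the second none of them
  since excursions avoid \<open>\<gamma>\<close>, so both are monotone for it.\<close>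

lemma on_off_harris:
  fixes \<gamma> :: "(int ^ 'd) list" and L :: nat
  assumes \<gamma>: "\<gamma> \<in> paths n" and L: "length \<gamma> = Suc L" and C: "finite C"
  shows "prob {w \<in> space M. \<forall>c\<in>C. \<forall>p<c. \<forall>q\<in>{c<..L}. 0 \<le> (\<Sum>k\<in>{p<..<q}. \<omega> (\<gamma> ! k) w - A)} *
      prob {w \<in> space M. \<forall>\<pi>\<in>excursions \<gamma> C UNIV. wt (\<lambda>z. \<omega> z w - A) \<pi> \<le> 0} \<le>
    prob {w \<in> space M. (\<forall>c\<in>C. \<forall>p<c. \<forall>q\<in>{c<..L}. 0 \<le> (\<Sum>k\<in>{p<..<q}. \<omega> (\<gamma> ! k) w - A)) \<and>
       (\<forall>\<pi>\<in>excursions \<gamma> C UNIV. wt (\<lambda>z. \<omega> z w - A) \<pi> \<le> 0)}"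
proof -
  let ?I = "box_set 0 (diag n) :: (int ^ 'd) set"
  define on where "on \<sigma> \<longleftrightarrow> (\<forall>c\<in>C. \<forall>p<c. \<forall>q\<in>{c<..L}. 0 \<le> (\<Sum>k\<in>{p<..<q}. \<sigma> (\<gamma> ! k) - A))" for \<sigma> :: "int ^ 'd \<Rightarrow> real"
  define off where "off \<sigma> \<longleftrightarrow> (\<forall>\<pi>\<in>excursions \<gamma> C UNIV. wt (\<lambda>z. \<sigma> z - A) \<pi> \<le> 0)" for \<sigma> :: "int ^ 'd \<Rightarrow> real"
  define le where "le i a b \<longleftrightarrow> (if i \<in> set \<gamma> then a \<le> b else b \<le> a)" for i and a b :: real
  define P where "P b = (if b then on else off)" for b
  have g: "\<gamma> ! k \<in> ?I" "\<gamma> ! k \<in> set \<gamma>" if "k \<le> L" for k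
    using paths_nth_box[OF \<gamma>, of k] that L by (auto simp: box_set_def diag_def)
  have mon: "{\<sigma> \<in> space (PiM ?I (\<lambda>_. borel)). on \<sigma>} \<in> sets (PiM ?I (\<lambda>_. borel))"
  proof -
    have S: "{\<sigma> \<in> space (PiM ?I (\<lambda>_. borel)). 0 \<le> (\<Sum>k\<in>{p<..<q}. \<sigma> (\<gamma> ! k) - A)} \<in> sets (PiM ?I (\<lambda>_. borel))"
      if "q \<le> L" for p q
    proof -
      have "(\<lambda>\<sigma>. \<Sum>k\<in>{p<..<q}. \<sigma> (\<gamma> ! k) - A) \<in> borel_measurable (PiM ?I (\<lambda>_. borel))"
        using that by (intro borel_measurable_sum borel_measurable_diff measurable_component_singleton borel_measurable_const g) auto
      then show ?thesis by measurable
    qed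
    have "{\<sigma> \<in> space (PiM ?I (\<lambda>_. borel)). \<forall>c\<in>C. \<forall>p\<in>{..<c}. \<forall>q\<in>{c<..L}. 0 \<le> (\<Sum>k\<in>{p<..<q}. \<sigma> (\<gamma> ! k) - A)} \<in> sets (PiM ?I (\<lambda>_. borel))"
      by (intro sets.sets_Collect_finite_All S C) auto
    then show ?thesis unfolding on_def Ball_def lessThan_iff .
  qed
  have moff: "{\<sigma> \<in> space (PiM ?I (\<lambda>_. borel)). off \<sigma>} \<in> sets (PiM ?I (\<lambda>_. borel))"
    unfolding off_def
  proof (rule sets.sets_Collect_finite_All[OF _ finite_excursions[OF \<gamma>]])
    fix \<pi> assume \<pi>: "\<pi> \<in> excursions \<gamma> C UNIV"
    have "(\<lambda>\<sigma>. wt (\<lambda>z. \<sigma> z - A) \<pi>) \<in> borel_measurable (PiM ?I (\<lambda>_. borel))"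
      using excursions_box[OF \<gamma> \<pi>]
      by (intro borel_measurable_wt borel_measurable_diff measurable_component_singleton borel_measurable_const) auto
    then show "{\<sigma> \<in> space (PiM ?I (\<lambda>_. borel)). wt (\<lambda>z. \<sigma> z - A) \<pi> \<le> 0} \<in> sets (PiM ?I (\<lambda>_. borel))" by measurable
  qed
  have "(\<Prod>b\<in>UNIV. prob {w \<in> space M. P b (\<lambda>z. \<omega> z w)}) \<le> prob {w \<in> space M. \<forall>b\<in>UNIV. P b (\<lambda>z. \<omega> z w)}"
  proof (rule harris[where I = ?I and le = le])
    show "{\<sigma> \<in> space (PiM ?I (\<lambda>_. borel)). P b \<sigma>} \<in> sets (PiM ?I (\<lambda>_. borel))" for b
      using mon moff by (simp add: P_def)
    fix b and \<sigma> \<tau> :: "int ^ 'd \<Rightarrow> real"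
    assume P: "P b \<sigma>" and le: "\<And>i. i \<in> ?I \<Longrightarrow> le i (\<sigma> i) (\<tau> i)"
    show "P b \<tau>"
    proof (cases b)
      case True
      have "on \<tau>" unfolding on_def
      proof (intro ballI allI impI)
        fix c p q assume c: "c \<in> C" "p < c" "q \<in> {c<..L}"
        have "0 \<le> (\<Sum>k\<in>{p<..<q}. \<sigma> (\<gamma> ! k) - A)" using P True c unfolding P_def on_def by simp
        also have "\<dots> \<le> (\<Sum>k\<in>{p<..<q}. \<tau> (\<gamma> ! k) - A)"
        proof (rule sum_mono)
          fix k assume "k \<in> {p<..<q}"
          then have "k \<le> L" using c by simp
          then show "\<sigma> (\<gamma> ! k) - A \<le> \<tau> (\<gamma> ! k) - A" using le[OF g(1)] g(2) by (simp add: le_def)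
        qed
        finally show "0 \<le> (\<Sum>k\<in>{p<..<q}. \<tau> (\<gamma> ! k) - A)" .
      qed
      then show ?thesis using True by (simp add: P_def)
    next
      case False
      have "off \<tau>" unfolding off_def
      proof
        fix \<pi> assume \<pi>: "\<pi> \<in> excursions \<gamma> C UNIV"
        have "wt (\<lambda>z. \<tau> z - A) \<pi> \<le> wt (\<lambda>z. \<sigma> z - A) \<pi>"
          using excursions_box[OF \<gamma> \<pi>] le by (intro wt_mono) (force simp: le_def)
        also have "\<dots> \<le> 0" using P False \<pi> by (simp add: P_def off_def)
        finally show "wt (\<lambda>z. \<tau> z - A) \<pi> \<le> 0" .
      qed
      then show ?thesis using False by (simp add: P_def)
    qed
  qed (auto simp: finite_box_set indep_on le_def)
  moreover have "(\<Prod>b\<in>UNIV. prob {w \<in> space M. P b (\<lambda>z. \<omega> z w)}) =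
      prob {w \<in> space M. on (\<lambda>z. \<omega> z w)} * prob {w \<in> space M. off (\<lambda>z. \<omega> z w)}"
    by (simp add: UNIV_bool P_def)
  moreover have "(\<forall>b\<in>UNIV. P b \<sigma>) \<longleftrightarrow> on \<sigma> \<and> off \<sigma>" for \<sigma> by (simp add: P_def all_bool_eq)
  ultimately show ?thesis unfolding on_def off_def by simp
qed

end

text \<open>The threshold \<open>A\<close> is above the speed of the diagonal passage time by
  \<open>H\<close> and below the tilted mean by hypothesis \<open>A\<close>. Tilting contributes
  \<open>(Z * exp (- t * B)) ^ (D * n + 1)\<close> up to a constant, the excursions
  \<open>c ^ K\<close> with \<open>K\<close> logarithmic in \<open>n\<close>;
  \<open>\<kappa>\<close> absorbs the polynomial factor and the constants.\<close>

lemma corner_path_lower_bound: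
  fixes M :: "'a measure" and \<omega> :: "int ^ 'd::{finite,linorder} \<Rightarrow> 'a \<Rightarrow> real" and N :: "real measure"
  defines "D \<equiv> CARD('d)"
  assumes iid: "iid_lattice_field M \<omega> N"
    and H: "(\<lambda>m. measure M {w \<in> space M. lpp (\<lambda>z. \<omega> z w) 0 (diag m) > (A * real D - \<delta>) * real m}) \<longlonglongrightarrow> 0" and \<delta>: "\<delta> > 0"
    and u: "u > 0" and E: "(\<integral>\<^sup>+y. ennreal (exp (u * \<bar>y\<bar>)) \<partial>N) < \<infinity>" and pA: "measure N {..A} > 0"
    and t: "t \<ge> 0" and s: "s > 0"
    and int: "integrable N (\<lambda>y. exp ((t - s) * y))" "integrable N (\<lambda>y. exp (t * y))" "integrable N (\<lambda>y. exp ((t + s) * y))"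
    and A: "exp (s * A) * (\<integral>y. exp ((t - s) * y) \<partial>N) < (\<integral>y. exp (t * y) \<partial>N)"
    and B: "exp (- s * B) * (\<integral>y. exp ((t + s) * y) \<partial>N) < (\<integral>y. exp (t * y) \<partial>N)"
    and \<kappa>: "\<kappa> > 0"
  shows "\<forall>\<^sub>F n in sequentially. exp (real n * (real D * (ln (\<integral>y. exp (t * y) \<partial>N) - t * B) - \<kappa>)) \<le>
     measure M {w \<in> space M. \<forall>\<gamma>'\<in>paths n. wt (\<lambda>z. \<omega> z w) \<gamma>' \<le> wt (\<lambda>z. \<omega> z w) (corner_path n)}"
proof -
  interpret F: iid_lattice_field M \<omega> N by (rule iid)
  define N' where "N' = distr N borel (\<lambda>y. y - A)"
  interpret S: iid_lattice_field M "\<lambda>x w. \<omega> x w - A" N' unfolding N'_def by (rule F.diff_const)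
  interpret N: prob_space N by (rule F.prob_space_N)
  have D: "D \<ge> 1" by (simp add: D_def Suc_leI)
  define Z where "Z = (\<integral>y. exp (t * y) \<partial>N)"
  have Z: "Z > 0"
  proof -
    have "0 \<le> exp (s * A) * (\<integral>y. exp ((t - s) * y) \<partial>N)" by simp
    from le_less_trans[OF this A] show ?thesis by (simp add: Z_def)
  qed
  have m: "(\<lambda>y. y - A) \<in> measurable N borel" by measurable
  have H': "(\<lambda>m. measure M {w \<in> space M. lpp (\<lambda>z. \<omega> z w - A) 0 (diag m) > - \<delta> * real m}) \<longlonglongrightarrow> 0"
  proof -
    have "lpp (\<lambda>z. \<omega> z w - A) 0 (diag m) > - \<delta> * real m \<longleftrightarrow> lpp (\<lambda>z. \<omega> z w) 0 (diag m) > (A * real D - \<delta>) * real m" for w m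
      by (subst lpp_diff_const) (auto simp: diag_def D_def level_diag[unfolded diag_def] algebra_simps)
    then show ?thesis using H by simp
  qed
  have E': "(\<integral>\<^sup>+y. ennreal (exp (u * \<bar>y\<bar>)) \<partial>N') < \<infinity>"
  proof -
    have "(\<integral>\<^sup>+y. ennreal (exp (u * \<bar>y\<bar>)) \<partial>N') = (\<integral>\<^sup>+y. ennreal (exp (u * \<bar>y - A\<bar>)) \<partial>N)"
      unfolding N'_def by (subst nn_integral_distr[OF m]) auto
    also have "\<dots> \<le> (\<integral>\<^sup>+y. ennreal (exp (u * \<bar>A\<bar>)) * ennreal (exp (u * \<bar>y\<bar>)) \<partial>N)"
    proof (rule nn_integral_mono)
      fix y
      have "u * \<bar>y - A\<bar> \<le> u * \<bar>A\<bar> + u * \<bar>y\<bar>" using u abs_triangle_ineq4[of y A]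
        by (simp add: distrib_left[symmetric])
      then have "exp (u * \<bar>y - A\<bar>) \<le> exp (u * \<bar>A\<bar>) * exp (u * \<bar>y\<bar>)" by (simp flip: exp_add)
      then show "ennreal (exp (u * \<bar>y - A\<bar>)) \<le> ennreal (exp (u * \<bar>A\<bar>)) * ennreal (exp (u * \<bar>y\<bar>))"
        by (subst ennreal_mult[symmetric]) (auto intro: ennreal_leI)
    qed
    also have "\<dots> = ennreal (exp (u * \<bar>A\<bar>)) * (\<integral>\<^sup>+y. ennreal (exp (u * \<bar>y\<bar>)) \<partial>N)"
      by (rule nn_integral_cmult) measurable
    also have "\<dots> < \<infinity>" using E by (simp add: ennreal_mult_less_top)
    finally show ?thesis .
  qed
  have p': "measure N' {..0} > 0"
  proof -
    have "measure N' {..0} = measure N ((\<lambda>y. y - A) -` {..0} \<inter> space N)"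
      unfolding N'_def by (rule measure_distr[OF m]) simp
    also have "(\<lambda>y. y - A) -` {..0} \<inter> space N = {..A}" by auto
    finally show ?thesis using pA by simp
  qed
  obtain c where c: "c > 0" and off: "\<And>n \<gamma> C K. \<lbrakk>\<gamma> \<in> paths n; finite C; card C \<le> D; length \<gamma> \<le> 2 ^ K\<rbrakk> \<Longrightarrow>
     c ^ K \<le> measure M {w \<in> space M. \<forall>\<pi>\<in>excursions \<gamma> C UNIV. wt (\<lambda>z. \<omega> z w - A) \<pi> \<le> 0}"
    using S.excursions_lower_bound[OF H' \<delta> u E' p', of D] by blast
  obtain c0 \<rho> where c0: "c0 > 0" and \<rho>: "0 \<le> \<rho>" "\<rho> < 1" and on: "\<And>C L. \<lbrakk>finite C; card C \<le> D\<rbrakk> \<Longrightarrow>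
     (c0 - \<rho> ^ Suc L) * (Z * exp (- t * B)) ^ Suc L \<le>
     measure (PiM {..L} (\<lambda>_. N)) {x \<in> space (PiM {..L} (\<lambda>_. N)). \<forall>c\<in>C. \<forall>p<c. \<forall>q\<in>{c<..L}. 0 \<le> (\<Sum>k\<in>{p<..<q}. x k - A)}"
    using tilted_interval_sums[OF F.prob_space_N F.sets_N t s int A B, of D] unfolding Z_def by blast
  \<comment> \<open>Makes \<open>ln c'\<close> nonpositive, so that the upper bound on
    \<open>K n\<close> gives a lower bound on \<open>c' ^ K n\<close>.\<close>
  define c' where "c' = min c 1"
  have c': "c' > 0" "c' \<le> 1" "c' \<le> c" using c by (auto simp: c'_def)
  define G where "G = Z * exp (- t * B)"
  have G: "G > 0" using Z by (simp add: G_def)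
  have lnG: "ln G = ln Z - t * B" using Z by (simp add: G_def ln_mult)
  define K where "K n = nat \<lceil>log 2 (real D * real n + 1)\<rceil>" for n
  have K2: "D * n + 1 \<le> 2 ^ K n" for n
  proof -
    have "log 2 (real D * real n + 1) \<le> real (K n)" unfolding K_def by linarith
    then have "real D * real n + 1 \<le> 2 powr real (K n)"
      by (subst (asm) log_le_iff) (auto intro: add_nonneg_pos)
    then have "real (D * n + 1) \<le> real (2 ^ K n)" by (simp add: powr_realpow)
    then show ?thesis by (simp only: of_nat_le_iff)
  qed
  have Kle: "real (K n) \<le> log 2 (real D * real n + 1) + 1" for n
  proof -
    have "0 \<le> log 2 (real D * real n + 1)"
      by (subst zero_le_log_cancel_iff) (auto intro: add_nonneg_pos)
    then show ?thesis unfolding K_def by linarith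
  qed
  have main: "c' ^ K n * ((c0 - \<rho> ^ Suc (D * n)) * G ^ Suc (D * n)) \<le>
     measure M {w \<in> space M. \<forall>\<gamma>'\<in>paths n. wt (\<lambda>z. \<omega> z w) \<gamma>' \<le> wt (\<lambda>z. \<omega> z w) (corner_path n)}"
    if n: "c0 - \<rho> ^ Suc (D * n) \<ge> 0" for n
  proof -
    let ?\<gamma> = "corner_path n :: (int, 'd) vec list"
    define C where "C = (\<lambda>m. m * n) ` {1..<D}"
    have C: "finite C" "card C \<le> D"
      using card_image_le[of "{1..<D}" "\<lambda>m. m * n"] by (auto simp: C_def)
    have \<gamma>: "?\<gamma> \<in> paths n" by (rule corner_path_in_paths)
    have len: "length ?\<gamma> = Suc (D * n)" using paths_length[OF \<gamma>] by (simp add: D_def)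
    let ?on = "\<lambda>w. \<forall>c\<in>C. \<forall>p<c. \<forall>q\<in>{c<..D * n}. 0 \<le> (\<Sum>k\<in>{p<..<q}. \<omega> (?\<gamma> ! k) w - A)"
    let ?off = "\<lambda>w. \<forall>\<pi>\<in>excursions ?\<gamma> C UNIV. wt (\<lambda>z. \<omega> z w - A) \<pi> \<le> 0"
    have "c' ^ K n * ((c0 - \<rho> ^ Suc (D * n)) * G ^ Suc (D * n)) \<le>
       measure M {w \<in> space M. ?off w} * measure M {w \<in> space M. ?on w}"
    proof (rule mult_mono)
      have "c' ^ K n \<le> c ^ K n" using c' by (intro power_mono) auto
      also have "\<dots> \<le> measure M {w \<in> space M. ?off w}"
        using K2[of n] len by (intro off[OF \<gamma> C]) simp
      finally show "c' ^ K n \<le> measure M {w \<in> space M. ?off w}" .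
      show "(c0 - \<rho> ^ Suc (D * n)) * G ^ Suc (D * n) \<le> measure M {w \<in> space M. ?on w}"
        unfolding F.on_event_prob[OF \<gamma> len C(1)] G_def by (rule on[OF C])
      show "0 \<le> (c0 - \<rho> ^ Suc (D * n)) * G ^ Suc (D * n)" using n G by (intro mult_nonneg_nonneg) auto
    qed simp
    also have "\<dots> \<le> measure M {w \<in> space M. ?on w \<and> ?off w}"
      using F.on_off_harris[OF \<gamma> len C(1), of A] by (simp only: mult.commute)
    also have "\<dots> \<le> measure M {w \<in> space M. \<forall>\<gamma>'\<in>paths n. wt (\<lambda>z. \<omega> z w) \<gamma>' \<le> wt (\<lambda>z. \<omega> z w) ?\<gamma>}"
    proof (rule F.finite_measure_mono)
      show "{w \<in> space M. ?on w \<and> ?off w} \<subseteq> {w \<in> space M. \<forall>\<gamma>'\<in>paths n. wt (\<lambda>z. \<omega> z w) \<gamma>' \<le> wt (\<lambda>z. \<omega> z w) ?\<gamma>}"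
      proof (intro subsetI CollectI conjI ballI)
        fix w and \<gamma>' :: "(int, 'd) vec list"
        assume w: "w \<in> {w \<in> space M. ?on w \<and> ?off w}"
        then show "w \<in> space M" by simp
        assume \<gamma>': "\<gamma>' \<in> paths n"
        show "wt (\<lambda>z. \<omega> z w) \<gamma>' \<le> wt (\<lambda>z. \<omega> z w) ?\<gamma>"
        proof (rule geodesic_if_excursions[OF \<gamma> _ _ _ \<gamma>', where C = C and A = A])
          show "0 \<le> (\<Sum>k\<in>{p<..<q}. \<omega> (?\<gamma> ! k) w - A)" if "c \<in> C" "p < c" "c < q" "q < length ?\<gamma>" for p q c
            using w that len by auto
          show "wt (\<lambda>z. \<omega> z w - A) \<pi> \<le> 0" if "\<pi> \<in> excursions ?\<gamma> C UNIV" for \<pi>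
            using w that by auto
          show "\<pi> = map ((!) ?\<gamma>) [Suc p..<Suc q]"
            if "p < q" "q < length ?\<gamma>" "\<And>c. c \<in> C \<Longrightarrow> p < c \<Longrightarrow> c < q \<Longrightarrow> False" "steps (?\<gamma> ! p) \<pi> (?\<gamma> ! q)" for p q \<pi>
            using that(3) unfolding C_def D_def by (intro corner_path_straight[OF that(1,2) _ that(4)])
        qed
      qed
      show "{w \<in> space M. \<forall>\<gamma>'\<in>paths n. wt (\<lambda>z. \<omega> z w) \<gamma>' \<le> wt (\<lambda>z. \<omega> z w) ?\<gamma>} \<in> sets M"
        by (intro sets.sets_Collect_finite_All finite_paths) measurable
    qed
    finally show ?thesis .
  qed
  have "(\<lambda>n. \<rho> ^ n) \<longlonglongrightarrow> 0" using \<rho> by (intro LIMSEQ_power_zero) auto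
  then have "\<forall>\<^sub>F n in sequentially. \<rho> ^ n < c0 / 2" using c0 by (intro order_tendstoD(2)) auto
  then obtain n1 where n1: "\<rho> ^ n < c0 / 2" if "n \<ge> n1" for n by (auto simp: eventually_sequentially)
  define a1 where "a1 = ln c'"
  define a2 where "a2 = ln (c0 / 2) + ln G"
  define Dr where "Dr = real D"
  have Dr: "Dr > 0" using D by (simp add: Dr_def)
  have "filterlim (\<lambda>n. \<kappa> * real n + a1 * (log 2 (Dr * real n + 1) + 1) + a2) at_top sequentially"
    using \<kappa> Dr by real_asymp
  then have ev: "\<forall>\<^sub>F n in sequentially. 0 \<le> \<kappa> * real n + a1 * (log 2 (Dr * real n + 1) + 1) + a2"
    by (simp add: filterlim_at_top)
  show ?thesis using ev eventually_ge_at_top[of n1]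
  proof eventually_elim
    case (elim n)
    have "n1 \<le> Suc (D * n)" using elim(2) D by (metis le_SucI le_trans mult_le_mono1 nat_mult_1)
    from n1[OF this] have rn: "\<rho> ^ Suc (D * n) < c0 / 2" .
    have a1: "a1 \<le> 0" using c' by (simp add: a1_def)
    have "exp (real n * (real D * (ln Z - t * B) - \<kappa>)) = exp (real (D * n) * ln G - \<kappa> * real n)"
      by (simp add: lnG algebra_simps)
    also have "\<dots> \<le> exp (real (K n) * ln c' + ln (c0 / 2) + real (Suc (D * n)) * ln G)"
    proof -
      have "a1 * (log 2 (Dr * real n + 1) + 1) \<le> a1 * real (K n)"
        using Kle[of n] a1 by (intro mult_left_mono_neg) (auto simp: Dr_def)
      then have "- \<kappa> * real n \<le> real (K n) * a1 + a2" using elim(1) by (simp add: mult.commute)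
      then show ?thesis by (simp add: a1_def a2_def algebra_simps)
    qed
    also have "\<dots> = c' ^ K n * ((c0 / 2) * G ^ Suc (D * n))"
      using c' c0 G by (simp only: exp_add exp_of_nat_mult exp_ln half_gt_zero mult.assoc)
    also have "\<dots> \<le> c' ^ K n * ((c0 - \<rho> ^ Suc (D * n)) * G ^ Suc (D * n))"
      using c' G rn by (intro mult_left_mono mult_right_mono) auto
    also have "\<dots> \<le> measure M {w \<in> space M. \<forall>\<gamma>'\<in>paths n. wt (\<lambda>z. \<omega> z w) \<gamma>' \<le> wt (\<lambda>z. \<omega> z w) (corner_path n)}"
      using rn c0 by (intro main) linarith
    finally show ?case unfolding Z_def .
  qed
qed

section \<open>Upper bound for paths with many corners\<close>

text \<open>The definition of a corner only speaks of membership; the levels show that its two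
  neighbours are the predecessor and the successor of \<open>x\<close> on \<open>\<gamma>\<close>.
  Exchanging the order of these two steps gives a path that differs from \<open>\<gamma>\<close> in
  one vertex, so optimality compares just two weights.\<close>

lemma corner_flip:
  fixes \<gamma> :: "(int ^ 'd::finite) list"
  assumes \<gamma>: "\<gamma> \<in> paths n" and x: "x \<in> corners \<gamma>"
  shows "\<exists>y. y \<notin> set \<gamma> \<and> level y = level x \<and>
    (\<forall>\<sigma>. (\<forall>\<gamma>'\<in>paths n. wt \<sigma> \<gamma>' \<le> wt \<sigma> \<gamma>) \<longrightarrow> \<sigma> y \<le> \<sigma> x)"
proof -
  obtain i j where ij: "i \<noteq> j" "x \<in> set \<gamma>" "x - axis i 1 \<in> set \<gamma>" "x + axis j 1 \<in> set \<gamma>"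
    using x by (auto simp: corners_def)
  obtain k where k: "k < length \<gamma>" "\<gamma> ! k = x" using ij by (auto simp: in_set_conv_nth)
  obtain l where l: "l < length \<gamma>" "\<gamma> ! l = x - axis i 1" using ij by (auto simp: in_set_conv_nth)
  obtain m where m: "m < length \<gamma>" "\<gamma> ! m = x + axis j 1" using ij by (auto simp: in_set_conv_nth)
  have lk: "level x = int k" using paths_level_nth[OF \<gamma> k(1)] k by simp
  have "int l = int k - 1" using paths_level_nth[OF \<gamma> l(1)] l lk by simp
  then have k1: "k = Suc l" by simp
  have "int m = int k + 1" using paths_level_nth[OF \<gamma> m(1)] m lk by simp
  then have m1: "m = Suc k" by simp
  define y where "y = x - axis i 1 + axis j 1"
  have ly: "level y = level x" by (simp add: y_def)
  have "y \<noteq> x"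
  proof
    assume "y = x"
    then have "axis j 1 = (axis i 1 :: int ^ 'd)" by (simp add: y_def algebra_simps)
    then show False using ij(1) by (simp add: axis_eq_axis)
  qed
  have yn: "y \<notin> set \<gamma>"
  proof
    assume "y \<in> set \<gamma>"
    then obtain a where a: "a < length \<gamma>" "\<gamma> ! a = y" by (auto simp: in_set_conv_nth)
    then have "int a = int k" using paths_level_nth[OF \<gamma> a(1)] ly lk by simp
    then show False using a k \<open>y \<noteq> x\<close> by simp
  qed
  have \<gamma>': "\<gamma>[k := y] \<in> paths n"
  proof -
    have d: "directed_path \<gamma>" and ne: "\<gamma> \<noteq> []" and h: "hd \<gamma> = 0" and la: "last \<gamma> = (\<chi> i. int n)"
      using \<gamma> by (auto simp: paths_def)
    have "\<exists>b. \<gamma>[k := y] ! Suc a - \<gamma>[k := y] ! a = axis b 1" if a: "Suc a < length \<gamma>" for a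
    proof (cases "a = k")
      case True
      then have "\<gamma>[k := y] ! Suc a - \<gamma>[k := y] ! a = axis i 1"
        using a m m1 by (simp add: y_def algebra_simps)
      then show ?thesis by blast
    next
      case ak: False
      show ?thesis
      proof (cases "Suc a = k")
        case True
        then have "\<gamma>[k := y] ! Suc a - \<gamma>[k := y] ! a = axis j 1"
          using a l k1 by (simp add: y_def algebra_simps)
        then show ?thesis by blast
      next
        case False
        then show ?thesis using ak a d by (simp add: directed_path_def successively_conv_nth)
      qed
    qed
    then have "directed_path (\<gamma>[k := y])" by (simp add: directed_path_def successively_conv_nth)
    moreover have "hd (\<gamma>[k := y]) = 0" using h ne k1 by (simp add: hd_conv_nth)
    moreover have "last (\<gamma>[k := y]) = (\<chi> i. int n)" using la ne m m1 by (simp add: last_conv_nth nth_list_update)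
    ultimately show ?thesis using ne by (simp add: paths_def)
  qed
  have "\<sigma> y \<le> \<sigma> x" if "\<forall>\<gamma>'\<in>paths n. wt \<sigma> \<gamma>' \<le> wt \<sigma> \<gamma>" for \<sigma>
  proof -
    have "wt \<sigma> (\<gamma>[k := y]) \<le> wt \<sigma> \<gamma>" using that \<gamma>' by blast
    moreover have "wt \<sigma> (\<gamma>[k := y]) = wt \<sigma> (take k \<gamma>) + \<sigma> y + wt \<sigma> (drop (Suc k) \<gamma>)"
      using k by (simp add: upd_conv_take_nth_drop)
    moreover have "wt \<sigma> \<gamma> = wt \<sigma> (take k \<gamma>) + \<sigma> x + wt \<sigma> (drop (Suc k) \<gamma>)"
      using k id_take_nth_drop[of k \<gamma>] by (metis add.assoc wt_simps(2) wt_simps(3))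
    ultimately show ?thesis by simp
  qed
  then show ?thesis using yn ly by blast
qed

context iid_lattice_field
begin

text \<open>The condition excludes the event that the weight at \<open>x\<close> is at most
  \<open>a\<close> and the one at \<open>y\<close> at least \<open>b\<close>. It has positive
  probability and the exponential is positive, hence \<open>q < 1\<close>. As the pair has the same
  law for all \<open>x \<noteq> y\<close>, one \<open>q\<close> serves all flips.\<close>

lemma pair_exponential_moment:
  assumes t: "integrable N (\<lambda>y. exp (t * y))" and ab: "a < b" "measure N {..a} > 0" "measure N {b..} > 0"
  shows "\<exists>q\<ge>0. q < 1 \<and> (\<forall>x y. x \<noteq> y \<longrightarrow>
    (\<integral>\<^sup>+w. ennreal (exp (t * \<omega> x w)) * indicator {w. \<omega> y w \<le> \<omega> x w} w \<partial>M) \<le> ennreal (q * (\<integral>y. exp (t * y) \<partial>N)))"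
proof -
  define Z where "Z = (\<integral>y. exp (t * y) \<partial>N)"
  \<comment> \<open>The index \<open>True\<close> stands for \<open>x\<close> and
    \<open>False\<close> for \<open>y\<close>, so that the law of the pair becomes a product measure
    over \<open>bool\<close>.\<close>
  define F where "F \<sigma> = ennreal (exp (t * \<sigma> True)) * indicator {\<sigma>. \<sigma> False \<le> \<sigma> True} \<sigma>" for \<sigma> :: "bool \<Rightarrow> real"
  have mF: "F \<in> borel_measurable (PiM UNIV (\<lambda>_. borel))"
  proof -
    have [measurable]: "(\<lambda>\<sigma>. \<sigma> i) \<in> borel_measurable (PiM UNIV (\<lambda>_. borel))" for i :: bool
      by (rule measurable_component_singleton) simp
    have "F = (\<lambda>\<sigma>. if \<sigma> False \<le> \<sigma> True then ennreal (exp (t * \<sigma> True)) else 0)" by (auto simp: F_def fun_eq_iff)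
    then show ?thesis by simp
  qed
  define r where "r = (\<integral>\<^sup>+\<sigma>. F \<sigma> \<partial>PiM UNIV (\<lambda>_. N))"
  have r: "(\<integral>\<^sup>+w. ennreal (exp (t * \<omega> x w)) * indicator {w. \<omega> y w \<le> \<omega> x w} w \<partial>M) = r" if "x \<noteq> y" for x y
  proof -
    have sets: "sets (PiM UNIV (\<lambda>_ :: bool. N)) = sets (PiM UNIV (\<lambda>_. borel))" by (rule sets_PiM_cong) auto
    have m: "(\<lambda>w i. \<omega> (if i then x else y) w) \<in> measurable M (PiM UNIV (\<lambda>_. borel))"
    proof -
      have "(\<lambda>w. \<lambda>i\<in>UNIV. \<omega> (if i then x else y) w) \<in> measurable M (PiM UNIV (\<lambda>_. borel))"
        by (rule measurable_restrict) (rule rv)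
      then show ?thesis by (simp only: restrict_UNIV)
    qed
    have "distr M (PiM UNIV (\<lambda>_. borel)) (\<lambda>w. \<lambda>i\<in>UNIV. \<omega> (if i then x else y) w) = PiM UNIV (\<lambda>_. N)"
      using that by (intro distr_field) (auto simp: inj_on_def)
    then have "r = (\<integral>\<^sup>+\<sigma>. F \<sigma> \<partial>distr M (PiM UNIV (\<lambda>_. borel)) (\<lambda>w i. \<omega> (if i then x else y) w))"
      unfolding r_def by (simp only: restrict_UNIV)
    also have "\<dots> = (\<integral>\<^sup>+w. F (\<lambda>i. \<omega> (if i then x else y) w) \<partial>M)"
      by (rule nn_integral_distr[OF m]) (use mF in simp)
    also have "\<dots> = (\<integral>\<^sup>+w. ennreal (exp (t * \<omega> x w)) * indicator {w. \<omega> y w \<le> \<omega> x w} w \<partial>M)"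
      by (intro nn_integral_cong) (simp add: F_def indicator_def)
    finally show ?thesis by simp
  qed
  have "r < ennreal Z"
  proof -
    let ?x = "0 :: int ^ 'd" and ?y = "diag 1 :: int ^ 'd"
    have xy: "?x \<noteq> ?y" by (simp add: vec_eq_iff diag_def)
    let ?e = "\<lambda>w. ennreal (exp (t * \<omega> ?x w))"
    have Zr: "ennreal Z = r + (\<integral>\<^sup>+w. ?e w * indicator {w. \<omega> ?x w < \<omega> ?y w} w \<partial>M)"
    proof -
      have "ennreal Z = (\<integral>\<^sup>+y. ennreal (exp (t * y)) \<partial>N)"
        unfolding Z_def by (rule nn_integral_eq_integral[OF t, symmetric]) simp
      also have "\<dots> = (\<integral>\<^sup>+w. ?e w \<partial>M)"
        by (rule nn_integral_marginal[symmetric]) measurable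
      also have "\<dots> = (\<integral>\<^sup>+w. ?e w * indicator {w. \<omega> ?y w \<le> \<omega> ?x w} w + ?e w * indicator {w. \<omega> ?x w < \<omega> ?y w} w \<partial>M)"
        by (intro nn_integral_cong) (auto simp: indicator_def)
      also have "\<dots> = (\<integral>\<^sup>+w. ?e w * indicator {w. \<omega> ?y w \<le> \<omega> ?x w} w \<partial>M) + (\<integral>\<^sup>+w. ?e w * indicator {w. \<omega> ?x w < \<omega> ?y w} w \<partial>M)"
        by (rule nn_integral_add) (simp_all add: indicator_def)
      finally show ?thesis using r[OF xy] by simp
    qed
    have "(\<integral>\<^sup>+w. ?e w * indicator {w. \<omega> ?x w < \<omega> ?y w} w \<partial>M) \<noteq> 0"
    proof
      assume "(\<integral>\<^sup>+w. ?e w * indicator {w. \<omega> ?x w < \<omega> ?y w} w \<partial>M) = 0"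
      then have "AE w in M. ?e w * indicator {w. \<omega> ?x w < \<omega> ?y w} w = 0"
        by (subst (asm) nn_integral_0_iff_AE) (auto simp: indicator_def)
      then have ae: "AE w in M. \<not> (\<omega> ?x w < \<omega> ?y w)"
        by eventually_elim (auto simp: indicator_def split: if_splits)
      define X where "X = (\<Inter>z\<in>{?x, ?y}. \<omega> z -` (if z = ?x then {..a} else {b..}) \<inter> space M)"
      have "prob X = (\<Prod>z\<in>{?x, ?y}. prob (\<omega> z -` (if z = ?x then {..a} else {b..}) \<inter> space M))"
        unfolding X_def by (intro indep_varsD[OF indep]) auto
      also have "\<dots> = measure N {..a} * measure N {b..}"
        using xy prob_marginal[of "{..a}" ?x] prob_marginal[of "{b..}" ?y] by (simp add: vimage_def Int_def conj_commute)
      also have "\<dots> > 0" using ab by simp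
      finally have pX: "prob X > 0" .
      have "AE w in M. w \<notin> X" using ae
      proof eventually_elim
        case (elim w)
        then show ?case using ab xy by (auto simp: X_def)
      qed
      moreover have mX: "X \<in> sets M" unfolding X_def by (intro sets.finite_INT) auto
      ultimately have "emeasure M X = 0" by (subst (asm) AE_iff_measurable[OF mX]) (use sets.sets_into_space[OF mX] in auto)
      then show False using pX by (simp add: emeasure_eq_measure)
    qed
    moreover have "r \<noteq> \<infinity>"
    proof
      assume "r = \<infinity>"
      then show False using Zr by simp
    qed
    ultimately show ?thesis unfolding Zr by (metis add.right_neutral ennreal_add_left_cancel_less gr_zeroI infinity_ennreal_def top.not_eq_extremum)
  qed
  then obtain r' where r': "r = ennreal r'" "0 \<le> r'" "r' < Z"
    by (cases r) (auto simp: ennreal_less_iff)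
  show ?thesis
  proof (intro exI[of _ "r' / Z"] conjI allI impI)
    show "0 \<le> r' / Z" "r' / Z < 1" using r' by auto
    fix x y :: "int ^ 'd" assume "x \<noteq> y"
    from r[OF this] show "(\<integral>\<^sup>+w. ennreal (exp (t * \<omega> x w)) * indicator {w. \<omega> y w \<le> \<omega> x w} w \<partial>M) \<le> ennreal (r' / Z * (\<integral>y. exp (t * y) \<partial>N))"
      using r' by (simp add: Z_def[symmetric])
  qed
qed

text \<open>On the event the indicator is at most the exponential Markov factor times the indicators
  of all flip comparisons. This bound is a product over the vertices of \<open>\<gamma>\<close> of
  independent factors: each vertex contributes the moment \<open>Z\<close>, and each corner an
  additional \<open>q\<close>.\<close>

lemma geodesic_upper_bound:
  fixes \<gamma> :: "(int ^ 'd) list"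
  assumes \<gamma>: "\<gamma> \<in> paths n" and t: "t \<ge> 0" "integrable N (\<lambda>y. exp (t * y))" and q: "q \<ge> 0"
    and pair: "\<And>x y. x \<noteq> y \<Longrightarrow>
    (\<integral>\<^sup>+w. ennreal (exp (t * \<omega> x w)) * indicator {w. \<omega> y w \<le> \<omega> x w} w \<partial>M) \<le> ennreal (q * (\<integral>y. exp (t * y) \<partial>N))"
  shows "prob {w \<in> space M. a \<le> wt (\<lambda>z. \<omega> z w) \<gamma> \<and> (\<forall>\<gamma>'\<in>paths n. wt (\<lambda>z. \<omega> z w) \<gamma>' \<le> wt (\<lambda>z. \<omega> z w) \<gamma>)} \<le>
    exp (- t * a) * (\<integral>y. exp (t * y) \<partial>N) ^ length \<gamma> * q ^ card (corners \<gamma>)"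
proof -
  define Z where "Z = (\<integral>y. exp (t * y) \<partial>N)"
  have Z: "Z \<ge> 0" by (simp add: Z_def)
  obtain fl where fl: "\<And>x. x \<in> corners \<gamma> \<Longrightarrow> fl x \<notin> set \<gamma>" "\<And>x. x \<in> corners \<gamma> \<Longrightarrow> level (fl x) = level x"
    "\<And>x \<sigma>. x \<in> corners \<gamma> \<Longrightarrow> (\<forall>\<gamma>'\<in>paths n. wt \<sigma> \<gamma>' \<le> wt \<sigma> \<gamma>) \<Longrightarrow> \<sigma> (fl x) \<le> \<sigma> x"
    using corner_flip[OF \<gamma>] by metis
  have cs: "corners \<gamma> \<subseteq> set \<gamma>" by (auto simp: corners_def)
  have level_inj: "x = y" if "x \<in> set \<gamma>" "y \<in> set \<gamma>" "level x = level y" for x y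
    using that paths_level_nth[OF \<gamma>] by (auto simp: in_set_conv_nth)
  \<comment> \<open>The vertices whose weights enter the factor of \<open>x\<close>. A flip
    preserves the level and \<open>\<gamma>\<close> has one vertex on each level, so these sets are
    disjoint.\<close>
  define K where "K x = (if x \<in> corners \<gamma> then {x, fl x} else {x})" for x
  have dis: "disjoint_family_on K (set \<gamma>)"
    unfolding disjoint_family_on_def
  proof (intro ballI impI)
    fix x y assume xy: "x \<in> set \<gamma>" "y \<in> set \<gamma>" "x \<noteq> y"
    have "level z = level u" if "z \<in> K u" for z u using that fl(2) by (auto simp: K_def split: if_splits)
    then show "K x \<inter> K y = {}" using level_inj[OF xy(1,2)] xy(3) by (metis disjoint_iff)
  qed
  define h where "h x \<sigma> = ennreal (exp (t * \<sigma> x)) * (if x \<in> corners \<gamma> then indicator {\<sigma>. \<sigma> (fl x) \<le> \<sigma> x} \<sigma> else 1)"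
    for x and \<sigma> :: "int ^ 'd \<Rightarrow> real"
  have mh: "h x \<in> borel_measurable (PiM (K x) (\<lambda>_. borel))" for x
  proof -
    have [measurable]: "(\<lambda>\<sigma>. \<sigma> x) \<in> borel_measurable (PiM (K x) (\<lambda>_. borel))"
      by (rule measurable_component_singleton) (simp add: K_def)
    show ?thesis
    proof (cases "x \<in> corners \<gamma>")
      case True
      have [measurable]: "(\<lambda>\<sigma>. \<sigma> (fl x)) \<in> borel_measurable (PiM (K x) (\<lambda>_. borel))"
        using True by (intro measurable_component_singleton) (simp add: K_def)
      have "h x = (\<lambda>\<sigma>. if \<sigma> (fl x) \<le> \<sigma> x then ennreal (exp (t * \<sigma> x)) else 0)"
        using True by (auto simp: h_def fun_eq_iff)
      then show ?thesis by simp
    next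
      case False
      then have "h x = (\<lambda>\<sigma>. ennreal (exp (t * \<sigma> x)))" by (simp add: h_def fun_eq_iff)
      then show ?thesis by simp
    qed
  qed
  have "indep_vars (\<lambda>x. PiM (K x) (\<lambda>_. borel)) (\<lambda>x w. restrict (\<lambda>z. \<omega> z w) (K x)) (set \<gamma>)"
    by (rule indep_vars_restrict[OF indep _ dis]) simp
  then have "indep_vars (\<lambda>_. borel) (\<lambda>x w. h x (restrict (\<lambda>z. \<omega> z w) (K x))) (set \<gamma>)"
    by (rule indep_vars_compose2) (rule mh)
  moreover have "h x (restrict (\<lambda>z. \<omega> z w) (K x)) = h x (\<lambda>z. \<omega> z w)" for x w
    by (simp add: h_def K_def indicator_def)
  ultimately have ind: "indep_vars (\<lambda>_. borel) (\<lambda>x w. h x (\<lambda>z. \<omega> z w)) (set \<gamma>)" by simp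
  have hx: "(\<integral>\<^sup>+w. h x (\<lambda>z. \<omega> z w) \<partial>M) \<le> ennreal (Z * (if x \<in> corners \<gamma> then q else 1))" if "x \<in> set \<gamma>" for x
  proof (cases "x \<in> corners \<gamma>")
    case True
    then have "x \<noteq> fl x" using fl(1) that by metis
    have "(\<integral>\<^sup>+w. h x (\<lambda>z. \<omega> z w) \<partial>M) = (\<integral>\<^sup>+w. ennreal (exp (t * \<omega> x w)) * indicator {w. \<omega> (fl x) w \<le> \<omega> x w} w \<partial>M)"
      using True by (intro nn_integral_cong) (simp add: h_def indicator_def)
    then show ?thesis using pair[OF \<open>x \<noteq> fl x\<close>] True by (simp add: Z_def mult.commute)
  next
    case False
    have "(\<integral>\<^sup>+w. h x (\<lambda>z. \<omega> z w) \<partial>M) = (\<integral>\<^sup>+w. ennreal (exp (t * \<omega> x w)) \<partial>M)"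
      using False by (simp add: h_def)
    also have "\<dots> = (\<integral>\<^sup>+y. ennreal (exp (t * y)) \<partial>N)" by (rule nn_integral_marginal) measurable
    also have "\<dots> = ennreal Z" unfolding Z_def by (rule nn_integral_eq_integral[OF t(2)]) simp
    finally show ?thesis using False by simp
  qed
  let ?E = "{w \<in> space M. a \<le> wt (\<lambda>z. \<omega> z w) \<gamma> \<and> (\<forall>\<gamma>'\<in>paths n. wt (\<lambda>z. \<omega> z w) \<gamma>' \<le> wt (\<lambda>z. \<omega> z w) \<gamma>)}"
  have mE: "?E \<in> sets M"
  proof -
    have "{w \<in> space M. \<forall>\<gamma>'\<in>paths n. wt (\<lambda>z. \<omega> z w) \<gamma>' \<le> wt (\<lambda>z. \<omega> z w) \<gamma>} \<in> sets M"
      by (intro sets.sets_Collect_finite_All finite_paths) measurable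
    then show ?thesis by (intro sets.sets_Collect_conj) measurable
  qed
  have "emeasure M ?E = (\<integral>\<^sup>+w. indicator ?E w \<partial>M)" using mE by simp
  also have "\<dots> \<le> (\<integral>\<^sup>+w. ennreal (exp (- t * a)) * (\<Prod>x\<in>set \<gamma>. h x (\<lambda>z. \<omega> z w)) \<partial>M)"
  proof (rule nn_integral_mono)
    fix w
    show "indicator ?E w \<le> ennreal (exp (- t * a)) * (\<Prod>x\<in>set \<gamma>. h x (\<lambda>z. \<omega> z w))"
    proof (cases "w \<in> ?E")
      case True
      let ?\<sigma> = "\<lambda>z. \<omega> z w"
      have "h x ?\<sigma> = ennreal (exp (t * \<omega> x w))" for x
        using fl(3)[of x ?\<sigma>] True by (auto simp: h_def)
      then have "(\<Prod>x\<in>set \<gamma>. h x ?\<sigma>) = ennreal (exp (t * wt ?\<sigma> \<gamma>))"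
        by (simp add: prod_ennreal exp_sum[symmetric] sum_distrib_left[symmetric] wt_distinct[OF paths_distinct[OF \<gamma>]])
      then have "ennreal (exp (- t * a)) * (\<Prod>x\<in>set \<gamma>. h x ?\<sigma>) = ennreal (exp (t * (wt ?\<sigma> \<gamma> - a)))"
        by (simp add: ennreal_mult[symmetric] exp_add[symmetric] algebra_simps)
      moreover have "1 \<le> exp (t * (wt ?\<sigma> \<gamma> - a))" using True t(1) by simp
      ultimately show ?thesis using True by (simp add: ennreal_leI flip: ennreal_1)
    qed simp
  qed
  also have "\<dots> = ennreal (exp (- t * a)) * (\<integral>\<^sup>+w. (\<Prod>x\<in>set \<gamma>. h x (\<lambda>z. \<omega> z w)) \<partial>M)"
    using ind by (intro nn_integral_cmult borel_measurable_prod_ennreal) (auto simp: indep_vars_def)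
  also have "(\<integral>\<^sup>+w. (\<Prod>x\<in>set \<gamma>. h x (\<lambda>z. \<omega> z w)) \<partial>M) = (\<Prod>x\<in>set \<gamma>. \<integral>\<^sup>+w. h x (\<lambda>z. \<omega> z w) \<partial>M)"
    by (rule indep_vars_nn_integral[OF _ ind]) auto
  also have "ennreal (exp (- t * a)) * \<dots> \<le> ennreal (exp (- t * a)) * (\<Prod>x\<in>set \<gamma>. ennreal (Z * (if x \<in> corners \<gamma> then q else 1)))"
    by (intro mult_left_mono prod_mono_ennreal hx) auto
  also have "(\<Prod>x\<in>set \<gamma>. ennreal (Z * (if x \<in> corners \<gamma> then q else 1))) = ennreal (\<Prod>x\<in>set \<gamma>. Z * (if x \<in> corners \<gamma> then q else 1))"
    using Z q by (intro prod_ennreal) auto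
  also have "(\<Prod>x\<in>set \<gamma>. Z * (if x \<in> corners \<gamma> then q else 1)) = Z ^ length \<gamma> * q ^ card (corners \<gamma>)"
    using cs paths_distinct[OF \<gamma>] by (simp add: prod.distrib distinct_card prod.If_cases Int_absorb1)
  also have "ennreal (exp (- t * a)) * ennreal (Z ^ length \<gamma> * q ^ card (corners \<gamma>)) = ennreal (exp (- t * a) * Z ^ length \<gamma> * q ^ card (corners \<gamma>))"
    using Z q by (simp add: ennreal_mult[symmetric] mult.assoc)
  finally have "ennreal (prob ?E) \<le> ennreal (exp (- t * a) * Z ^ length \<gamma> * q ^ card (corners \<gamma>))"
    by (simp add: emeasure_eq_measure)
  then show ?thesis using Z q by (subst (asm) ennreal_le_iff) (auto simp: Z_def)
qed

end

section \<open>Moment generating functions\<close>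

lemma abs_exp_minus_1_le: "\<bar>exp x - 1\<bar> \<le> \<bar>x\<bar> * exp \<bar>x :: real\<bar>"
proof -
  obtain z where z: "\<bar>z\<bar> \<le> \<bar>x\<bar>" "exp x = (\<Sum>m<1. x ^ m / fact m) + exp z / fact 1 * x ^ 1"
    using Maclaurin_exp_le[of x 1] by blast
  have "\<bar>exp x - 1\<bar> = exp z * \<bar>x\<bar>" using z(2) by (simp add: abs_mult)
  also have "\<dots> \<le> exp \<bar>x\<bar> * \<bar>x\<bar>" using z(1) by (intro mult_right_mono) auto
  finally show ?thesis by (simp add: mult.commute)
qed

lemma abs_exp_minus_1_minus_le: "\<bar>exp x - 1 - x\<bar> \<le> x\<^sup>2 * exp \<bar>x :: real\<bar>"
proof -
  obtain z where z: "\<bar>z\<bar> \<le> \<bar>x\<bar>" "exp x = (\<Sum>m<2. x ^ m / fact m) + exp z / fact 2 * x ^ 2"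
    using Maclaurin_exp_le[of x 2] by blast
  have "\<bar>exp x - 1 - x\<bar> = exp z / 2 * x\<^sup>2" using z(2) by (simp add: numeral_2_eq_2 abs_mult)
  also have "\<dots> \<le> exp \<bar>x\<bar> * x\<^sup>2"
  proof (rule mult_right_mono)
    have "exp z \<le> exp \<bar>x\<bar>" using z(1) by simp
    then show "exp z / 2 \<le> exp \<bar>x\<bar>" using exp_ge_zero[of z] by linarith
  qed simp
  finally show ?thesis by (simp add: mult.commute)
qed

text \<open>A common majorant for the remainders below. The factor \<open>y\<^sup>2\<close> costs
  \<open>exp (s / 2 * \<bar>y\<bar>)\<close>, the increment \<open>h\<close> costs as much again,
  and the result is below one of the exponentials at the ends of the enlarged interval, according to
  the sign of \<open>y\<close>.\<close>

lemma square_exp_le: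
  fixes y u h s a b :: real
  assumes s: "s > 0" and u: "a \<le> u" "u \<le> b" and h: "\<bar>h\<bar> \<le> s / 2"
  shows "y\<^sup>2 * exp (u * y + \<bar>h * y\<bar>) \<le> 8 / s\<^sup>2 * (exp ((b + s) * y) + exp ((a - s) * y))"
proof -
  have sq: "y\<^sup>2 \<le> 8 / s\<^sup>2 * exp (s / 2 * \<bar>y\<bar>)"
  proof -
    have "1 + s / 2 * \<bar>y\<bar> + (s / 2 * \<bar>y\<bar>)\<^sup>2 / 2 \<le> exp (s / 2 * \<bar>y\<bar>)"
      using s by (intro exp_lower_Taylor_quadratic) simp
    moreover have "0 \<le> s / 2 * \<bar>y\<bar>" using s by simp
    ultimately have "(s / 2 * \<bar>y\<bar>)\<^sup>2 / 2 \<le> exp (s / 2 * \<bar>y\<bar>)" by linarith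
    then have "8 / s\<^sup>2 * ((s / 2 * \<bar>y\<bar>)\<^sup>2 / 2) \<le> 8 / s\<^sup>2 * exp (s / 2 * \<bar>y\<bar>)"
      by (intro mult_left_mono) auto
    moreover have "8 / s\<^sup>2 * ((s / 2 * \<bar>y\<bar>)\<^sup>2 / 2) = y\<^sup>2" using s by (simp add: power2_eq_square field_simps)
    ultimately show ?thesis by simp
  qed
  have ex: "u * y + \<bar>h * y\<bar> + s / 2 * \<bar>y\<bar> \<le> u * y + s * \<bar>y\<bar>"
  proof -
    have "\<bar>h * y\<bar> \<le> s / 2 * \<bar>y\<bar>" unfolding abs_mult using h by (intro mult_right_mono) auto
    then show ?thesis by (simp add: algebra_simps)
  qed
  have "u * y + s * \<bar>y\<bar> \<le> (b + s) * y \<or> u * y + s * \<bar>y\<bar> \<le> (a - s) * y"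
  proof (cases "y \<ge> 0")
    case True
    then have "u * y \<le> b * y" using u by (intro mult_right_mono)
    then show ?thesis using True by (simp add: algebra_simps)
  next
    case False
    then have "u * y \<le> a * y" using u by (intro mult_right_mono_neg) auto
    then show ?thesis using False by (simp add: algebra_simps)
  qed
  then have "exp (u * y + s * \<bar>y\<bar>) \<le> exp ((b + s) * y) \<or> exp (u * y + s * \<bar>y\<bar>) \<le> exp ((a - s) * y)"
    by (simp only: exp_le_cancel_iff)
  then have "exp (u * y + s * \<bar>y\<bar>) \<le> exp ((b + s) * y) + exp ((a - s) * y)"
    using exp_ge_zero[of "(b + s) * y"] exp_ge_zero[of "(a - s) * y"] by linarith
  moreover have "exp (u * y + \<bar>h * y\<bar>) * exp (s / 2 * \<bar>y\<bar>) \<le> exp (u * y + s * \<bar>y\<bar>)"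
    unfolding exp_add[symmetric] using ex by (simp only: exp_le_cancel_iff)
  ultimately have e2: "exp (u * y + \<bar>h * y\<bar>) * exp (s / 2 * \<bar>y\<bar>) \<le> exp ((b + s) * y) + exp ((a - s) * y)"
    by linarith
  have "y\<^sup>2 * exp (u * y + \<bar>h * y\<bar>) \<le> 8 / s\<^sup>2 * exp (s / 2 * \<bar>y\<bar>) * exp (u * y + \<bar>h * y\<bar>)"
    using sq by (intro mult_right_mono) auto
  also have "\<dots> = 8 / s\<^sup>2 * (exp (u * y + \<bar>h * y\<bar>) * exp (s / 2 * \<bar>y\<bar>))" by simp
  also have "\<dots> \<le> 8 / s\<^sup>2 * (exp ((b + s) * y) + exp ((a - s) * y))"
    using e2 by (intro mult_left_mono) auto
  finally show ?thesis .
qed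

lemma integrable_exp_between:
  fixes N :: "real measure"
  assumes "sets N = sets borel" "integrable N (\<lambda>y. exp (p * y))" "integrable N (\<lambda>y. exp (q * y))" "p \<le> u" "u \<le> q"
  shows "integrable N (\<lambda>y. exp (u * y))"
proof (rule Bochner_Integration.integrable_bound)
  have [measurable_cong]: "sets N = sets borel" by (rule assms)
  show "integrable N (\<lambda>y. exp (p * y) + exp (q * y))" using assms by simp
  show "(\<lambda>y. exp (u * y)) \<in> borel_measurable N" by measurable
  show "AE y in N. norm (exp (u * y)) \<le> norm (exp (p * y) + exp (q * y))"
  proof (rule AE_I2)
    fix y :: real
    have "u * y \<le> q * y \<or> u * y \<le> p * y"
      using assms(4,5) by (cases "y \<ge> 0") (auto intro: mult_right_mono mult_right_mono_neg)
    then have "exp (u * y) \<le> exp (q * y) \<or> exp (u * y) \<le> exp (p * y)" by (simp only: exp_le_cancel_iff)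
    then have "exp (u * y) \<le> exp (p * y) + exp (q * y)"
      using exp_ge_zero[of "p * y"] exp_ge_zero[of "q * y"] by linarith
    then show "norm (exp (u * y)) \<le> norm (exp (p * y) + exp (q * y))" by simp
  qed
qed

text \<open>Differentiation under the integral with an explicit remainder
  \<open>h\<^sup>2 * K\<close>, where \<open>K\<close> is the integral of one majorant for the whole
  interval. The same majorant makes \<open>g\<close> locally Lipschitz. The margin \<open>s\<close>
  on both sides gives two-sided derivatives even at the end points.\<close>

lemma DERIV_mgf:
  fixes N :: "real measure" and a b s :: real
  assumes N: "sets N = sets borel" and s: "s > 0"
    and int: "integrable N (\<lambda>y. exp ((a - s) * y))" "integrable N (\<lambda>y. exp ((b + s) * y))"
  defines "Z \<equiv> \<lambda>u. \<integral>y. exp (u * y) \<partial>N" and "g \<equiv> \<lambda>u. \<integral>y. y * exp (u * y) \<partial>N"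
  shows "\<And>u. a \<le> u \<Longrightarrow> u \<le> b \<Longrightarrow> DERIV Z u :> g u" and "continuous_on {a..b} g"
proof -
  have [measurable_cong]: "sets N = sets borel" by (rule N)
  define U where "U y = 8 / s\<^sup>2 * (exp ((b + s) * y) + exp ((a - s) * y))" for y
  have U: "integrable N U" unfolding U_def using int by simp
  define K where "K = (\<integral>y. U y \<partial>N)"
  have U0: "U y \<ge> 0" for y using s by (simp add: U_def)
  have intE: "integrable N (\<lambda>y. exp (u * y))" if "a - s \<le> u" "u \<le> b + s" for u
    by (rule integrable_exp_between[OF N int that])
  have intY: "integrable N (\<lambda>y. y * exp (u * y))" if u: "a \<le> u" "u \<le> b" for u
  proof (rule Bochner_Integration.integrable_bound)
    show "integrable N (\<lambda>y. exp (u * y) + U y)" using U intE[of u] u s by simp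
    show "(\<lambda>y. y * exp (u * y)) \<in> borel_measurable N" by measurable
    show "AE y in N. norm (y * exp (u * y)) \<le> norm (exp (u * y) + U y)"
    proof (rule AE_I2)
      fix y :: real
      have "0 \<le> (\<bar>y\<bar> - 1)\<^sup>2" by (rule zero_le_power2)
      then have "0 \<le> y\<^sup>2 + 1 - 2 * \<bar>y\<bar>" by (simp add: power2_diff)
      then have "\<bar>y\<bar> \<le> 1 + y\<^sup>2" using abs_ge_zero[of y] by linarith
      then have "\<bar>y\<bar> * exp (u * y) \<le> (1 + y\<^sup>2) * exp (u * y)" by (intro mult_right_mono) auto
      also have "\<dots> = exp (u * y) + y\<^sup>2 * exp (u * y + \<bar>0 * y\<bar>)" by (simp add: distrib_right)
      also have "\<dots> \<le> exp (u * y) + U y" unfolding U_def using u s by (intro add_left_mono square_exp_le) auto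
      finally show "norm (y * exp (u * y)) \<le> norm (exp (u * y) + U y)" using U0[of y] by (simp add: abs_mult)
    qed
  qed
  have Zb: "\<bar>Z (u + h) - Z u - h * g u\<bar> \<le> h\<^sup>2 * K" if u: "a \<le> u" "u \<le> b" and h: "\<bar>h\<bar> \<le> s / 2" for u h
  proof -
    have i1: "integrable N (\<lambda>y. exp ((u + h) * y))" using u h s by (intro intE) auto
    have i2: "integrable N (\<lambda>y. exp (u * y))" using u s by (intro intE) auto
    have "Z (u + h) - Z u - h * g u = (\<integral>y. exp ((u + h) * y) - exp (u * y) - h * (y * exp (u * y)) \<partial>N)"
      unfolding Z_def g_def using i1 i2 intY[OF u] by simp
    also have "\<bar>\<dots>\<bar> \<le> (\<integral>y. h\<^sup>2 * U y \<partial>N)"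
    proof (rule order_trans[OF integral_abs_bound integral_mono'])
      show "integrable N (\<lambda>y. h\<^sup>2 * U y)" using U by simp
      fix y :: real
      have "exp ((u + h) * y) - exp (u * y) - h * (y * exp (u * y)) = exp (u * y) * (exp (h * y) - 1 - h * y)"
        by (simp add: algebra_simps exp_add)
      then have "\<bar>exp ((u + h) * y) - exp (u * y) - h * (y * exp (u * y))\<bar> = exp (u * y) * \<bar>exp (h * y) - 1 - h * y\<bar>"
        by (simp add: abs_mult)
      also have "\<dots> \<le> exp (u * y) * ((h * y)\<^sup>2 * exp \<bar>h * y\<bar>)"
        by (intro mult_left_mono abs_exp_minus_1_minus_le) auto
      also have "\<dots> = h\<^sup>2 * (y\<^sup>2 * exp (u * y + \<bar>h * y\<bar>))" by (simp add: power_mult_distrib exp_add)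
      also have "\<dots> \<le> h\<^sup>2 * U y" unfolding U_def using u s h by (intro mult_left_mono square_exp_le) auto
      finally show "\<bar>exp ((u + h) * y) - exp (u * y) - h * (y * exp (u * y))\<bar> \<le> h\<^sup>2 * U y" .
      show "0 \<le> h\<^sup>2 * U y" using U0[of y] by simp
    qed
    also have "\<dots> = h\<^sup>2 * K" by (simp add: K_def)
    finally show ?thesis .
  qed
  have gb: "\<bar>g v - g u\<bar> \<le> \<bar>v - u\<bar> * K" if u: "a \<le> u" "u \<le> b" "a \<le> v" "v \<le> b" and h: "\<bar>v - u\<bar> \<le> s / 2" for u v
  proof -
    define h where "h = v - u"
    have "g v - g u = (\<integral>y. y * exp (v * y) - y * exp (u * y) \<partial>N)"
      unfolding g_def using intY u by simp
    also have "\<bar>\<dots>\<bar> \<le> (\<integral>y. \<bar>h\<bar> * U y \<partial>N)"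
    proof (rule order_trans[OF integral_abs_bound integral_mono'])
      show "integrable N (\<lambda>y. \<bar>h\<bar> * U y)" using U by simp
      fix y :: real
      have "y * exp (v * y) - y * exp (u * y) = y * exp (u * y) * (exp (h * y) - 1)"
        by (simp add: h_def algebra_simps flip: exp_add)
      then have "\<bar>y * exp (v * y) - y * exp (u * y)\<bar> = \<bar>y\<bar> * exp (u * y) * \<bar>exp (h * y) - 1\<bar>"
        by (simp add: abs_mult)
      also have "\<dots> \<le> \<bar>y\<bar> * exp (u * y) * (\<bar>h * y\<bar> * exp \<bar>h * y\<bar>)"
        by (intro mult_left_mono abs_exp_minus_1_le) auto
      also have "\<dots> = \<bar>h\<bar> * (y\<^sup>2 * exp (u * y + \<bar>h * y\<bar>))"
      proof -
        have "y\<^sup>2 = \<bar>y\<bar> * \<bar>y\<bar>" by (simp add: power2_eq_square)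
        then show ?thesis unfolding exp_add abs_mult by (simp only: mult_ac)
      qed
      also have "\<dots> \<le> \<bar>h\<bar> * U y" unfolding U_def using u s that(5) by (intro mult_left_mono square_exp_le) (auto simp: h_def)
      finally show "\<bar>y * exp (v * y) - y * exp (u * y)\<bar> \<le> \<bar>h\<bar> * U y" .
      show "0 \<le> \<bar>h\<bar> * U y" using U0[of y] by simp
    qed
    also have "\<dots> = \<bar>v - u\<bar> * K" by (simp add: K_def h_def)
    finally show ?thesis .
  qed
  show "DERIV Z u :> g u" if u: "a \<le> u" "u \<le> b" for u
    unfolding DERIV_def
  proof (rule LIM_zero_cancel, rule Lim_null_comparison)
    have "\<forall>\<^sub>F h in at 0. \<bar>h\<bar> < s / 2 \<and> h \<noteq> (0 :: real)"
      unfolding eventually_at using s by (auto intro!: exI[of _ "s / 2"] simp: dist_real_def)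
    then show "\<forall>\<^sub>F h in at 0. norm ((Z (u + h) - Z u) / h - g u) \<le> \<bar>h\<bar> * K"
    proof eventually_elim
      case (elim h)
      then have "\<bar>(Z (u + h) - Z u) / h - g u\<bar> = \<bar>Z (u + h) - Z u - h * g u\<bar> / \<bar>h\<bar>"
        by (simp add: field_simps flip: abs_divide)
      also have "\<dots> \<le> h\<^sup>2 * K / \<bar>h\<bar>" using elim Zb[OF u, of h] by (intro divide_right_mono) auto
      also have "h\<^sup>2 = \<bar>h\<bar> * \<bar>h\<bar>" by (simp add: power2_eq_square)
      also have "\<bar>h\<bar> * \<bar>h\<bar> * K / \<bar>h\<bar> = \<bar>h\<bar> * K"
        unfolding mult.assoc by (rule nonzero_mult_div_cancel_left) (use elim in simp)
      finally show ?case by simp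
    qed
    show "((\<lambda>h. \<bar>h\<bar> * K) \<longlongrightarrow> 0) (at 0)" by (auto intro!: tendsto_eq_intros)
  qed
  show "continuous_on {a..b} g"
    unfolding continuous_on_def
  proof
    fix u assume u: "u \<in> {a..b}"
    show "(g \<longlongrightarrow> g u) (at u within {a..b})"
    proof (rule LIM_zero_cancel, rule Lim_null_comparison)
      have "\<forall>\<^sub>F v in at u within {a..b}. \<bar>v - u\<bar> < s / 2 \<and> v \<in> {a..b}"
        unfolding eventually_at using s by (auto intro!: exI[of _ "s / 2"] simp: dist_real_def)
      then show "\<forall>\<^sub>F v in at u within {a..b}. norm (g v - g u) \<le> \<bar>v - u\<bar> * K"
        by eventually_elim (use u gb in auto)
      show "((\<lambda>v. \<bar>v - u\<bar> * K) \<longlongrightarrow> 0) (at u within {a..b})" by (auto intro!: tendsto_eq_intros)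
    qed
  qed
qed

text \<open>For convex \<open>L\<close> with derivative \<open>f\<close>, the point \<open>r\<close> minimises \<open>L t - t * \<mu>\<close> over \<open>t \<ge> 0\<close>.\<close>

lemma slope_selection:
  fixes L f :: "real \<Rightarrow> real"
  assumes t1: "t1 \<ge> 0" "f t1 > \<mu>" and L: "continuous_on {0..t1} L" "L 0 = 0" and f: "continuous_on {0..t1} f"
  shows "\<exists>r\<in>{0..t1}. \<forall>k>0. \<exists>t\<in>{0..t1}. f t > \<mu> \<and> L t - t * f t \<ge> L r - r * \<mu> - k"
proof (cases "f 0 > \<mu>")
  case True
  then show ?thesis using t1 L(2) by (auto intro!: bexI[of _ 0])
next
  case False
  \<comment> \<open>\<open>r\<close> is the last point whose slope is at most \<open>\<mu>\<close>,
    and by continuity its slope equals \<open>\<mu>\<close>. The tilt \<open>t\<close> is taken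
    slightly to the right of \<open>r\<close>: there the slope is strictly above
    \<open>\<mu>\<close>, and \<open>L t - t * f t\<close> has changed by less than
    \<open>k\<close>.\<close>
  define S where "S = {t \<in> {0..t1}. f t \<le> \<mu>}"
  have "S = {0..t1} \<inter> f -` {..\<mu>}" by (auto simp: S_def)
  then have "closed S" using continuous_closed_preimage[OF f closed_atLeastAtMost closed_atMost] by simp
  moreover have "0 \<in> S" using False t1 by (simp add: S_def)
  moreover have bdd: "bdd_above S" by (rule bdd_aboveI[of _ t1]) (simp add: S_def)
  ultimately have rS: "Sup S \<in> S" by (intro closed_contains_Sup) auto
  define r where "r = Sup S"
  have r: "0 \<le> r" "r < t1" "f r \<le> \<mu>" using rS t1 by (auto simp: S_def r_def order.strict_iff_order)
  have above: "f t > \<mu>" if "r < t" "t \<le> t1" for t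
  proof (rule ccontr)
    assume "\<not> f t > \<mu>"
    then have "t \<in> S" using that r by (simp add: S_def)
    then have "t \<le> r" unfolding r_def using bdd by (rule cSup_upper)
    then show False using that by simp
  qed
  define F where "F t = L t - t * f t" for t
  have cF: "continuous_on {0..t1} F" unfolding F_def by (intro continuous_intros L f)
  have lim: "(G \<longlongrightarrow> G r) (at r within {r<..t1})" if "continuous_on {0..t1} G" for G :: "real \<Rightarrow> real"
  proof (rule tendsto_within_subset)
    show "(G \<longlongrightarrow> G r) (at r within {0..t1})" using that r by (auto simp: continuous_on_def)
  qed (use r in auto)
  have nt: "at r within {r<..t1} \<noteq> bot"
  proof -
    have "at r within {r<..t1} = at_right r"
      using r by (intro at_within_nhd[of r "{..<t1}"]) auto
    then show ?thesis by simp
  qed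
  have ev: "\<forall>\<^sub>F t in at r within {r<..t1}. r < t \<and> t \<le> t1" by (auto simp: eventually_at_filter)
  have "f r \<ge> \<mu>"
  proof (rule tendsto_lowerbound[OF lim[OF f] _ nt])
    show "\<forall>\<^sub>F t in at r within {r<..t1}. \<mu> \<le> f t" using ev by eventually_elim (use above in force)
  qed
  then have fr: "f r = \<mu>" using r by simp
  show ?thesis
  proof (rule bexI[of _ r], intro allI impI)
    fix k :: real assume "k > 0"
    then have "\<forall>\<^sub>F t in at r within {r<..t1}. F r - k < F t" by (intro order_tendstoD(1)[OF lim[OF cF]]) simp
    with ev have "\<forall>\<^sub>F t in at r within {r<..t1}. F r - k < F t \<and> r < t \<and> t \<le> t1" by eventually_elim auto
    then obtain t where t: "F r - k < F t" "r < t" "t \<le> t1" using nt eventually_happens' by blast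
    show "\<exists>t\<in>{0..t1}. f t > \<mu> \<and> L t - t * f t \<ge> L r - r * \<mu> - k"
      using t r above[of t] fr by (intro bexI[of _ t]) (auto simp: F_def)
  qed (use r in auto)
qed

text \<open>\<open>L u - A * u\<close> and \<open>B * u - L u\<close> have positive derivatives at
  \<open>t\<close>. Comparing their values at \<open>t\<close> with those at \<open>t - h\<close>
  and \<open>t + h\<close> and taking exponentials gives the two Chernoff conditions.\<close>

lemma tilt_window:
  fixes L f Z :: "real \<Rightarrow> real"
  assumes L: "\<And>u. L u = ln (Z u)" and d: "DERIV L t :> f'" and A: "A < f'" and B: "f' < B" and s: "s > 0"
    and pos: "\<And>u. t - s \<le> u \<Longrightarrow> u \<le> t + s \<Longrightarrow> Z u > 0"
  shows "\<exists>h>0. h \<le> s \<and> exp (h * A) * Z (t - h) < Z t \<and> exp (- h * B) * Z (t + h) < Z t"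
proof -
  have dA: "DERIV (\<lambda>u. L u - A * u) t :> f' - A" by (auto intro!: derivative_eq_intros d)
  then obtain d1 where d1: "d1 > 0" "\<And>h. 0 < h \<Longrightarrow> h < d1 \<Longrightarrow> L (t - h) - A * (t - h) < L t - A * t"
    using DERIV_pos_inc_left[OF dA] A by auto
  have dB: "DERIV (\<lambda>u. B * u - L u) t :> B - f'" by (auto intro!: derivative_eq_intros d)
  then obtain d2 where d2: "d2 > 0" "\<And>h. 0 < h \<Longrightarrow> h < d2 \<Longrightarrow> B * t - L t < B * (t + h) - L (t + h)"
    using DERIV_pos_inc_right[OF dB] B by auto
  define h where "h = min s (min d1 d2 / 2)"
  have h: "h > 0" "h \<le> s" "h < d1" "h < d2" using s d1(1) d2(1) by (auto simp: h_def min_def)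
  have Z: "Z (t - h) > 0" "Z t > 0" "Z (t + h) > 0" using h s by (auto intro!: pos)
  have "h * A + ln (Z (t - h)) < ln (Z t)" using d1(2)[OF h(1,3)] by (simp add: L algebra_simps)
  then have "exp (h * A + ln (Z (t - h))) < exp (ln (Z t))" by simp
  then have 1: "exp (h * A) * Z (t - h) < Z t" using Z by (simp add: exp_add)
  have "- h * B + ln (Z (t + h)) < ln (Z t)" using d2(2)[OF h(1,4)] by (simp add: L algebra_simps)
  then have "exp (- h * B + ln (Z (t + h))) < exp (ln (Z t))" by simp
  then have 2: "exp (- h * B) * Z (t + h) < Z t" using Z unfolding exp_add by simp
  show ?thesis using h 1 2 by blast
qed

text \<open>If \<open>y < A\<close> held almost surely, then
  \<open>exp (t * y) \<le> exp (h * A) * exp ((t - h) * y)\<close>, contrary to the tilt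
  condition.\<close>

lemma tilt_imp_mass:
  fixes N :: "real measure"
  assumes N: "prob_space N" "sets N = sets borel"
    and int: "integrable N (\<lambda>y. exp ((t - h) * y))" "integrable N (\<lambda>y. exp (t * y))" and h: "h > 0"
    and A: "exp (h * A) * (\<integral>y. exp ((t - h) * y) \<partial>N) < (\<integral>y. exp (t * y) \<partial>N)"
  shows "measure N {A..} > 0"
proof (rule ccontr)
  interpret N: prob_space N by (rule N)
  assume "\<not> ?thesis"
  then have "measure N {A..} = 0" using measure_nonneg[of N "{A..}"] by linarith
  then have "AE y in N. y \<notin> {A..}"
    using N(2) by (intro AE_not_in) (simp add: null_sets_def N.emeasure_eq_measure)
  then have "AE y in N. exp (t * y) \<le> exp (h * A) * exp ((t - h) * y)"
  proof eventually_elim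
    case (elim y)
    then have "h * y \<le> h * A" using h by simp
    then show ?case by (simp add: left_diff_distrib flip: exp_add)
  qed
  then have "(\<integral>y. exp (t * y) \<partial>N) \<le> (\<integral>y. exp (h * A) * exp ((t - h) * y) \<partial>N)"
    using int by (intro integral_mono_AE) auto
  then show False using A by simp
qed

section \<open>The time constant\<close>

lemma (in prob_space) AE_limit_imp_prob:
  fixes X :: "nat \<Rightarrow> 'a \<Rightarrow> real"
  assumes m[measurable]: "\<And>n. X n \<in> borel_measurable M" and lim: "AE w in M. (\<lambda>n. X n w) \<longlonglongrightarrow> l"
  shows "a > l \<Longrightarrow> (\<lambda>n. prob {w \<in> space M. X n w > a}) \<longlonglongrightarrow> 0"
    and "a < l \<Longrightarrow> (\<lambda>n. prob {w \<in> space M. X n w < a}) \<longlonglongrightarrow> 0"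
proof -
  have *: "(\<lambda>n. prob (A n)) \<longlonglongrightarrow> 0"
    if A[measurable]: "\<And>n. A n \<in> sets M" and ev: "AE w in M. \<forall>\<^sub>F n in sequentially. w \<notin> A n" for A
  proof -
    have "(\<lambda>n. \<integral>w. indicat_real (A n) w \<partial>M) \<longlonglongrightarrow> (\<integral>w. 0 \<partial>M)"
    proof (rule integral_dominated_convergence[where w = "\<lambda>_. 1"])
      show "AE w in M. (\<lambda>n. indicat_real (A n) w) \<longlonglongrightarrow> 0"
        using ev
      proof eventually_elim
        case (elim w)
        then have "\<forall>\<^sub>F n in sequentially. indicat_real (A n) w = 0" by eventually_elim simp
        then show ?case by (rule tendsto_eventually)
      qed
    qed (auto simp: indicator_def)
    then show ?thesis by simp
  qed
  show "(\<lambda>n. prob {w \<in> space M. X n w > a}) \<longlonglongrightarrow> 0" if "a > l"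
    by (rule *) (measurable, use lim in eventually_elim, use that order_tendstoD(2) in \<open>fastforce elim: eventually_mono\<close>)
  show "(\<lambda>n. prob {w \<in> space M. X n w < a}) \<longlonglongrightarrow> 0" if "a < l"
    by (rule *) (measurable, use lim in eventually_elim, use that order_tendstoD(1) in \<open>fastforce elim: eventually_mono\<close>)
qed

context iid_lattice_field
begin

text \<open>The weight of the origin, counted in \<open>last_passage_time\<close> but not in
  \<open>lpp\<close>, disappears after division by \<open>n\<close>. Clearing the denominator
  requires \<open>n \<ge> 1\<close>, which is enough for a limit.\<close>

lemma lpp_diag_limits:
  assumes lim: "is_time_constant M \<omega> \<mu>"
  shows "c > \<mu> \<Longrightarrow> (\<lambda>n. prob {w \<in> space M. lpp (\<lambda>z. \<omega> z w) 0 (diag n) > c * real CARD('d) * real n}) \<longlonglongrightarrow> 0"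
    and "c < \<mu> \<Longrightarrow> (\<lambda>n. prob {w \<in> space M. lpp (\<lambda>z. \<omega> z w) 0 (diag n) < c * real CARD('d) * real n}) \<longlonglongrightarrow> 0"
proof -
  let ?D = "real CARD('d)"
  let ?X = "\<lambda>n w. lpp (\<lambda>z. \<omega> z w) 0 (diag n) / (?D * real n)"
  have m: "?X n \<in> borel_measurable M" for n by measurable
  have AE: "AE w in M. (\<lambda>n. ?X n w) \<longlonglongrightarrow> \<mu>"
    using lim unfolding is_time_constant_def
  proof eventually_elim
    case (elim w)
    have "(\<lambda>n. \<omega> 0 w / (?D * real n)) \<longlonglongrightarrow> 0"
      by (intro tendsto_divide_0[OF tendsto_const] filterlim_at_top_imp_at_infinity filterlim_tendsto_pos_mult_at_top[OF tendsto_const] filterlim_real_sequentially)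
         (simp add: card_gt_0_iff)
    from tendsto_diff[OF elim this] show ?case
      by (simp add: last_passage_time_lpp add_divide_distrib)
  qed
  have conv: "(\<lambda>n. prob {w \<in> space M. P n w}) \<longlonglongrightarrow> 0"
    if l: "(\<lambda>n. prob {w \<in> space M. Q n w}) \<longlonglongrightarrow> 0" and eq: "\<And>n w. n \<ge> 1 \<Longrightarrow> P n w \<longleftrightarrow> Q n w" for P Q
  proof (rule Lim_transform_eventually[OF l])
    show "\<forall>\<^sub>F n in sequentially. prob {w \<in> space M. Q n w} = prob {w \<in> space M. P n w}"
      using eventually_ge_at_top[of 1] by eventually_elim (simp add: eq)
  qed
  have D: "?D > 0" by (simp add: card_gt_0_iff)
  show "(\<lambda>n. prob {w \<in> space M. lpp (\<lambda>z. \<omega> z w) 0 (diag n) > c * ?D * real n}) \<longlonglongrightarrow> 0" if "c > \<mu>"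
    by (rule conv[OF AE_limit_imp_prob(1)[OF m AE that]]) (use D in \<open>simp add: less_divide_eq mult_ac\<close>)
  show "(\<lambda>n. prob {w \<in> space M. lpp (\<lambda>z. \<omega> z w) 0 (diag n) < c * ?D * real n}) \<longlonglongrightarrow> 0" if "c < \<mu>"
    by (rule conv[OF AE_limit_imp_prob(2)[OF m AE that]]) (use D in \<open>simp add: divide_less_eq mult_ac\<close>)
qed

text \<open>Otherwise all weights exceed \<open>a\<close> almost surely, hence so does their average
  along any path, and the time constant would be at least \<open>a\<close>.\<close>

lemma marginal_mass_above_time_constant:
  assumes lim: "is_time_constant M \<omega> \<mu>" and a: "a > \<mu>"
  shows "measure N {..a} > 0"
proof (rule ccontr)
  interpret N: prob_space N by (rule prob_space_N)
  assume "\<not> ?thesis"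
  then have 0: "measure N {..a} = 0" using measure_nonneg[of N "{..a}"] by linarith
  define c where "c = (\<mu> + a) / 2"
  have c: "\<mu> < c" "c < a" using a by (auto simp: c_def)
  let ?D = "real CARD('d)"
  have D: "?D > 0" by (simp add: card_gt_0_iff)
  have "AE w in M. a < \<omega> z w" for z
  proof -
    have "prob {w \<in> space M. \<omega> z w \<in> {..a}} = 0" using prob_marginal[of "{..a}" z] 0 by simp
    then have "AE w in M. w \<notin> {w \<in> space M. \<omega> z w \<in> {..a}}"
      by (intro AE_not_in) (simp add: null_sets_def emeasure_eq_measure)
    then show ?thesis by (auto simp: not_le)
  qed
  then have ae: "AE w in M. \<forall>z\<in>box_set 0 (diag n) :: (int ^ 'd) set. a < \<omega> z w" for n
    by (intro AE_finite_allI finite_box_set)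
  have one: "prob {w \<in> space M. lpp (\<lambda>z. \<omega> z w) 0 (diag n) > c * ?D * real n} = 1" if "n \<ge> 1" for n
  proof (rule prob_eq_1[THEN iffD2])
    show "AE w in M. w \<in> {w \<in> space M. lpp (\<lambda>z. \<omega> z w) 0 (diag n) > c * ?D * real n}"
      using ae[of n] AE_space
    proof eventually_elim
      case (elim w)
      obtain \<pi> where \<pi>: "steps (0 :: int ^ 'd) \<pi> (diag n)" using steps_exist[of 0 "diag n"] by (auto simp: diag_def)
      have len: "real (length \<pi>) = ?D * real n" using steps_level[OF \<pi>] by (simp flip: of_nat_mult)
      have "c * ?D * real n < a * real (length \<pi>)" using c D that unfolding len by (simp add: mult.assoc)
      also have "\<dots> \<le> wt (\<lambda>z. \<omega> z w) \<pi>"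
      proof (rule wt_ge_const)
        fix z assume "z \<in> set \<pi>"
        then have "z \<in> box_set 0 (diag n)" using steps_box[OF \<pi>] by blast
        then have "a < \<omega> z w" using elim(1) by blast
        then show "a \<le> \<omega> z w" by simp
      qed
      also have "\<dots> \<le> lpp (\<lambda>z. \<omega> z w) 0 (diag n)" by (rule lpp_ge[OF \<pi>])
      finally show ?case using elim(2) by simp
    qed
  qed measurable
  have "(\<lambda>n. prob {w \<in> space M. lpp (\<lambda>z. \<omega> z w) 0 (diag n) > c * ?D * real n}) \<longlonglongrightarrow> 1"
    by (rule tendsto_eventually) (rule eventually_sequentiallyI[OF one])
  with lpp_diag_limits(1)[OF lim c(1)] show False using LIMSEQ_unique by fastforce
qed

text \<open>This is where \<open>\<nu> > 1\<close> enters. The offset \<open>x0\<close> is there for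
  centred weights.\<close>

lemma marginal_superexponential:
  assumes tail: "\<nu> > 1" "c > 0" "\<And>t. t > 0 \<Longrightarrow> measure N {..<- t} < exp (- c * t powr \<nu>)"
  shows "\<forall>\<^sub>F t in at_top. measure N {..<x0 - t} \<le> exp (- R * t)"
proof -
  have "filterlim (\<lambda>t. c * (t - x0) powr \<nu> - R * t) at_top at_top"
    using tail(1,2) by real_asymp
  then have "\<forall>\<^sub>F t in at_top. 0 \<le> c * (t - x0) powr \<nu> - R * t" unfolding filterlim_at_top by (rule spec)
  moreover have "\<forall>\<^sub>F t in at_top. t > x0" by (rule eventually_gt_at_top)
  ultimately show ?thesis
  proof eventually_elim
    case (elim t)
    have "measure N {..<x0 - t} = measure N {..<- (t - x0)}" by simp
    also have "\<dots> \<le> exp (- c * (t - x0) powr \<nu>)" using elim by (intro less_imp_le tail(3)) simp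
    also have "\<dots> \<le> exp (- R * t)" using elim by simp
    finally show ?case .
  qed
qed

text \<open>Subtracting the midpoint \<open>A\<close> of \<open>\<mu> - \<delta>\<close> and
  \<open>\<mu>\<close> leaves weights whose passage time typically grows linearly, so the event
  becomes that of a negative passage time. The other half of \<open>\<delta>\<close> pays for the
  weight of the origin.\<close>

lemma last_passage_lower_tail:
  fixes \<delta> R :: real
  assumes dim: "CARD('d) \<ge> 2" and lim: "is_time_constant M \<omega> \<mu>" and \<delta>: "\<delta> > 0"
    and tail: "\<nu> > 1" "c > 0" "\<And>t. t > 0 \<Longrightarrow> measure N {..<- t} < exp (- c * t powr \<nu>)"
    and s0: "s0 > 0" "integrable N (\<lambda>y. exp (- s0 * y))"
  shows "\<forall>\<^sub>F n in sequentially.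
    prob {w \<in> space M. \<omega> 0 w + lpp (\<lambda>z. \<omega> z w) 0 (diag n) < (\<mu> - \<delta>) * real CARD('d) * real n} \<le> exp (- R * real n)"
proof -
  let ?D = "real CARD('d)"
  have D: "?D > 0" by (simp add: card_gt_0_iff)
  define A where "A = \<mu> - \<delta> / 2"
  define N' where "N' = distr N borel (\<lambda>y. y - A)"
  interpret S: iid_lattice_field M "\<lambda>x w. \<omega> x w - A" N' unfolding N'_def by (rule diff_const)
  have m: "(\<lambda>y. y - A) \<in> measurable N borel" by measurable
  have eq: "lpp (\<lambda>z. \<omega> z w - A) 0 (diag n) = lpp (\<lambda>z. \<omega> z w) 0 (diag n) - A * ?D * real n" for w n
    by (subst lpp_diff_const) (auto simp: diag_def level_diag[unfolded diag_def])
  define \<delta>1 where "\<delta>1 = \<delta> / 4 * ?D"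
  have \<delta>1: "\<delta>1 > 0" using \<delta> D by (simp add: \<delta>1_def)
  have "\<mu> - \<delta> / 4 < \<mu>" using \<delta> by simp
  note lpp_diag_limits(2)[OF lim this]
  moreover have "lpp (\<lambda>z. \<omega> z w - A) 0 (diag n) < \<delta>1 * real n \<longleftrightarrow> lpp (\<lambda>z. \<omega> z w) 0 (diag n) < (\<mu> - \<delta> / 4) * ?D * real n" for w n
  proof -
    have "A * ?D * real n + \<delta>1 * real n = (\<mu> - \<delta> / 4) * ?D * real n"
      by (simp add: A_def \<delta>1_def field_simps)
    then show ?thesis unfolding eq by linarith
  qed
  ultimately have H1: "(\<lambda>n. prob {w \<in> space M. lpp (\<lambda>z. \<omega> z w - A) 0 (diag n) < \<delta>1 * real n}) \<longlonglongrightarrow> 0" by simp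
  have H2: "integrable N' (\<lambda>y. exp (- s0 * y))"
  proof -
    have "integrable N (\<lambda>y. exp (s0 * A) * exp (- s0 * y))" using s0(2) by simp
    then have "integrable N (\<lambda>y. exp (- s0 * (y - A)))" by (simp add: algebra_simps flip: exp_add)
    then show ?thesis unfolding N'_def by (subst integrable_distr_eq[OF m]) auto
  qed
  have H3: "\<forall>\<^sub>F t in at_top. measure N' {..<- t} \<le> exp (- r * t)" for r
  proof -
    have "measure N' {..<- t} = measure N {..<A - t}" for t
    proof -
      have "measure N' {..<- t} = measure N ((\<lambda>y. y - A) -` {..<- t} \<inter> space N)"
        unfolding N'_def by (rule measure_distr[OF m]) simp
      also have "(\<lambda>y. y - A) -` {..<- t} \<inter> space N = {..<A - t}" by auto
      finally show ?thesis .
    qed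
    then show ?thesis using marginal_superexponential[OF tail, of A r] by simp
  qed
  \<comment> \<open>The additional unit of rate beats the factor 2 of the union bound as soon as
    \<open>n \<ge> 1\<close>.\<close>
  define R1 where "R1 = R + 1"
  have ev1: "\<forall>\<^sub>F n in sequentially. prob {w \<in> space M. lpp (\<lambda>z. \<omega> z w - A) 0 (diag n) < 0} \<le> exp (- R1 * real n)"
    by (rule S.lower_tail_superexponential[OF dim \<delta>1 H1 s0(1) H2 H3])
  define \<delta>2 where "\<delta>2 = \<delta> / 2 * ?D"
  have \<delta>2: "\<delta>2 > 0" using \<delta> D by (simp add: \<delta>2_def)
  have "filterlim (\<lambda>n. \<delta>2 * real n) at_top sequentially" using \<delta>2 by real_asymp
  from eventually_compose_filterlim[OF marginal_superexponential[OF tail, of 0 "R1 / \<delta>2"] this]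
  have ev2: "\<forall>\<^sub>F n in sequentially. measure N {..<- (\<delta>2 * real n)} \<le> exp (- R1 * real n)"
    using \<delta>2 by simp
  show ?thesis using ev1 ev2 eventually_ge_at_top[of 1]
  proof eventually_elim
    case (elim n)
    have "prob {w \<in> space M. \<omega> 0 w + lpp (\<lambda>z. \<omega> z w) 0 (diag n) < (\<mu> - \<delta>) * ?D * real n} \<le>
       prob ({w \<in> space M. lpp (\<lambda>z. \<omega> z w - A) 0 (diag n) < 0} \<union> {w \<in> space M. \<omega> 0 w \<in> {..<- (\<delta>2 * real n)}})"
    proof (rule finite_measure_mono)
      have "A * ?D * real n - \<delta>2 * real n = (\<mu> - \<delta>) * ?D * real n"
        by (simp add: A_def \<delta>2_def field_simps)
      then show "{w \<in> space M. \<omega> 0 w + lpp (\<lambda>z. \<omega> z w) 0 (diag n) < (\<mu> - \<delta>) * ?D * real n} \<subseteq>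
         {w \<in> space M. lpp (\<lambda>z. \<omega> z w - A) 0 (diag n) < 0} \<union> {w \<in> space M. \<omega> 0 w \<in> {..<- (\<delta>2 * real n)}}"
        unfolding eq by auto
    qed measurable
    also have "\<dots> \<le> prob {w \<in> space M. lpp (\<lambda>z. \<omega> z w - A) 0 (diag n) < 0} + prob {w \<in> space M. \<omega> 0 w \<in> {..<- (\<delta>2 * real n)}}"
      by (rule measure_Un_le) measurable
    also have "\<dots> \<le> exp (- R1 * real n) + exp (- R1 * real n)"
      using elim prob_marginal[of "{..<- (\<delta>2 * real n)}" 0] by simp
    also have "exp (- R1 * real n) = exp (- real n) * exp (- R * real n)"
      unfolding exp_add[symmetric] R1_def by (simp add: algebra_simps)
    also have "exp (- real n) * exp (- R * real n) + exp (- real n) * exp (- R * real n) = 2 * exp (- real n) * exp (- R * real n)"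
      by simp
    also have "\<dots> \<le> 1 * exp (- R * real n)"
    proof (rule mult_right_mono)
      have "2 \<le> exp (real n)" using exp_ge_add_one_self[of "real n"] elim(3) by linarith
      then show "2 * exp (- real n) \<le> 1" by (simp add: exp_minus field_simps)
    qed simp
    finally show ?case by simp
  qed
qed

end

text \<open>The budget: more than \<open>\<epsilon> * n\<close> corners lower the exponent of the
  upper bound by \<open>e0 * n\<close>. A quarter of this pays for the deviation
  \<open>\<delta>\<close> of the passage time, a quarter for the losses in the lower bound, and the
  remaining half gives the exponential decay of the quotient.\<close>

theorem theorem1:
  fixes M :: "'a measure"
    and \<omega> :: "int ^ 'd::{finite,linorder} \<Rightarrow> 'a \<Rightarrow> real"
    and \<mu> \<epsilon> :: real
  assumes dim: "CARD('d) \<ge> 2"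
    and prob: "prob_space M"
    and indep: "prob_space.indep_vars M (\<lambda>_. borel) \<omega> UNIV"
    and ident: "\<And>x y. distr M borel (\<omega> x) = distr M borel (\<omega> y)"
    and lower_tail: "\<exists>\<nu>>1. \<exists>c>0. \<forall>x. \<forall>t>0.
          measure M {w \<in> space M. \<omega> x w < - t} < exp (- c * t powr \<nu>)"
    and cgf_finite: "\<And>x. \<exists>a b. a < 0 \<and> 0 < b \<and> {a<..<b} \<subseteq> cgf_domain M (\<omega> x)"
    and time_constant: "is_time_constant M \<omega> \<mu>"
    and slope: "\<And>x. ereal \<mu> < sup_cgf_deriv M (\<omega> x)"
    and eps: "\<epsilon> > 0"
  shows "\<exists>C>0. \<forall>\<^sub>F n in sequentially. \<forall>\<gamma> \<in> paths n. real (card (corners \<gamma>)) > \<epsilon> * real n \<longrightarrow>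
           measure M {w \<in> space M. \<gamma> \<in> geodesics \<omega> n w} /
           measure M {w \<in> space M. corner_path n \<in> geodesics \<omega> n w} \<le> C * exp (- real n / C)"
proof -
  define N where "N = distr M borel (\<omega> 0)"
  define D where "D = real CARD('d)"
  have D: "D > 0" by (simp add: D_def card_gt_0_iff)
  have iid: "iid_lattice_field M \<omega> N"
    unfolding iid_lattice_field_def iid_field_def iid_field_axioms_def N_def using prob indep ident by blast
  interpret F: iid_lattice_field M \<omega> N by (rule iid)
  interpret N: prob_space N by (rule F.prob_space_N)
  obtain \<nu> c where tail0: "\<nu> > 1" "c > 0" "\<And>x t. t > 0 \<Longrightarrow> measure M {w \<in> space M. \<omega> x w < - t} < exp (- c * t powr \<nu>)"
    using lower_tail by blast
  have tail: "measure N {..<- t} < exp (- c * t powr \<nu>)" if "t > 0" for t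
    using tail0(3)[OF that, of 0] F.prob_marginal[of "{..<- t}" 0] by simp

  have int_iff: "integrable M (\<lambda>w. exp (u * \<omega> 0 w)) \<longleftrightarrow> integrable N (\<lambda>y. exp (u * y))" for u
    unfolding N_def by (subst integrable_distr_eq) auto
  define Z where "Z u = (\<integral>y. exp (u * y) \<partial>N)" for u
  define L where "L u = ln (Z u)" for u
  have cgfL: "cgf M (\<omega> 0) = L"
  proof
    fix u
    have "Z u = (\<integral>w. exp (u * \<omega> 0 w) \<partial>M)" unfolding Z_def N_def by (subst integral_distr) auto
    then show "cgf M (\<omega> 0) u = L u" by (simp add: cgf_def L_def)
  qed
  obtain a b where ab: "a < 0" "0 < b" "{a<..<b} \<subseteq> cgf_domain M (\<omega> 0)" using cgf_finite by blast
  obtain t1 where t1: "0 \<le> t1" "t1 \<in> interior (cgf_domain M (\<omega> 0))" "\<mu> < deriv (cgf M (\<omega> 0)) t1"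
    using slope[of 0] unfolding sup_cgf_deriv_def less_SUP_iff by auto
  obtain e where e: "e > 0" "ball t1 e \<subseteq> cgf_domain M (\<omega> 0)" using t1(2) by (auto simp: mem_interior)
  \<comment> \<open>Exponential moments exist on \<open>[- s, t1 + s]\<close>: on the left by
    \<open>cgf_finite\<close>, on the right because \<open>t1\<close> is an interior point of the
    domain, and in between by interpolation.\<close>
  define s where "s = min (- a / 2) (e / 2)"
  have s: "s > 0" "s \<le> - a / 2" "s \<le> e / 2" using ab e by (auto simp: s_def)
  have "- s \<in> {a<..<b}" using s ab by auto
  then have intm: "integrable N (\<lambda>y. exp (- s * y))" using ab(3) by (auto simp: cgf_domain_def int_iff)
  have "t1 + s \<in> ball t1 e" using s e by (simp add: dist_real_def)
  then have intp: "integrable N (\<lambda>y. exp ((t1 + s) * y))" using e(2) by (auto simp: cgf_domain_def int_iff)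
  have intE: "integrable N (\<lambda>y. exp (u * y))" if "- s \<le> u" "u \<le> t1 + s" for u
    by (rule integrable_exp_between[OF F.sets_N intm intp that])
  have Zpos: "Z u > 0" if "- s \<le> u" "u \<le> t1 + s" for u
  proof -
    have "Z u \<noteq> 0"
    proof
      assume "Z u = 0"
      then have "AE y in N. exp (u * y) = 0"
        unfolding Z_def using intE[OF that] by (subst (asm) integral_nonneg_eq_0_iff_AE) auto
      then show False by simp
    qed
    moreover have "Z u \<ge> 0" by (simp add: Z_def)
    ultimately show ?thesis by simp
  qed
  define g where "g u = (\<integral>y. y * exp (u * y) \<partial>N)" for u
  have dZ: "DERIV Z u :> g u" if "0 \<le> u" "u \<le> t1" for u
    using DERIV_mgf(1)[OF F.sets_N s(1), of 0 t1 u] intm intp that unfolding Z_def g_def by simp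
  have cg: "continuous_on {0..t1} g"
    using DERIV_mgf(2)[OF F.sets_N s(1), of 0 t1] intm intp unfolding g_def by simp
  have cZ: "continuous_on {0..t1} Z" using dZ by (intro DERIV_continuous_on) (auto intro: has_field_derivative_at_within)
  define f where "f u = g u / Z u" for u
  have dL: "DERIV L u :> f u" if "0 \<le> u" "u \<le> t1" for u
    unfolding L_def f_def using dZ[OF that] Zpos[of u] that s by (auto intro!: derivative_eq_intros)
  have cL: "continuous_on {0..t1} L" using dL by (intro DERIV_continuous_on) (auto intro: has_field_derivative_at_within)
  have cf: "continuous_on {0..t1} f"
    unfolding f_def using cg cZ Zpos s by (intro continuous_on_divide) (auto simp: less_imp_neq[symmetric])
  have L0: "L 0 = 0" by (simp add: L_def Z_def N.prob_space[unfolded F.space_N])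
  have ft1: "f t1 > \<mu>" using t1 DERIV_imp_deriv[OF dL[of t1]] by (simp add: cgfL)
  obtain r where r: "0 \<le> r" "r \<le> t1"
    and sel: "\<And>k. k > 0 \<Longrightarrow> \<exists>t\<in>{0..t1}. f t > \<mu> \<and> L t - t * f t \<ge> L r - r * \<mu> - k"
    using slope_selection[where L = L and f = f and \<mu> = \<mu>, OF t1(1) ft1 cL L0 cf] by auto

  \<comment> \<open>Mass below \<open>a0\<close> and above \<open>A1 > a0\<close> shows that the
    weights are not constant. The former comes from the time constant being below \<open>a0\<close>,
    the latter from the tilt by \<open>t1\<close>, whose slope exceeds \<open>A1\<close>.\<close>
  define A1 where "A1 = (\<mu> + f t1) / 2"
  have A1: "\<mu> < A1" "A1 < f t1" using ft1 by (auto simp: A1_def)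
  have "\<exists>h>0. h \<le> s \<and> exp (h * A1) * Z (t1 - h) < Z t1 \<and> exp (- h * (f t1 + 1)) * Z (t1 + h) < Z t1"
    by (rule tilt_window[OF L_def dL]) (use t1 A1 s Zpos in auto)
  then obtain h1 where h1: "h1 > 0" "h1 \<le> s" "exp (h1 * A1) * Z (t1 - h1) < Z t1" by blast
  have massA1: "measure N {A1..} > 0"
    by (rule tilt_imp_mass[OF F.prob_space_N F.sets_N _ _ h1(1), of t1]) (use h1 t1 s intE in \<open>auto simp: Z_def\<close>)
  define a0 where "a0 = (\<mu> + A1) / 2"
  have a0: "\<mu> < a0" "a0 < A1" using A1 by (auto simp: a0_def)
  note mass = F.marginal_mass_above_time_constant[OF time_constant]
  have intr: "integrable N (\<lambda>y. exp (r * y))" using r s by (intro intE) auto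
  obtain q where q: "q \<ge> 0" "q < 1" and pair: "\<And>x y. x \<noteq> y \<Longrightarrow>
     (\<integral>\<^sup>+w. ennreal (exp (r * \<omega> x w)) * indicator {w. \<omega> y w \<le> \<omega> x w} w \<partial>M) \<le> ennreal (q * Z r)"
    using F.pair_exponential_moment[OF intr a0(2) mass[OF a0(1)] massA1] unfolding Z_def by blast
  \<comment> \<open>As \<open>q\<close> may be 0, it is replaced by \<open>max q (1 / 2)\<close>
    before taking the logarithm.\<close>
  define l where "l = - ln (max q (1 / 2))"
  have qmax: "0 < max q (1 / 2)" "max q (1 / 2) < 1" using q by auto
  have l: "l > 0" using qmax unfolding l_def by (simp add: ln_less_zero)
  define e0 where "e0 = \<epsilon> * l"
  have e0: "e0 > 0" using eps l by (simp add: e0_def)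
  \<comment> \<open>Makes the loss \<open>r * \<delta> * D\<close> of the upper bound at most
    \<open>e0 / 4\<close>; the summand 1 covers \<open>r = 0\<close>.\<close>
  define \<delta> where "\<delta> = e0 / (4 * (r * D + 1))"
  have rD: "r * D + 1 > 0" using r D by (simp add: add_nonneg_pos)
  have \<delta>: "\<delta> > 0" using e0 rD by (simp add: \<delta>_def)
  have \<delta>r: "r * \<delta> * D \<le> e0 / 4"
  proof -
    have "r * \<delta> * D = e0 / 4 * (r * D / (r * D + 1))" using rD by (simp add: \<delta>_def field_simps)
    also have "\<dots> \<le> e0 / 4 * 1" using e0 rD by (intro mult_left_mono) (auto simp: divide_le_eq)
    finally show ?thesis by simp
  qed
  \<comment> \<open>\<open>\<kappa>\<close> is lost twice in each of the \<open>D\<close>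
    directions, for \<open>t\<close> in place of \<open>r\<close> and for \<open>B\<close> in place
    of \<open>f t\<close>, and once more in the bound for the corner path.\<close>
  define \<kappa> where "\<kappa> = e0 / (4 * (2 * D + 1))"
  have \<kappa>: "\<kappa> > 0" using e0 D by (simp add: \<kappa>_def)
  have \<kappa>e: "(2 * D + 1) * \<kappa> = e0 / 4"
  proof -
    have "x * (e0 / (4 * x)) = e0 / 4" if "x \<noteq> 0" for x using that by simp
    from this[of "2 * D + 1"] show ?thesis using D unfolding \<kappa>_def by linarith
  qed
  obtain t where t: "0 \<le> t" "t \<le> t1" "f t > \<mu>" "L t - t * f t \<ge> L r - r * \<mu> - \<kappa>" using sel[OF \<kappa>] by auto
  \<comment> \<open>\<open>A\<close> separates the speed \<open>\<mu>\<close> of excursions from the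
    tilted mean \<open>f t\<close>. \<open>B\<close> is just above \<open>f t\<close>, so undoing
    the tilt costs at most \<open>\<kappa>\<close> more per vertex than \<open>t * f t\<close>;
    dividing by \<open>t + 1\<close> covers \<open>t = 0\<close>.\<close>
  define A where "A = (\<mu> + f t) / 2"
  have A: "\<mu> < A" "A < f t" using t by (auto simp: A_def)
  define B where "B = f t + \<kappa> / (t + 1)"
  have B: "f t < B" using \<kappa> t by (simp add: B_def)
  have tB: "t * B \<le> t * f t + \<kappa>"
  proof -
    have "t * (\<kappa> / (t + 1)) = \<kappa> * (t / (t + 1))" by simp
    also have "\<dots> \<le> \<kappa> * 1" using \<kappa> t by (intro mult_left_mono) auto
    finally show ?thesis by (simp add: B_def distrib_left)
  qed
  have "\<exists>h>0. h \<le> s \<and> exp (h * A) * Z (t - h) < Z t \<and> exp (- h * B) * Z (t + h) < Z t"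
    by (rule tilt_window[OF L_def dL]) (use t A B s Zpos in auto)
  then obtain h where h: "h > 0" "h \<le> s" "exp (h * A) * Z (t - h) < Z t" "exp (- h * B) * Z (t + h) < Z t" by blast

  have Eabs: "(\<integral>\<^sup>+y. ennreal (exp (s * \<bar>y\<bar>)) \<partial>N) < \<infinity>"
  proof -
    have "integrable N (\<lambda>y. exp (s * y) + exp (- s * y))" using intE[of s] intm s t1 by simp
    then have "(\<integral>\<^sup>+y. ennreal (exp (s * y) + exp (- s * y)) \<partial>N) < \<infinity>"
      by (subst nn_integral_eq_integral) auto
    moreover have "(\<integral>\<^sup>+y. ennreal (exp (s * \<bar>y\<bar>)) \<partial>N) \<le> (\<integral>\<^sup>+y. ennreal (exp (s * y) + exp (- s * y)) \<partial>N)"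
      by (intro nn_integral_mono ennreal_leI) (auto simp: abs_if)
    ultimately show ?thesis by (rule le_less_trans[rotated])
  qed
  \<comment> \<open>Puts \<open>A * D - \<delta>0\<close> at the midpoint of \<open>A * D\<close>
    and \<open>\<mu> * D\<close>, hence still above the diagonal speed.\<close>
  define \<delta>0 where "\<delta>0 = (A - \<mu>) / 2 * D"
  have \<delta>0: "\<delta>0 > 0" using A D by (simp add: \<delta>0_def)
  have H: "(\<lambda>m. measure M {w \<in> space M. lpp (\<lambda>z. \<omega> z w) 0 (diag m) > (A * D - \<delta>0) * real m}) \<longlonglongrightarrow> 0"
  proof -
    have eq: "A * D - \<delta>0 = (A + \<mu>) / 2 * D" by (simp add: \<delta>0_def field_simps)
    show ?thesis unfolding eq unfolding D_def by (rule F.lpp_diag_limits(1)[OF time_constant]) (use A in simp)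
  qed
  have lower: "\<forall>\<^sub>F n in sequentially. exp (real n * (D * (ln (Z t) - t * B) - \<kappa>)) \<le>
     measure M {w \<in> space M. \<forall>\<gamma>'\<in>paths n. wt (\<lambda>z. \<omega> z w) \<gamma>' \<le> wt (\<lambda>z. \<omega> z w) (corner_path n)}"
    unfolding Z_def D_def
    by (rule corner_path_lower_bound[OF iid H[unfolded D_def] \<delta>0 s(1) Eabs mass[OF A(1)] t(1) h(1)])
       (use h t s \<kappa> intE in \<open>auto simp: Z_def\<close>)

  define Y where "Y = D * (L r - r * \<mu>)"
  \<comment> \<open>Large enough for the exceptional event of a small last passage time to be
    negligible even against the lower bound \<open>E0\<close>.\<close>
  define R where "R = \<bar>Y\<bar> + e0"
  have upper_tail: "\<forall>\<^sub>F n in sequentially.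
     measure M {w \<in> space M. \<omega> 0 w + lpp (\<lambda>z. \<omega> z w) 0 (diag n) < (\<mu> - \<delta>) * D * real n} \<le> exp (- R * real n)"
    unfolding D_def by (rule F.last_passage_lower_tail[OF dim time_constant \<delta> tail0(1,2) tail s(1) intm])
  define C where "C = max (Z r + 1) (2 / e0)"
  have Zr: "Z r > 0" using r s by (intro Zpos) auto
  have C: "C > 0" "Z r + 1 \<le> C" "1 / C \<le> e0 / 2"
  proof -
    show "C > 0" "Z r + 1 \<le> C" using Zr by (auto simp: C_def)
    have "2 / e0 \<le> C" by (simp add: C_def)
    then show "1 / C \<le> e0 / 2" using \<open>C > 0\<close> e0 by (simp add: field_simps)
  qed
  have geo: "\<gamma> \<in> geodesics \<omega> n w \<longleftrightarrow> (\<forall>\<gamma>'\<in>paths n. wt (\<lambda>z. \<omega> z w) \<gamma>' \<le> wt (\<lambda>z. \<omega> z w) \<gamma>)"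
    if "\<gamma> \<in> paths n" for \<gamma> n w
    using geodesics_iff[OF that, of \<omega> w] that by (simp add: passage_time_wt)
  show ?thesis
  proof (intro exI[of _ C] conjI C(1))
    show "\<forall>\<^sub>F n in sequentially. \<forall>\<gamma>\<in>paths n. real (card (corners \<gamma>)) > \<epsilon> * real n \<longrightarrow>
       measure M {w \<in> space M. \<gamma> \<in> geodesics \<omega> n w} / measure M {w \<in> space M. corner_path n \<in> geodesics \<omega> n w} \<le> C * exp (- real n / C)"
      using lower upper_tail
    proof eventually_elim
      case (elim n)
      show ?case
      proof (intro ballI impI)
        fix \<gamma> :: "(int, 'd) vec list"
        assume \<gamma>: "\<gamma> \<in> paths n" and cor: "real (card (corners \<gamma>)) > \<epsilon> * real n"
        \<comment> \<open>The yardstick for both bounds: the corner path stays above it, and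
          \<open>\<gamma>\<close> falls short of it by the factor
          \<open>exp (- (e0 / 2) * n)\<close> up to \<open>Z r + 1\<close>.\<close>
        define E0 where "E0 = exp (real n * (Y - e0 / 4))"
        have "Y - e0 / 4 \<le> D * (ln (Z t) - t * B) - \<kappa>"
        proof -
          have "D * (L r - r * \<mu> - 2 * \<kappa>) \<le> D * (L t - t * B)" using t(4) tB D by (intro mult_left_mono) auto
          then show ?thesis using \<kappa>e by (simp add: Y_def L_def algebra_simps)
        qed
        then have "E0 \<le> exp (real n * (D * (ln (Z t) - t * B) - \<kappa>))"
          unfolding E0_def by (simp add: mult_left_mono)
        also note elim(1)
        finally have low: "E0 \<le> measure M {w \<in> space M. corner_path n \<in> geodesics \<omega> n w}"
          by (simp add: geo[OF corner_path_in_paths])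
        define x where "x = (\<mu> - \<delta>) * D * real n"
        let ?E1 = "{w \<in> space M. x \<le> wt (\<lambda>z. \<omega> z w) \<gamma> \<and> (\<forall>\<gamma>'\<in>paths n. wt (\<lambda>z. \<omega> z w) \<gamma>' \<le> wt (\<lambda>z. \<omega> z w) \<gamma>)}"
        let ?E2 = "{w \<in> space M. \<omega> 0 w + lpp (\<lambda>z. \<omega> z w) 0 (diag n) < x}"
        \<comment> \<open>The passage time of a geodesic is the last passage time; hence either it
          is at least \<open>x\<close>, or the exceptional event occurs.\<close>
        have sub: "{w \<in> space M. \<gamma> \<in> geodesics \<omega> n w} \<subseteq> ?E1 \<union> ?E2"
        proof
          fix w assume w: "w \<in> {w \<in> space M. \<gamma> \<in> geodesics \<omega> n w}"
          let ?\<sigma> = "\<lambda>z. \<omega> z w"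
          have g: "\<forall>\<gamma>'\<in>paths n. wt ?\<sigma> \<gamma>' \<le> wt ?\<sigma> \<gamma>" using w geo[OF \<gamma>] by blast
          have "wt ?\<sigma> \<gamma> = last_passage_time \<omega> n w"
            using w passage_time_wt[OF \<gamma>, of \<omega> w] by (simp add: geodesics_def)
          then have "wt ?\<sigma> \<gamma> = \<omega> 0 w + lpp ?\<sigma> 0 (diag n)" by (simp add: last_passage_time_lpp)
          then show "w \<in> ?E1 \<union> ?E2" using w g by auto
        qed
        have mE1: "?E1 \<in> sets M"
        proof -
          have "{w \<in> space M. \<forall>\<gamma>'\<in>paths n. wt (\<lambda>z. \<omega> z w) \<gamma>' \<le> wt (\<lambda>z. \<omega> z w) \<gamma>} \<in> sets M"
            by (intro sets.sets_Collect_finite_All finite_paths) measurable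
          then show ?thesis by (intro sets.sets_Collect_conj) measurable
        qed
        have mE2: "?E2 \<in> sets M" by measurable
        have "measure M {w \<in> space M. \<gamma> \<in> geodesics \<omega> n w} \<le> measure M (?E1 \<union> ?E2)"
          using mE1 mE2 by (intro F.finite_measure_mono sub) auto
        also have "\<dots> \<le> measure M ?E1 + measure M ?E2" using mE1 mE2 by (rule measure_Un_le)
        also have "\<dots> \<le> Z r * exp (real n * (Y + e0 / 4 - e0)) + exp (- R * real n)"
        proof (rule add_mono)
          show "measure M ?E2 \<le> exp (- R * real n)" using elim(2) by (simp add: x_def)
          have "measure M ?E1 \<le> exp (- r * x) * Z r ^ length \<gamma> * q ^ card (corners \<gamma>)"
            unfolding Z_def by (rule F.geodesic_upper_bound[OF \<gamma> r(1) intr q(1) pair[unfolded Z_def]])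
          also have "\<dots> \<le> exp (- r * x) * Z r ^ length \<gamma> * exp (- e0 * real n)"
          proof (rule mult_left_mono)
            have "q ^ card (corners \<gamma>) \<le> max q (1 / 2) ^ card (corners \<gamma>)" using q by (intro power_mono) auto
            also have "\<dots> = exp (real (card (corners \<gamma>)) * ln (max q (1 / 2)))"
              unfolding exp_of_nat_mult using qmax by simp
            also have "\<dots> = exp (- (l * real (card (corners \<gamma>))))" by (simp add: l_def mult.commute)
            also have "\<dots> \<le> exp (- e0 * real n)"
            proof -
              have "l * (\<epsilon> * real n) \<le> l * real (card (corners \<gamma>))" using cor l by (intro mult_left_mono) auto
              then show ?thesis by (simp add: e0_def mult_ac)
            qed
            finally show "q ^ card (corners \<gamma>) \<le> exp (- e0 * real n)" .
          qed (use Zr in simp)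
          also have "Z r ^ length \<gamma> = Z r * exp (real n * (D * L r))"
          proof -
            have "length \<gamma> = Suc (CARD('d) * n)" by (rule paths_length[OF \<gamma>])
            moreover have "Z r ^ (CARD('d) * n) = exp (real (CARD('d) * n) * L r)"
              unfolding exp_of_nat_mult L_def using Zr by simp
            ultimately show ?thesis by (simp add: D_def mult_ac)
          qed
          also have "exp (- r * x) * (Z r * exp (real n * (D * L r))) * exp (- e0 * real n) =
              Z r * exp (real n * (Y + r * \<delta> * D - e0))"
          proof -
            have "real n * (Y + r * \<delta> * D - e0) = - r * x + real n * (D * L r) + - e0 * real n"
              by (simp add: Y_def x_def algebra_simps)
            then show ?thesis by (simp only: exp_add mult_ac)
          qed
          also have "\<dots> \<le> Z r * exp (real n * (Y + e0 / 4 - e0))"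
            using \<delta>r Zr by (intro mult_left_mono) (auto intro!: mult_left_mono)
          finally show "measure M ?E1 \<le> Z r * exp (real n * (Y + e0 / 4 - e0))" .
        qed
        also have "\<dots> \<le> Z r * (exp (- (e0 / 2) * real n) * E0) + exp (- (e0 / 2) * real n) * E0"
        proof (rule add_mono)
          show "Z r * exp (real n * (Y + e0 / 4 - e0)) \<le> Z r * (exp (- (e0 / 2) * real n) * E0)"
            unfolding E0_def exp_add[symmetric] using Zr by (simp add: algebra_simps)
          have "- R * real n \<le> (Y - e0 / 4 - e0 / 2) * real n"
            unfolding R_def using e0 by (intro mult_right_mono) auto
          then show "exp (- R * real n) \<le> exp (- (e0 / 2) * real n) * E0"
            unfolding E0_def exp_add[symmetric] by (simp add: algebra_simps)
        qed
        also have "\<dots> = (Z r + 1) * exp (- (e0 / 2) * real n) * E0" by (simp add: algebra_simps)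
        finally have up: "measure M {w \<in> space M. \<gamma> \<in> geodesics \<omega> n w} \<le> (Z r + 1) * exp (- (e0 / 2) * real n) * E0" .
        let ?P = "measure M {w \<in> space M. corner_path n \<in> geodesics \<omega> n w}"
        have E0: "E0 > 0" by (simp add: E0_def)
        have P: "?P > 0" using low E0 by linarith
        have "measure M {w \<in> space M. \<gamma> \<in> geodesics \<omega> n w} \<le> (Z r + 1) * exp (- (e0 / 2) * real n) * ?P"
          using up low Zr by (intro order_trans[OF up] mult_left_mono) auto
        also have "\<dots> \<le> C * exp (- real n / C) * ?P"
        proof (intro mult_right_mono mult_mono)
          have "1 / C * real n \<le> e0 / 2 * real n" using C(3) by (intro mult_right_mono) auto
          then show "exp (- (e0 / 2) * real n) \<le> exp (- real n / C)" by simp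
        qed (use C Zr in auto)
        finally show "measure M {w \<in> space M. \<gamma> \<in> geodesics \<omega> n w} / ?P \<le> C * exp (- real n / C)"
          using P by (simp add: divide_le_eq)
      qed
    qed
  qed
qed

end
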